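(* Let $\tau$ be a positive integer, $t=q^\tau$, and let $a_1,a_2,b_1,b_2\in\mathbb{C}^*$ satisfy $q<|a_1a_2b_1b_2t^{2i-2}|$ for $i=1,\ldots,n$. Then for all $x_1,x_2\in\mathbb{C}^*$ (with $x_ib_j\notin q^{\mathbb{Z}}$ for $i,j\in\{1,2\}$) $$ \frac{1}{n!}\int_{x_1\infty}^{x_2\infty}\!\!\!\cdots\int_{x_1\infty}^{x_2\infty} \prod_{i=1}^n z_i^{(n-1)\tau} \frac{(qa_1^{-1}z_i)_\infty}{(b_1z_i)_\infty} \frac{(qa_2^{-1}z_i)_\infty}{(b_2z_i)_\infty} \prod_{1\le j<k\le n} (z_j/z_k)_\tau(z_k/z_j)_\tau \,d_qz_1\cdots d_qz_n $$ $$ =C_0 \prod_{j=1}^n \frac{(x_1x_2q^{(j-1)\tau})^{(n-j)\tau}\,x_2\,\theta(x_1/x_2)\,\theta(x_1x_2b_1b_2q^{(n+j-2)\tau})} {\theta(x_1b_1q^{(j-1)\tau})\theta(x_1b_2q^{(j-1)\tau})\theta(x_2b_1q^{(j-1)\tau})\theta(x_2b_2q^{(j-1)\tau})}, $$ where $$ C_0=(1-q)^n\prod_{k=1}^n\frac{(q)_\infty(t)_\infty\prod_{i=1}^2\prod_{j=1}^2(qa_i^{-1}b_j^{-1}t^{-(k-1)})_\infty} {(t^{k})_\infty(qa_1^{-1}a_2^{-1}b_1^{-1}b_2^{-1}t^{-(n+k-2)})_\infty}. $$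
   Context: Fix $0<q<1$ and an integer $n\ge1$. Notation: $(a)_\infty=\prod_{i\ge0}(1-q^ia)$, $(a)_N=(a)_\infty/(q^Na)_\infty$, $\theta(a)=(a)_\infty(q/a)_\infty$. The bilateral Jackson integral is $\int_{a\infty}^{b\infty}f(z)\,d_qz=\int_0^{b\infty}f(z)\,d_qz-\int_0^{a\infty}f(z)\,d_qz$, where $\int_0^{a\infty}f(z)\,d_qz=(1-q)\sum_{\nu=-\infty}^{\infty}f(aq^\nu)\,aq^\nu$; the $n$-fold integral is the iterated one. *)

theory Defs
  imports "HOL-Analysis.Analysis"
begin

text \<open>The infinite \<open>q\<close>-shifted factorial \<open>(a)\<^sub>\<infinity>\<close>.\<close>

definition qinf :: "real \<Rightarrow> complex \<Rightarrow> complex" where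
  "qinf q a = (\<Prod>i. 1 - of_real q ^ i * a)"

text \<open>
  The finite \<open>q\<close>-shifted factorial \<open>(a)\<^sub>N\<close> for a natural number \<open>N\<close>.  The quotient
  \<open>(a)\<^sub>\<infinity> / (q\<^sup>N a)\<^sub>\<infinity>\<close> has removable singularities where \<open>q\<^sup>N a = q\<^sup>-\<^sup>m\<close> with \<open>m\<close> a natural
  number, and such values do occur in \<open>(z\<^sub>j / z\<^sub>k)\<^sub>N\<close> when \<open>z\<^sub>j\<close> and \<open>z\<^sub>k\<close> lie in the same
  \<open>q\<close>-lattice.  The finite product gives the intended value there; elsewhere it is the quotient,
  see \<open>qfin_eq_quotient\<close>.
\<close>

definition qfin :: "real \<Rightarrow> complex \<Rightarrow> nat \<Rightarrow> complex" where
  "qfin q a N = (\<Prod>i<N. 1 - of_real q ^ i * a)"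

definition qtheta :: "real \<Rightarrow> complex \<Rightarrow> complex" where
  "qtheta q a = qinf q a * qinf q (of_real q / a)"

lemma convergent_prod_qinf:
  assumes "0 < q" "q < 1"
  shows "convergent_prod (\<lambda>i. 1 - complex_of_real q ^ i * a)"
proof -
  have "summable (\<lambda>i. norm (- (complex_of_real q ^ i * a)))"
    using assms by (auto simp: norm_mult norm_power intro!: summable_mult2 summable_geometric)
  then have "abs_convergent_prod (\<lambda>i. 1 + - (complex_of_real q ^ i * a))"
    by (simp add: abs_convergent_prod_conv_summable)
  then show ?thesis
    by (simp add: abs_convergent_prod_imp_convergent_prod)
qed

lemma qinf_nonzero:
  assumes "0 < q" "q < 1" "\<And>i. of_real q ^ i * a \<noteq> 1"
  shows "qinf q a \<noteq> 0"
  unfolding qinf_def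
  using prodinf_nonzero[OF convergent_prod_qinf[OF assms(1,2), of a]] assms(3)
  by (metis eq_iff_diff_eq_0)

lemma qfin_mult_qinf:
  assumes "0 < q" "q < 1"
  shows "qfin q a N * qinf q (of_real q ^ N * a) = qinf q a"
proof (induction N)
  case (Suc N)
  define b where "b = complex_of_real q ^ N * a"
  have "qinf q b = (1 - b) * qinf q (of_real q * b)"
  proof -
    have lim: "(\<lambda>n. \<Prod>i\<le>n. 1 - complex_of_real q ^ i * c) \<longlonglongrightarrow> qinf q c" for c
      unfolding qinf_def by (rule convergent_prod_LIMSEQ[OF convergent_prod_qinf[OF assms]])
    have "(\<lambda>n. \<Prod>i\<le>Suc n. 1 - complex_of_real q ^ i * b) \<longlonglongrightarrow> qinf q b"
      by (rule LIMSEQ_Suc[OF lim])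
    moreover have "(\<Prod>i\<le>Suc n. 1 - complex_of_real q ^ i * b)
        = (1 - b) * (\<Prod>i\<le>n. 1 - complex_of_real q ^ i * (of_real q * b))" for n
      by (subst prod.atMost_Suc_shift) (simp add: mult_ac)
    moreover have "(\<lambda>n. (1 - b) * (\<Prod>i\<le>n. 1 - complex_of_real q ^ i * (of_real q * b)))
        \<longlonglongrightarrow> (1 - b) * qinf q (of_real q * b)"
      by (intro tendsto_intros lim)
    ultimately show ?thesis
      by (simp add: LIMSEQ_unique)
  qed
  with Suc show ?case
    by (simp add: qfin_def b_def mult_ac)
qed (simp add: qfin_def)

lemma qfin_eq_quotient:
  assumes "0 < q" "q < 1" "\<And>i. of_real q ^ i * (of_real q ^ N * a) \<noteq> 1"
  shows "qfin q a N = qinf q a / qinf q (of_real q ^ N * a)"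
  using qfin_mult_qinf[OF assms(1,2), of a N] qinf_nonzero[OF assms]
  by (simp add: eq_divide_eq)

text \<open>
  \<open>jackson0 q f a\<close> is the Jackson integral of \<open>f\<close> from \<open>0\<close> to \<open>a\<infinity>\<close>.  The bilateral sum is
  read as an unconditionally (for complex terms: absolutely) convergent one.
\<close>

definition jackson0 :: "real \<Rightarrow> (complex \<Rightarrow> complex) \<Rightarrow> complex \<Rightarrow> complex" where
  "jackson0 q f a =
     (1 - of_real q) * (\<Sum>\<^sub>\<infinity>\<nu>::int. f (a * of_real q powi \<nu>) * (a * of_real q powi \<nu>))"

definition jackson0_converges :: "real \<Rightarrow> (complex \<Rightarrow> complex) \<Rightarrow> complex \<Rightarrow> bool" where
  "jackson0_converges q f a \<longleftrightarrow>
     (\<lambda>\<nu>::int. f (a * of_real q powi \<nu>) * (a * of_real q powi \<nu>)) summable_on UNIV"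

definition jackson :: "real \<Rightarrow> complex \<Rightarrow> complex \<Rightarrow> (complex \<Rightarrow> complex) \<Rightarrow> complex" where
  "jackson q a b f = jackson0 q f b - jackson0 q f a"

definition jackson_converges :: "real \<Rightarrow> complex \<Rightarrow> complex \<Rightarrow> (complex \<Rightarrow> complex) \<Rightarrow> bool" where
  "jackson_converges q a b f \<longleftrightarrow> jackson0_converges q f a \<and> jackson0_converges q f b"

text \<open>
  \<open>jackson_iter q a b m F z\<close> integrates \<open>F\<close> over the coordinates \<open>z 1, \<dots>, z m\<close> (\<open>z 1\<close> innermost),
  each from \<open>a\<infinity>\<close> to \<open>b\<infinity>\<close>; the other coordinates keep their values in \<open>z\<close>.
\<close>

primrec jackson_iter ::
  "real \<Rightarrow> complex \<Rightarrow> complex \<Rightarrow> nat \<Rightarrow> ((nat \<Rightarrow> complex) \<Rightarrow> complex) \<Rightarrow> (nat \<Rightarrow> complex) \<Rightarrow> complex"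
where
  "jackson_iter q a b 0 F z = F z"
| "jackson_iter q a b (Suc m) F z =
     jackson q a b (\<lambda>w. jackson_iter q a b m F (z(Suc m := w)))"

text \<open>
  Every one-dimensional integral occurring in the iterated integral converges; the inner ones
  only matter at the points of the two \<open>q\<close>-lattices.
\<close>

primrec jackson_iter_converges ::
  "real \<Rightarrow> complex \<Rightarrow> complex \<Rightarrow> nat \<Rightarrow> ((nat \<Rightarrow> complex) \<Rightarrow> complex) \<Rightarrow> (nat \<Rightarrow> complex) \<Rightarrow> bool"
where
  "jackson_iter_converges q a b 0 F z \<longleftrightarrow> True"
| "jackson_iter_converges q a b (Suc m) F z \<longleftrightarrow>
     (\<forall>c\<in>{a, b}. \<forall>\<nu>::int. jackson_iter_converges q a b m F (z(Suc m := c * of_real q powi \<nu>))) \<and>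
     jackson_converges q a b (\<lambda>w. jackson_iter q a b m F (z(Suc m := w)))"

end

theory Submission
  imports Defs "HOL-Computational_Algebra.Polynomial"
begin

text \<open>
  Write \<open>w(z)\<close> for the one-variable weight, \<open>I\<close> for its integral, and \<open>u = a1 b1\<close>, \<open>v = a2 b1\<close>,
  \<open>p = a1 a2 b1 b2\<close>.  As \<open>(b1 z)\<^sub>k w(z)\<close> is the weight with \<open>b1\<close> replaced by \<open>b1 q\<^sup>k\<close>, telescoping a
  \<open>q\<close>-difference shows that its integral is \<open>I (u)\<^sub>k (v)\<^sub>k / (p)\<^sub>k\<close>, with a factor that does not
  depend on \<open>x1\<close> and \<open>x2\<close>.  For integral \<open>\<tau>\<close> the remaining part of the integrand is a polynomial;
  expanded in products of the shifted factorials of the \<open>b1 z\<^sub>i\<close> it turns the \<open>n\<close>-fold integral into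
  \<open>I\<^sup>n\<close> times a finite sum \<open>S(u, v, p)\<close>, so it remains to find \<open>I\<close> and \<open>S\<close>.

  For \<open>I\<close>, shifting \<open>a1\<close> and \<open>a2\<close> to infinity costs explicit factors, and for one special choice of
  \<open>a1, a2\<close> the weight is itself a \<open>q\<close>-difference whose boundary values at infinity are theta quotients.

  For \<open>S\<close>, the polynomial vanishes at the nodes \<open>q\<close> to the power \<open>-\<nu>\<^sub>i\<close> unless the \<open>\<nu>\<^sub>i\<close> are pairwise at
  distance at least \<open>\<tau>\<close>.  Hence only multi-indices \<open>k\<close> whose \<open>i\<close>-th smallest entry is at least
  \<open>(i - 1) \<tau>\<close> occur.  Together with degree bounds this makes \<open>S\<close>, times a known denominator, a
  polynomial in \<open>p\<close> of degree \<open>N = n (n - 1) \<tau>\<close>, and by the symmetry \<open>b1 \<leftrightarrow> b2\<close> of the integral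
  this polynomial is divisible by an explicit one of degree \<open>N\<close>.  The constant is the coefficient of
  \<open>p\<^sup>N\<close>, to which only the \<open>n!\<close> minimal multi-indices contribute.
\<close>

section \<open>Shifted factorials and bilateral sums\<close>

text \<open>Apart from the minimal ones, the coefficients of the kernel's expansion stay unknown;
  only their support matters, and its upper bounds are as important as the lower ones. The
  \<open>i\<close>-th smallest entry is at most \<open>(n + i - 2) \<tau>\<close>, so the product of
  the \<open>(p)\<close> of these lengths clears all denominators. The largest possible index is
  \<open>(2 n - 2) \<tau>\<close>, and \<open>q < |p t^(2n-2)|\<close> is the condition under which
  the integral still converges when \<open>b1\<close> is multiplied by \<open>q\<close> to that
  power. Divisibility arises thus: exchanging \<open>b1\<close> and \<open>b2\<close> turns
  \<open>u, v\<close> into \<open>p / v, p / u\<close>, and by the lower bounds every term of the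
  exchanged sum contains the same product of factorials of \<open>p / u\<close> and
  \<open>p / v\<close>. The exchange also costs a factor \<open>p^N\<close>, which is coprime to
  that product because the product equals 1 at \<open>p = 0\<close>. The symmetry of
  \<open>S\<close> follows from that of the integral only after division by \<open>I^n\<close>.
  Since \<open>S\<close> does not involve \<open>x1, x2\<close>, generic end points can be taken to
  make \<open>I\<close> nonzero. It also suffices to treat infinitely many large \<open>p\<close>
  with \<open>u, v\<close> fixed, because an identity of polynomials in \<open>p\<close> then
  extends to all \<open>p\<close>.\<close>

lemma qfin_0 [simp]: "qfin q a 0 = 1"
  by (simp add: qfin_def)

lemma qfin_Suc: "qfin q a (Suc N) = qfin q a N * (1 - of_real q ^ N * a)"
  by (simp add: qfin_def)

lemma qfin_add: "qfin q a (m + n) = qfin q a m * qfin q (of_real q ^ m * a) n"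
  by (induction n) (simp_all add: qfin_Suc power_add mult_ac)

lemma qfin_eq_0_iff: "qfin q a N = 0 \<longleftrightarrow> (\<exists>i<N. of_real q ^ i * a = 1)"
  by (auto simp: qfin_def)

text \<open>Read backwards, the product has the factors \<open>1 - y / q ^ (j + 1)\<close>, and each
  releases \<open>- y / q ^ (j + 1)\<close>. This gives the growth of shifted factorials along
  \<open>q ^ (- N)\<close>, on which the summability and the boundary values of the weight near
  infinity rest.\<close>

lemma qfin_reflect:
  assumes "q \<noteq> 0" "y \<noteq> 0"
  shows "qfin q (y / of_real q ^ N) N =
    (- y) ^ N * (\<Prod>j<N. inverse (of_real q ^ Suc j)) * qfin q (of_real q / y) N"
proof -
  have "qfin q (y / of_real q ^ N) N = (\<Prod>j<N. 1 - of_real q ^ (N - Suc j) * (y / of_real q ^ N))"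
    unfolding qfin_def
    by (rule prod.nat_diff_reindex[symmetric])
  also have "\<dots> = (\<Prod>j<N. (- y) * inverse (of_real q ^ Suc j) * (1 - of_real q ^ j * (of_real q / y)))"
  proof (rule prod.cong[OF refl])
    fix j assume "j \<in> {..<N}"
    then have "complex_of_real q ^ N = of_real q ^ (N - Suc j) * of_real q ^ Suc j"
      by (metis lessThan_iff Suc_leI le_add_diff_inverse2 power_add)
    then show "1 - of_real q ^ (N - Suc j) * (y / of_real q ^ N) =
        (- y) * inverse (of_real q ^ Suc j) * (1 - of_real q ^ j * (of_real q / y))"
      using assms by (simp add: field_simps)
  qed
  finally show ?thesis
    by (simp only: prod.distrib qfin_def prod_constant card_lessThan)
qed

section \<open>Unconditional sums: dominated convergence, splitting over the integers,
  telescoping\<close>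

lemma infsum_dominated_convergence:
  fixes f :: "nat \<Rightarrow> 'a \<Rightarrow> complex"
  assumes g: "g summable_on UNIV"
    and bound: "\<And>K x. norm (f K x) \<le> g x"
    and lim: "\<And>x. (\<lambda>K. f K x) \<longlonglongrightarrow> F x"
  shows "(\<lambda>K. infsum (f K) UNIV) \<longlonglongrightarrow> infsum F UNIV"
proof -
  have F_bound: "norm (F x) \<le> g x" for x
    using Lim_bounded[OF tendsto_norm[OF lim[of x]], of 0 "g x"] bound by simp
  have f_sum: "f K summable_on S" for K S
    by (rule abs_summable_summable, rule summable_on_comparison_test[OF summable_on_subset_banach[OF g]])
       (auto intro: bound)
  have F_sum: "F summable_on S" for S
    by (rule abs_summable_summable, rule summable_on_comparison_test[OF summable_on_subset_banach[OF g]])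
       (auto intro: F_bound)
  show ?thesis
  proof (rule LIMSEQ_I)
    fix e :: real assume e: "e > 0"
    obtain A where A: "finite A" "\<bar>sum g A - infsum g UNIV\<bar> \<le> e / 4"
      using infsum_finite_approximation[OF g, of "e / 4"] e by (auto simp: dist_real_def)
    have "infsum g UNIV = sum g A + infsum g (- A)"
      using infsum_Un_disjoint[of g A "- A"] A(1) summable_on_subset_banach[OF g, of "- A"] by simp
    with A(2) have tail: "infsum g (- A) \<le> e / 4"
      by linarith
    have tail_bound: "norm (infsum h (- A)) \<le> e / 4" if "\<And>x. norm (h x) \<le> g x" for h :: "'a \<Rightarrow> complex"
    proof -
      have "h summable_on (- A)"
        by (rule abs_summable_summable, rule summable_on_comparison_test[OF summable_on_subset_banach[OF g]])
          (auto intro: that)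
      then have "norm (infsum h (- A)) \<le> infsum g (- A)"
        using that by (intro norm_infsum_le[OF has_sum_infsum has_sum_infsum] summable_on_subset_banach[OF g]) auto
      with tail show ?thesis by simp
    qed
    have "(\<lambda>K. sum (f K) A) \<longlonglongrightarrow> sum F A"
      by (intro tendsto_sum lim)
    then obtain K0 where K0: "\<And>K. K \<ge> K0 \<Longrightarrow> norm (sum (f K) A - sum F A) < e / 4"
      using LIMSEQ_D[of _ _ "e / 4"] e by (metis divide_pos_pos zero_less_numeral)
    show "\<exists>K0. \<forall>K\<ge>K0. norm (infsum (f K) UNIV - infsum F UNIV) < e"
    proof (intro exI allI impI)
      fix K assume "K \<ge> K0"
      have split: "infsum h UNIV = sum h A + infsum h (- A)" if "\<And>S. h summable_on S" for h :: "'a \<Rightarrow> complex"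
        using infsum_Un_disjoint[of h A "- A"] A(1) that by simp
      have "infsum (f K) UNIV - infsum F UNIV =
          (sum (f K) A - sum F A) + infsum (f K) (- A) - infsum F (- A)"
        by (subst (1 2) split) (auto simp: f_sum F_sum)
      also have "norm \<dots> \<le> norm (sum (f K) A - sum F A) + norm (infsum (f K) (- A)) + norm (infsum F (- A))"
        by norm
      also have "\<dots> < e / 4 + e / 4 + e / 4"
        using K0[OF \<open>K \<ge> K0\<close>] tail_bound[of "f K"] tail_bound[of F] bound F_bound by fastforce
      finally show "norm (infsum (f K) UNIV - infsum F UNIV) < e"
        using e by simp
    qed
  qed
qed

lemma UNIV_int_split: "(UNIV :: int set) = range int \<union> range (\<lambda>n. - int (Suc n))"
proof -
  have "x \<in> range int \<union> range (\<lambda>n. - int (Suc n))" for x :: int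
    by (cases x rule: int_cases) auto
  then show ?thesis by auto
qed

lemma summable_on_int_split:
  fixes f :: "int \<Rightarrow> 'a::banach"
  assumes "(\<lambda>n. f (int n)) summable_on UNIV" "(\<lambda>n. f (- int (Suc n))) summable_on UNIV"
  shows "f summable_on UNIV"
proof -
  have "f summable_on range int"
    using assms(1) by (subst summable_on_reindex) (auto simp: o_def)
  moreover have "f summable_on range (\<lambda>n. - int (Suc n))"
    using assms(2) by (subst summable_on_reindex) (auto simp: o_def inj_on_def)
  ultimately show ?thesis
    unfolding UNIV_int_split by (intro summable_on_Un_disjoint) auto
qed

lemma infsum_int_split:
  fixes f :: "int \<Rightarrow> complex"
  assumes "f summable_on UNIV"
  shows "infsum f UNIV = (\<Sum>\<^sub>\<infinity>n. f (int n)) + (\<Sum>\<^sub>\<infinity>n. f (- int (Suc n)))"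
proof -
  have "infsum f UNIV = infsum f (range int) + infsum f (range (\<lambda>n. - int (Suc n)))"
    unfolding UNIV_int_split
    by (rule infsum_Un_disjoint) (auto intro: summable_on_subset_banach[OF assms])
  then show ?thesis
    by (simp add: infsum_reindex inj_on_def o_def)
qed

text \<open>On a lattice \<open>x * q powi \<nu>\<close> with \<open>q < 1\<close>, large indices
  approach 0 and large negative ones approach infinity, so \<open>A\<close> and \<open>B\<close>
  become the boundary values at 0 and at infinity. Both are kept because \<open>g\<close> may have
  nonzero limits, as it does in the applications.\<close>

lemma infsum_telescope_int:
  fixes g :: "int \<Rightarrow> complex"
  assumes sum: "(\<lambda>\<nu>. g \<nu> - g (\<nu> + 1)) summable_on UNIV"
    and A: "(\<lambda>n. g (int n)) \<longlonglongrightarrow> A"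
    and B: "(\<lambda>n. g (- int n)) \<longlonglongrightarrow> B"
  shows "(\<Sum>\<^sub>\<infinity>\<nu>. g \<nu> - g (\<nu> + 1)) = B - A"
proof -
  let ?f = "\<lambda>\<nu>. g \<nu> - g (\<nu> + 1)"
  have s1: "(\<lambda>n. ?f (int n)) summable_on UNIV"
    using summable_on_reindex[of int UNIV ?f] summable_on_subset_banach[OF sum, of "range int"]
    by (simp add: o_def)
  have s2: "(\<lambda>n. ?f (- int (Suc n))) summable_on UNIV"
    using summable_on_reindex[of "\<lambda>n. - int (Suc n)" UNIV ?f]
      summable_on_subset_banach[OF sum, of "range (\<lambda>n. - int (Suc n))"]
    by (simp add: o_def inj_on_def)
  have "(\<lambda>n. g (int n) - g (int (Suc n))) sums (g 0 - A)"
    using telescope_sums'[OF A] by simp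
  then have 1: "(\<Sum>\<^sub>\<infinity>n. ?f (int n)) = g 0 - A"
    using has_sum_imp_sums[OF has_sum_infsum[OF s1]] by (simp add: add.commute sums_iff)
  have "(\<lambda>n. g (- int (Suc n)) - g (- int n)) sums (B - g 0)"
    using telescope_sums[OF B] by simp
  then have 2: "(\<Sum>\<^sub>\<infinity>n. ?f (- int (Suc n))) = B - g 0"
    using has_sum_imp_sums[OF has_sum_infsum[OF s2]] by (simp add: sums_iff)
  show ?thesis
    using infsum_int_split[OF sum] 1 2 by simp
qed

section \<open>Infinite products: majorants, continuity at 0, zeros, growth\<close>

context
  fixes q :: real
  assumes q: "0 < q" "q < 1"
begin

lemma qfin_tendsto_qinf: "(\<lambda>N. qfin q a N) \<longlonglongrightarrow> qinf q a"
proof -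
  have "(\<lambda>n. \<Prod>i\<le>n. 1 - complex_of_real q ^ i * a) \<longlonglongrightarrow> qinf q a"
    unfolding qinf_def by (rule convergent_prod_LIMSEQ[OF convergent_prod_qinf[OF q]])
  then have "(\<lambda>n. qfin q a (Suc n)) \<longlonglongrightarrow> qinf q a"
    by (simp add: qfin_def lessThan_Suc_atMost)
  then show ?thesis
    by (rule LIMSEQ_imp_Suc)
qed

lemma qinf_shift: "qinf q a = (1 - a) * qinf q (of_real q * a)"
  using qfin_mult_qinf[OF q, of a 1] by (simp add: qfin_Suc)

lemma qinf_0 [simp]: "qinf q 0 = 1"
  by (simp add: qinf_def)

text \<open>Each factor \<open>1 - q ^ i * a\<close> with \<open>norm a \<le> r\<close> is largest
  in norm at the negative real point \<open>- r\<close>. Products taken there majorise the weight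
  uniformly over all parameters of bounded norm.\<close>

lemma norm_qfin_le: "norm a \<le> r \<Longrightarrow> norm (qfin q a N) \<le> norm (qfin q (of_real (- r)) N)"
  unfolding qfin_def prod_norm[symmetric]
proof (rule prod_mono)
  fix i assume r: "norm a \<le> r"
  have "norm (1 - complex_of_real q ^ i * a) \<le> 1 + q ^ i * norm a"
    using norm_triangle_ineq4[of 1 "complex_of_real q ^ i * a"] q by (simp add: norm_mult norm_power)
  also have "\<dots> \<le> 1 + q ^ i * r"
    using q r by (simp add: mult_left_mono)
  also have "\<dots> = norm (complex_of_real (1 + q ^ i * r))"
    using r q order_trans[OF norm_ge_zero r] by (subst norm_of_real) auto
  finally show "0 \<le> norm (1 - complex_of_real q ^ i * a) \<and>
      norm (1 - complex_of_real q ^ i * a) \<le> norm (1 - complex_of_real q ^ i * complex_of_real (- r))"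
    by simp
qed

lemma norm_qinf_le: "norm a \<le> r \<Longrightarrow> norm (qinf q a) \<le> norm (qinf q (of_real (- r)))"
  by (rule tendsto_le[OF _ tendsto_norm[OF qfin_tendsto_qinf] tendsto_norm[OF qfin_tendsto_qinf]])
     (use norm_qfin_le in \<open>auto intro!: always_eventually\<close>)

text \<open>Comparison with the exponential of a geometric series. The bound is uniform in
  \<open>N\<close> and tends to 0 with \<open>a\<close>; passing to the limit gives continuity of
  the infinite product at 0, the only continuity of it that is used.\<close>

lemma norm_qfin_minus_1_le: "norm (qfin q a N - 1) \<le> exp (norm a / (1 - q)) - 1"
proof -
  have "norm (qfin q a N - 1) = norm ((\<Prod>i<N. 1 + - (of_real q ^ i * a)) - 1)"
    by (simp add: qfin_def)
  also have "\<dots> \<le> (\<Prod>i<N. 1 + norm (- (complex_of_real q ^ i * a))) - 1"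
    by (rule norm_prod_minus1_le_prod_minus1)
  also have "\<dots> \<le> (\<Prod>i<N. exp (q ^ i * norm a)) - 1"
    using q by (intro diff_right_mono prod_mono) (auto simp: norm_mult norm_power intro!: exp_ge_add_one_self)
  also have "\<dots> = exp (\<Sum>i<N. q ^ i * norm a) - 1"
    by (simp add: exp_sum)
  also have "(\<Sum>i<N. q ^ i * norm a) = (\<Sum>i<N. q ^ i) * norm a"
    by (simp add: sum_distrib_right)
  also have "\<dots> \<le> (1 / (1 - q)) * norm a"
  proof (rule mult_right_mono)
    have "(\<Sum>i<N. q ^ i) \<le> (\<Sum>i. q ^ i)"
      using q by (intro sum_le_suminf summable_geometric) auto
    then show "(\<Sum>i<N. q ^ i) \<le> 1 / (1 - q)"
      using q by (simp add: suminf_geometric)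
  qed auto
  finally show ?thesis by simp
qed

lemma norm_qinf_minus_1_le: "norm (qinf q a - 1) \<le> exp (norm a / (1 - q)) - 1"
  by (rule Lim_bounded[OF tendsto_norm[OF tendsto_diff[OF qfin_tendsto_qinf tendsto_const]]])
     (use norm_qfin_minus_1_le in blast)

lemma tendsto_qinf_0:
  assumes "(g \<longlongrightarrow> 0) F"
  shows "((\<lambda>x. qinf q (g x)) \<longlongrightarrow> 1) F"
proof -
  have "((\<lambda>x. exp (norm (g x) / (1 - q)) - 1) \<longlongrightarrow> exp (norm (0::complex) / (1 - q)) - 1) F"
    using q by (intro tendsto_diff tendsto_const tendsto_exp tendsto_divide tendsto_norm assms) auto
  then have lim: "((\<lambda>x. exp (norm (g x) / (1 - q)) - 1) \<longlongrightarrow> 0) F"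
    by simp
  have "((\<lambda>x. qinf q (g x) - 1) \<longlongrightarrow> 0) F"
    by (rule Lim_null_comparison[OF always_eventually lim]) (use norm_qinf_minus_1_le in blast)
  then show ?thesis
    by (simp add: LIM_zero_iff)
qed

lemma qinf_eq_0_iff: "qinf q a = 0 \<longleftrightarrow> (\<exists>i. of_real q ^ i * a = 1)"
proof
  assume "qinf q a = 0"
  then show "\<exists>i. of_real q ^ i * a = 1"
    using qinf_nonzero[OF q, of a] by auto
next
  assume "\<exists>i. of_real q ^ i * a = 1"
  then obtain i where "of_real q ^ i * a = 1" by auto
  then have "qfin q a (Suc i) = 0"
    by (auto simp: qfin_eq_0_iff)
  then show "qinf q a = 0"
    using qfin_mult_qinf[OF q, of a "Suc i"] by auto
qed

text \<open>Along \<open>y / q ^ N\<close> the infinite product is a monomial, times a Gaussian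
  factor in \<open>N\<close>, times a convergent part. A quotient with equally many such products
  above and below loses the Gaussian factor.\<close>

lemma qinf_div_power:
  assumes "y \<noteq> 0"
  shows "qinf q (y / of_real q ^ N) =
    qinf q y * ((- y) ^ N * (\<Prod>j<N. inverse (of_real q ^ Suc j)) * qfin q (of_real q / y) N)"
  using qfin_mult_qinf[OF q, of "y / of_real q ^ N" N] qfin_reflect[of q y N] q assms by (simp add: mult_ac)

end

section \<open>The weight function\<close>

text \<open>The parameters \<open>c1, c2\<close> are the inverses of \<open>a1, a2\<close>, so that \<open>a1 = \<infinity>\<close> becomes \<open>c1 = 0\<close>.\<close>

definition wt :: "real \<Rightarrow> complex \<Rightarrow> complex \<Rightarrow> complex \<Rightarrow> complex \<Rightarrow> complex \<Rightarrow> complex" where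
  "wt q c1 c2 b1 b2 z =
     qinf q (of_real q * c1 * z) / qinf q (b1 * z) * (qinf q (of_real q * c2 * z) / qinf q (b2 * z))"

definition off_lattice :: "real \<Rightarrow> complex \<Rightarrow> bool" where
  "off_lattice q y \<longleftrightarrow> (\<forall>m::int. y \<noteq> of_real q powi m)"

text \<open>The numerators of \<open>wt\<close> are replaced by their largest values for
  \<open>norm c1 \<le> C1\<close> and \<open>norm c2 \<le> C2\<close>, so that one majorant serves a
  whole sequence of parameters. The factor \<open>norm z\<close> comes from the Jackson
  measure.\<close>

definition wt_bound :: "real \<Rightarrow> real \<Rightarrow> real \<Rightarrow> complex \<Rightarrow> complex \<Rightarrow> complex \<Rightarrow> real" where
  "wt_bound q C1 C2 b1 b2 z =
     norm z * (norm (qinf q (of_real (- (q * C1 * norm z)))) * norm (qinf q (of_real (- (q * C2 * norm z)))))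
       / (norm (qinf q (b1 * z)) * norm (qinf q (b2 * z)))"

lemma summable_on_convergent_mult_power:
  fixes A :: "nat \<Rightarrow> real"
  assumes "convergent A" "0 \<le> r" "r < 1"
  shows "(\<lambda>n. A n * r ^ n) summable_on UNIV"
proof (rule norm_summable_imp_summable_on)
  obtain B where B: "\<And>n. norm (A n) \<le> B"
    using convergent_imp_Bseq[OF assms(1)] by (auto simp: Bseq_def)
  show "summable (\<lambda>n. norm (A n * r ^ n))"
  proof (rule summable_comparison_test)
    show "summable (\<lambda>n. B * r ^ n)"
      using assms by (intro summable_mult summable_geometric) auto
    show "\<exists>N. \<forall>n\<ge>N. norm (norm (A n * r ^ n)) \<le> B * r ^ n"
      using assms B by (auto simp: abs_mult intro!: mult_right_mono)
  qed
qed

lemma wt_commute_c: "wt q c1 c2 b1 b2 z = wt q c2 c1 b1 b2 z"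
  by (simp add: wt_def)

lemma wt_commute_b: "wt q c1 c2 b1 b2 z = wt q c1 c2 b2 b1 z"
  by (simp add: wt_def)

context
  fixes q :: real
  assumes q: "0 < q" "q < 1"
begin

lemma off_lattice_mult_powi:
  assumes "off_lattice q y"
  shows "off_lattice q (y * of_real q powi k)"
  unfolding off_lattice_def
proof (intro allI notI)
  fix m :: int
  assume "y * of_real q powi k = of_real q powi m"
  then have "y = of_real q powi (m - k)"
    using q by (simp add: power_int_diff field_simps)
  with assms show False
    unfolding off_lattice_def by blast
qed

lemma off_lattice_mult_power: "off_lattice q y \<Longrightarrow> off_lattice q (y * of_real q ^ k)"
  using off_lattice_mult_powi[of y "int k"] by simp

lemma qinf_off_lattice:
  assumes "off_lattice q y"
  shows "qinf q y \<noteq> 0"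
proof
  assume "qinf q y = 0"
  then obtain i where "of_real q ^ i * y = 1"
    using qinf_eq_0_iff[OF q] by auto
  then have "y = of_real q powi (- int i)"
    using q by (simp add: power_int_minus field_simps)
  with assms show False
    unfolding off_lattice_def by blast
qed

lemma off_lattice_div:
  assumes "off_lattice q y"
  shows "off_lattice q (of_real q / y)"
  unfolding off_lattice_def
proof (intro allI notI)
  fix m :: int
  assume "of_real q / y = of_real q powi m"
  then have "y = of_real q powi (1 - m)"
    using q by (cases "y = 0") (auto simp: power_int_diff field_simps)
  with assms show False
    unfolding off_lattice_def by blast
qed

lemma qinf_lattice_nonzero:
  assumes "off_lattice q (x * b)"
  shows "qinf q (b * (x * of_real q powi k)) \<noteq> 0"
  using qinf_off_lattice[OF off_lattice_mult_powi[OF assms, of k]] by (simp add: mult_ac)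

lemma norm_wt_le:
  assumes "norm c1 \<le> C1" "norm c2 \<le> C2"
  shows "norm (wt q c1 c2 b1 b2 z * z) \<le> wt_bound q C1 C2 b1 b2 z"
proof -
  have le: "norm (qinf q (of_real q * c * z)) \<le> norm (qinf q (of_real (- (q * C * norm z))))"
    if "norm c \<le> C" for c C
    using that q by (intro norm_qinf_le[OF q]) (auto simp: norm_mult intro!: mult_mono intro: order_trans[OF norm_ge_zero])
  have "norm (wt q c1 c2 b1 b2 z * z) =
      norm z * (norm (qinf q (of_real q * c1 * z)) * norm (qinf q (of_real q * c2 * z)))
       / (norm (qinf q (b1 * z)) * norm (qinf q (b2 * z)))"
    by (simp add: wt_def norm_mult norm_divide)
  also have "\<dots> \<le> wt_bound q C1 C2 b1 b2 z"
    unfolding wt_bound_def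
    by (intro divide_right_mono mult_left_mono mult_mono le assms) auto
  finally show ?thesis .
qed

lemma norm_qinf_div_power:
  assumes "y \<noteq> 0"
  shows "norm (qinf q (y / of_real q ^ N)) =
    norm (qinf q y) * (norm y ^ N * (\<Prod>j<N. inverse (q ^ Suc j)) * norm (qfin q (of_real q / y) N))"
  using q by (simp add: qinf_div_power[OF q assms] norm_mult norm_power norm_inverse prod_norm[symmetric]
      del: power_Suc)

text \<open>Towards 0 the products tend to 1 and the measure decays geometrically. Towards infinity
  the Gaussian factors of two numerators and two denominators cancel, leaving a convergent sequence
  times a geometric one. The numerator arguments must be nonzero for this splitting, whence
  \<open>C1 > 0\<close> and \<open>C2 > 0\<close>.\<close>

lemma wt_bound_summable:
  assumes C: "C1 > 0" "C2 > 0" "q * C1 * C2 < norm (b1 * b2)"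
    and nz: "b1 \<noteq> 0" "b2 \<noteq> 0" "x \<noteq> 0"
    and off: "off_lattice q (x * b1)" "off_lattice q (x * b2)"
  shows "(\<lambda>\<nu>::int. wt_bound q C1 C2 b1 b2 (x * of_real q powi \<nu>)) summable_on UNIV"
proof (rule summable_on_int_split)
  define X where "X = norm x"
  have X: "X > 0" using nz by (simp add: X_def)
  let ?A = "\<lambda>n. X * (norm (qinf q (of_real (- (q * C1 * X * q ^ n)))) * norm (qinf q (of_real (- (q * C2 * X * q ^ n)))))
       / (norm (qinf q (b1 * (x * of_real q ^ n))) * norm (qinf q (b2 * (x * of_real q ^ n))))"
  have eq: "wt_bound q C1 C2 b1 b2 (x * of_real q powi int n) = ?A n * q ^ n" for n
    using q by (simp add: wt_bound_def X_def norm_mult norm_power mult_ac)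
  have q0: "(\<lambda>n. q ^ n) \<longlonglongrightarrow> 0" "(\<lambda>n. complex_of_real q ^ n) \<longlonglongrightarrow> 0"
    using q by (auto intro!: LIMSEQ_power_zero)
  have l1: "(\<lambda>n. complex_of_real (- (q * C * X * q ^ n))) \<longlonglongrightarrow> 0" for C
    using tendsto_of_real[OF tendsto_minus[OF tendsto_mult_right_zero[OF q0(1), of "q * C * X"]], where ?'a=complex]
    by simp
  have l2: "(\<lambda>n. b * (x * complex_of_real q ^ n)) \<longlonglongrightarrow> 0" for b
    by (intro tendsto_mult_right_zero q0)
  have "?A \<longlonglongrightarrow> X * (norm (1::complex) * norm (1::complex)) / (norm (1::complex) * norm (1::complex))"
    by (intro tendsto_divide tendsto_mult tendsto_norm tendsto_const tendsto_qinf_0[OF q] l1 l2) auto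
  then show "(\<lambda>n. wt_bound q C1 C2 b1 b2 (x * of_real q powi int n)) summable_on UNIV"
    unfolding eq using q by (intro summable_on_convergent_mult_power convergentI) auto

  \<comment> \<open>The numerators contribute \<open>q ^ 2 * C1 * C2\<close> per lattice step, and
    the measure \<open>norm z = X / q ^ n\<close> takes one power of \<open>q\<close> back.\<close>
  define r where "r = q * C1 * C2 / norm (b1 * b2)"
  have r: "0 \<le> r" "r < 1"
    using C q nz by (auto simp: r_def)
  let ?F = "\<lambda>C n. norm (qinf q (of_real (- (q * C * X)))) * norm (qfin q (of_real q / of_real (- (q * C * X))) n)"
  let ?G = "\<lambda>b n. norm (qinf q (b * x)) * norm (qfin q (of_real q / (b * x)) n)"
  let ?B = "\<lambda>n. X * (?F C1 n * ?F C2 n) / (?G b1 n * ?G b2 n)"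
  have F: "norm (qinf q (of_real (- (q * C * norm (x / of_real q ^ n))))) =
      ?F C n * ((q * C * X) ^ n * (\<Prod>j<n. inverse (q ^ Suc j)))" if "C > 0" for C n
  proof -
    have "complex_of_real (- (q * C * norm (x / of_real q ^ n))) = of_real (- (q * C * X)) / of_real q ^ n"
      using q by (simp add: X_def norm_divide norm_power)
    moreover have "norm (complex_of_real (- (q * C * X))) = q * C * X"
      using q X that by (simp add: norm_mult)
    ultimately show ?thesis
      using norm_qinf_div_power[of "complex_of_real (- (q * C * X))" n] q X that
      by (simp only: mult_ac) simp
  qed
  have G: "norm (qinf q (b * (x / of_real q ^ n))) =
      ?G b n * ((norm b * X) ^ n * (\<Prod>j<n. inverse (q ^ Suc j)))" if "b \<noteq> 0" for b n
    using norm_qinf_div_power[of "b * x" n] nz that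
    by (simp add: X_def norm_mult mult_ac)
  have eq: "wt_bound q C1 C2 b1 b2 (x * of_real q powi (- int n)) = ?B n * r ^ n" for n
  proof -
    have z: "x * of_real q powi (- int n) = x / of_real q ^ n"
      by (simp add: power_int_minus field_simps)
    have tri: "(\<Prod>j<n. inverse (q ^ Suc j)) \<noteq> 0"
      using q by simp
    have rn: "r ^ n = ((q * C1 * X) ^ n * (q * C2 * X) ^ n) / (q ^ n * ((norm b1 * X) ^ n * (norm b2 * X) ^ n))"
      using q X nz by (simp add: r_def power_mult_distrib power_divide norm_mult field_simps)
    have nx: "norm (x / of_real q ^ n) = X / q ^ n"
      using q by (simp add: X_def norm_divide norm_power)
    show ?thesis
      unfolding z wt_bound_def F[OF C(1)] F[OF C(2)] G[OF nz(1)] G[OF nz(2)] rn unfolding nx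
      using tri by (simp add: divide_simps)
  qed
  have G0: "norm (qinf q (b * x)) * norm (qinf q (of_real q / (b * x))) \<noteq> 0" if "off_lattice q (x * b)" for b
    using qinf_off_lattice[OF that] qinf_off_lattice[OF off_lattice_div[OF that]] by (simp add: mult_ac)
  have "?B \<longlonglongrightarrow> X * ((norm (qinf q (of_real (- (q * C1 * X)))) * norm (qinf q (of_real q / of_real (- (q * C1 * X)))))
        * (norm (qinf q (of_real (- (q * C2 * X)))) * norm (qinf q (of_real q / of_real (- (q * C2 * X)))))) /
      ((norm (qinf q (b1 * x)) * norm (qinf q (of_real q / (b1 * x)))) *
       (norm (qinf q (b2 * x)) * norm (qinf q (of_real q / (b2 * x)))))"
    using G0[OF off(1)] G0[OF off(2)]
    by (intro tendsto_divide tendsto_mult tendsto_norm tendsto_const qfin_tendsto_qinf[OF q]) auto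
  then have "convergent (\<lambda>n. ?B (Suc n) * r)"
    by (intro convergentI[OF tendsto_mult[OF LIMSEQ_Suc tendsto_const]])
  from summable_on_convergent_mult_power[OF this r]
  show "(\<lambda>n. wt_bound q C1 C2 b1 b2 (x * of_real q powi (- int (Suc n)))) summable_on UNIV"
    unfolding eq by (simp add: mult_ac)
qed

text \<open>A strict inequality survives a small enlargement of both norms. The enlargement makes
  the majorant available for zero parameters as well, which occur in the limit
  \<open>c1 = 0\<close>.\<close>

lemma exists_majorant_constants:
  fixes c1 c2 :: complex
  assumes "q * norm (c1 * c2) < B"
  obtains C1 C2 where "C1 > 0" "C2 > 0" "q * C1 * C2 < B" "norm c1 \<le> C1" "norm c2 \<le> C2"
proof -
  have "((\<lambda>e. q * (norm c1 + e) * (norm c2 + e)) \<longlongrightarrow> q * (norm c1 + 0) * (norm c2 + 0)) (at_right 0)"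
    by (intro tendsto_intros)
  then have "eventually (\<lambda>e. q * (norm c1 + e) * (norm c2 + e) < B) (at_right 0)"
    using assms by (intro order_tendstoD) (auto simp: norm_mult mult_ac)
  moreover have "eventually (\<lambda>e::real. e > 0) (at_right 0)"
    by (simp add: eventually_at_right_less)
  ultimately have "eventually (\<lambda>e. q * (norm c1 + e) * (norm c2 + e) < B \<and> e > 0) (at_right 0)"
    by (rule eventually_conj)
  then obtain e where "q * (norm c1 + e) * (norm c2 + e) < B" "e > 0"
    using eventually_happens'[OF trivial_limit_at_right_real] by blast
  then show thesis
    by (intro that[of "norm c1 + e" "norm c2 + e"]) (auto intro: add_nonneg_pos)
qed

lemma wt_summable:
  assumes "q * norm (c1 * c2) < norm (b1 * b2)" "b1 \<noteq> 0" "b2 \<noteq> 0" "x \<noteq> 0"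
    and "off_lattice q (x * b1)" "off_lattice q (x * b2)"
  shows "(\<lambda>\<nu>::int. wt q c1 c2 b1 b2 (x * of_real q powi \<nu>) * (x * of_real q powi \<nu>)) summable_on UNIV"
proof -
  obtain C1 C2 where C: "C1 > 0" "C2 > 0" "q * C1 * C2 < norm (b1 * b2)" "norm c1 \<le> C1" "norm c2 \<le> C2"
    using exists_majorant_constants[OF assms(1)] by metis
  show ?thesis
    by (rule abs_summable_summable,
        rule summable_on_comparison_test[OF wt_bound_summable[OF C(1-3) assms(2-)]])
       (auto intro: norm_wt_le[OF C(4,5)])
qed

end

section \<open>Recurrences for the one-dimensional integral\<close>

definition lattice_sum :: "real \<Rightarrow> (complex \<Rightarrow> complex) \<Rightarrow> complex \<Rightarrow> complex" where
  "lattice_sum q f x = (\<Sum>\<^sub>\<infinity>\<nu>::int. f (x * of_real q powi \<nu>) * (x * of_real q powi \<nu>))"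

lemma summable_on_diff_complex:
  fixes f g :: "'a \<Rightarrow> complex"
  assumes "f summable_on A" "g summable_on A"
  shows "(\<lambda>x. f x - g x) summable_on A"
  using summable_on_add[OF assms(1), of "\<lambda>x. - g x"] assms(2) by (simp add: summable_on_uminus)

context
  fixes q :: real
  assumes q: "0 < q" "q < 1"
begin

lemma wt_shift_b1:
  assumes "qinf q (b1 * z) \<noteq> 0"
  shows "wt q c1 c2 (b1 * of_real q) b2 z = (1 - b1 * z) * wt q c1 c2 b1 b2 z"
proof -
  have "qinf q (b1 * z) = (1 - b1 * z) * qinf q (b1 * of_real q * z)"
    using qinf_shift[OF q, of "b1 * z"] by (simp add: mult_ac)
  moreover from this have "1 - b1 * z \<noteq> 0"
    using assms by auto
  ultimately show ?thesis
    by (simp add: wt_def)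
qed

lemma wt_shift_c1: "wt q c1 c2 b1 b2 z = (1 - of_real q * c1 * z) * wt q (of_real q * c1) c2 b1 b2 z"
proof -
  have "qinf q (of_real q * c1 * z) = (1 - of_real q * c1 * z) * qinf q (of_real q * (of_real q * c1) * z)"
    using qinf_shift[OF q, of "of_real q * c1 * z"] by (simp add: mult_ac)
  then show ?thesis
    by (simp add: wt_def)
qed

text \<open>The Pearson type q-difference equation of the weight: passing from \<open>z\<close> to
  \<open>q * z\<close> removes one factor from each of the four infinite products.\<close>

lemma wt_qdiff:
  assumes "qinf q (b1 * z) \<noteq> 0" "qinf q (b2 * z) \<noteq> 0"
  shows "(1 - c1 * (of_real q * z)) * (1 - c2 * (of_real q * z)) * wt q c1 c2 b1 b2 (of_real q * z) =
    (1 - b1 * z) * (1 - b2 * z) * wt q c1 c2 b1 b2 z"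
proof -
  define B where "B b = qinf q (b * (of_real q * z))" for b
  define C where "C c = qinf q (of_real q * c * (of_real q * z))" for c
  have b: "qinf q (b * z) = (1 - b * z) * B b" for b
    using qinf_shift[OF q, of "b * z"] by (simp add: B_def mult_ac)
  have c: "qinf q (of_real q * c * z) = (1 - c * (of_real q * z)) * C c" for c
    using qinf_shift[OF q, of "c * (of_real q * z)"] by (simp add: C_def mult_ac)
  have nz: "1 - b1 * z \<noteq> 0" "1 - b2 * z \<noteq> 0" "B b1 \<noteq> 0" "B b2 \<noteq> 0"
    using b[of b1] b[of b2] assms by auto
  have "wt q c1 c2 b1 b2 (of_real q * z) = C c1 * C c2 / (B b1 * B b2)"
    by (simp add: wt_def B_def C_def)
  moreover have "(1 - b1 * z) * (1 - b2 * z) * wt q c1 c2 b1 b2 z =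
      (1 - c1 * (of_real q * z)) * (1 - c2 * (of_real q * z)) * (C c1 * C c2 / (B b1 * B b2))"
    unfolding wt_def b[of b1] b[of b2] c[of c1] c[of c2] using nz(1,2) by simp
  ultimately show ?thesis
    by simp
qed

lemma lattice_tendsto_0: "(\<lambda>n. b * (x * complex_of_real q powi int n)) \<longlonglongrightarrow> 0"
proof -
  have "(\<lambda>n. complex_of_real q ^ n) \<longlonglongrightarrow> 0"
    using q by (intro LIMSEQ_power_zero) auto
  then show ?thesis
    by (simp add: tendsto_mult_right_zero)
qed

lemma wt_tendsto_1: "(\<lambda>n. wt q c1 c2 b1 b2 (x * of_real q powi int n)) \<longlonglongrightarrow> 1"
proof -
  have "(\<lambda>n. wt q c1 c2 b1 b2 (x * of_real q powi int n)) \<longlonglongrightarrow> 1 / 1 * (1 / 1)"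
    unfolding wt_def
    by (intro tendsto_mult tendsto_divide tendsto_qinf_0[OF q] lattice_tendsto_0) auto
  then show ?thesis by simp
qed

text \<open>By \<open>wt_qdiff\<close>, \<open>f (q * z)\<close> is
  \<open>(1 - b1 * z) * (1 - b2 * z)\<close> times the weight at \<open>z\<close>. In
  \<open>f z - f (q * z)\<close> the constant terms cancel, so one factor \<open>z\<close> splits
  off and plays the part of the Jackson measure; the rest is \<open>g\<close>. The value of
  \<open>f\<close> at 0 is 1.\<close>

lemma lattice_sum_telescope:
  fixes c1 c2 b1 b2 x B :: complex
  defines "f \<equiv> \<lambda>z. (1 - c1 * z) * (1 - c2 * z) * wt q c1 c2 b1 b2 z"
  defines "g \<equiv> \<lambda>z. ((b1 + b2 - c1 - c2) + (c1 * c2 - b1 * b2) * z) * wt q c1 c2 b1 b2 z"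
  assumes off: "off_lattice q (x * b1)" "off_lattice q (x * b2)"
    and sum: "(\<lambda>\<nu>::int. g (x * of_real q powi \<nu>) * (x * of_real q powi \<nu>)) summable_on UNIV"
    and B: "(\<lambda>n. f (x * of_real q powi (- int n))) \<longlonglongrightarrow> B"
  shows "lattice_sum q g x = B - 1"
proof -
  let ?z = "\<lambda>\<nu>::int. x * of_real q powi \<nu>"
  have eq: "g (?z \<nu>) * ?z \<nu> = f (?z \<nu>) - f (?z (\<nu> + 1))" for \<nu>
  proof -
    have z: "?z (\<nu> + 1) = of_real q * ?z \<nu>"
      using q by (simp add: power_int_add_1)
    have "f (?z (\<nu> + 1)) = (1 - b1 * ?z \<nu>) * (1 - b2 * ?z \<nu>) * wt q c1 c2 b1 b2 (?z \<nu>)"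
      unfolding f_def z
      by (rule wt_qdiff) (use qinf_lattice_nonzero[OF q] off in auto)
    then show ?thesis
      by (simp add: f_def g_def algebra_simps)
  qed
  have "(\<lambda>n. f (?z (int n))) \<longlonglongrightarrow> (1 - 0) * (1 - 0) * 1"
    unfolding f_def by (intro tendsto_mult tendsto_diff tendsto_const lattice_tendsto_0 wt_tendsto_1)
  then have A: "(\<lambda>n. f (?z (int n))) \<longlonglongrightarrow> 1"
    by simp
  show ?thesis
    using infsum_telescope_int[OF _ A B] sum unfolding lattice_sum_def eq by blast
qed

context
  fixes x1 x2 :: complex
  assumes x: "x1 \<noteq> 0" "x2 \<noteq> 0"
begin

definition admissible :: "complex \<Rightarrow> complex \<Rightarrow> bool" where
  "admissible b1 b2 \<longleftrightarrow> b1 \<noteq> 0 \<and> b2 \<noteq> 0 \<and>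
     (\<forall>x\<in>{x1, x2}. \<forall>b\<in>{b1, b2}. off_lattice q (x * b))"

text \<open>The factor \<open>1 - q\<close> of the Jackson integral is left out;
  \<open>jackson_wt\<close> restores it.\<close>

definition wint :: "complex \<Rightarrow> complex \<Rightarrow> complex \<Rightarrow> complex \<Rightarrow> complex" where
  "wint c1 c2 b1 b2 = lattice_sum q (wt q c1 c2 b1 b2) x2 - lattice_sum q (wt q c1 c2 b1 b2) x1"

lemma admissible_commute: "admissible b1 b2 \<longleftrightarrow> admissible b2 b1"
  by (auto simp: admissible_def)

lemma admissible_shift: "admissible b1 b2 \<Longrightarrow> admissible (b1 * of_real q ^ k) b2"
  using off_lattice_mult_power[OF q] q by (auto simp: admissible_def mult.assoc[symmetric])

lemma wint_commute_c: "wint c1 c2 b1 b2 = wint c2 c1 b1 b2"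
proof -
  have "wt q c1 c2 b1 b2 = wt q c2 c1 b1 b2"
    by (rule ext) (rule wt_commute_c)
  then show ?thesis by (simp only: wint_def)
qed

lemma wint_commute_b: "wint c1 c2 b1 b2 = wint c1 c2 b2 b1"
proof -
  have "wt q c1 c2 b1 b2 = wt q c1 c2 b2 b1"
    by (rule ext) (rule wt_commute_b)
  then show ?thesis by (simp only: wint_def)
qed

lemma wt_summable_admissible:
  assumes "admissible b1 b2" "x \<in> {x1, x2}" "q * norm (c1 * c2) < norm (b1 * b2)"
  shows "(\<lambda>\<nu>::int. wt q c1 c2 b1 b2 (x * of_real q powi \<nu>) * (x * of_real q powi \<nu>)) summable_on UNIV"
  using assms x by (intro wt_summable[OF q]) (auto simp: admissible_def)

text \<open>\<open>z\<close> times the weight is a combination of the weights with \<open>b1\<close>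
  and with \<open>b1 * q\<close>. The latter is the one that needs the stronger condition, without
  the factor \<open>q\<close>.\<close>

lemma wt_moment_summable:
  assumes adm: "admissible b1 b2" "x \<in> {x1, x2}" and conv: "norm (c1 * c2) < norm (b1 * b2)"
  shows "(\<lambda>\<nu>::int. (x * of_real q powi \<nu>) * wt q c1 c2 b1 b2 (x * of_real q powi \<nu>) * (x * of_real q powi \<nu>))
      summable_on UNIV"
proof -
  let ?z = "\<lambda>\<nu>::int. x * of_real q powi \<nu>"
  have b1: "b1 \<noteq> 0" and off: "off_lattice q (x * b1)"
    using adm by (auto simp: admissible_def)
  have eq: "?z \<nu> * wt q c1 c2 b1 b2 (?z \<nu>) * ?z \<nu> =
     inverse b1 * (wt q c1 c2 b1 b2 (?z \<nu>) * ?z \<nu> - wt q c1 c2 (b1 * of_real q) b2 (?z \<nu>) * ?z \<nu>)" for \<nu>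
    unfolding wt_shift_b1[OF qinf_lattice_nonzero[OF q off]] using b1 by (simp add: algebra_simps)
  have "q * norm (c1 * c2) \<le> norm (c1 * c2)"
    using q by (intro mult_left_le_one_le) auto
  then have s1: "q * norm (c1 * c2) < norm (b1 * b2)"
    using conv by linarith
  have s2: "q * norm (c1 * c2) < norm (b1 * of_real q * b2)"
    using conv q by (simp add: norm_mult mult_ac)
  show ?thesis
    unfolding eq
    by (intro summable_on_cmult_right summable_on_diff_complex wt_summable_admissible adm s1 s2
        admissible_shift[where k=1, simplified])
qed

text \<open>Telescoping on each lattice gives the same constant \<open>- 1\<close>, contributed by
  the point 0, which disappears in the difference between \<open>x2\<close> and \<open>x1\<close>.
  Nothing comes from infinity under the stronger convergence condition.\<close>

lemma wint_moment:
  assumes adm: "admissible b1 b2" and conv: "norm (c1 * c2) < norm (b1 * b2)"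
  shows "(c1 * c2 - b1 * b2) * (lattice_sum q (\<lambda>z. z * wt q c1 c2 b1 b2 z) x2
       - lattice_sum q (\<lambda>z. z * wt q c1 c2 b1 b2 z) x1) = - (b1 + b2 - c1 - c2) * wint c1 c2 b1 b2"
proof -
  let ?M = "lattice_sum q (\<lambda>z. z * wt q c1 c2 b1 b2 z)" and ?I = "lattice_sum q (wt q c1 c2 b1 b2)"
  have "q * norm (c1 * c2) \<le> norm (c1 * c2)"
    using q by (intro mult_left_le_one_le) auto
  then have conv': "q * norm (c1 * c2) < norm (b1 * b2)"
    using conv by linarith
  have "(b1 + b2 - c1 - c2) * ?I x + (c1 * c2 - b1 * b2) * ?M x = - 1" if xx: "x \<in> {x1, x2}" for x
  proof -
    let ?z = "\<lambda>\<nu>::int. x * of_real q powi \<nu>"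
    let ?w = "wt q c1 c2 b1 b2"
    let ?g = "\<lambda>z. ((b1 + b2 - c1 - c2) + (c1 * c2 - b1 * b2) * z) * ?w z"
    let ?f = "\<lambda>z. (1 - c1 * z) * (1 - c2 * z) * ?w z"
    note s0 = wt_summable_admissible[OF adm xx conv']
    note s1 = wt_moment_summable[OF adm xx conv]
    have eq: "?g (?z \<nu>) * ?z \<nu> = (b1 + b2 - c1 - c2) * (?w (?z \<nu>) * ?z \<nu>)
        + (c1 * c2 - b1 * b2) * (?z \<nu> * ?w (?z \<nu>) * ?z \<nu>)" for \<nu>
      by (simp add: algebra_simps)
    have sum: "(\<lambda>\<nu>::int. ?g (?z \<nu>) * ?z \<nu>) summable_on UNIV"
      unfolding eq by (intro summable_on_add summable_on_cmult_right s0 s1)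
    \<comment> \<open>The boundary value at infinity needs no asymptotics: it is a combination of
      terms of summable families, and these tend to 0.\<close>
    have lim: "(\<lambda>n. h (- int n)) \<longlonglongrightarrow> 0" if "h summable_on UNIV" for h :: "int \<Rightarrow> complex"
    proof -
      have "h summable_on range (\<lambda>n. - int n)"
        using summable_on_subset_banach[OF that] by auto
      then have "(\<lambda>n. h (- int n)) summable_on UNIV"
        by (subst (asm) summable_on_reindex) (auto simp: o_def inj_on_def)
      then show ?thesis
        by (intro summable_LIMSEQ_zero summable_on_imp_summable)
    qed
    have xnz: "x \<noteq> 0"
      using xx x by auto
    have "(\<lambda>n. inverse x * of_real q ^ n * (?w (?z (- int n)) * ?z (- int n))) \<longlonglongrightarrow> inverse x * 0 * 0"
      using q by (intro tendsto_mult tendsto_const lim[OF s0] LIMSEQ_power_zero) auto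
    moreover have "inverse x * of_real q ^ n * (?w (?z (- int n)) * ?z (- int n)) = ?w (?z (- int n))" for n
      using q xnz by (simp add: power_int_minus field_simps)
    ultimately have l0: "(\<lambda>n. ?w (?z (- int n))) \<longlonglongrightarrow> 0"
      by simp
    have f_eq: "?f z = ?w z - (c1 + c2) * (?w z * z) + c1 * c2 * (z * ?w z * z)" for z
      by (simp add: algebra_simps)
    have "(\<lambda>n. ?f (?z (- int n))) \<longlonglongrightarrow> 0 - (c1 + c2) * 0 + c1 * c2 * 0"
      unfolding f_eq by (intro tendsto_add tendsto_diff tendsto_mult tendsto_const l0 lim[OF s0] lim[OF s1])
    then have "lattice_sum q ?g x = 0 - 1"
      using adm xx by (intro lattice_sum_telescope[OF _ _ sum]) (auto simp: admissible_def)
    moreover have "lattice_sum q ?g x = (b1 + b2 - c1 - c2) * ?I x + (c1 * c2 - b1 * b2) * ?M x"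
      unfolding lattice_sum_def eq
      by (subst infsum_add) (auto intro!: summable_on_cmult_right s0 s1 simp: infsum_cmult_right s0 s1)
    ultimately show ?thesis by simp
  qed
  from this[of x1, simplified] this[of x2, simplified] show ?thesis
    unfolding wint_def by algebra
qed

lemma lattice_sum_diff:
  assumes "(\<lambda>\<nu>::int. f (x * of_real q powi \<nu>) * (x * of_real q powi \<nu>)) summable_on UNIV"
    and "(\<lambda>\<nu>::int. g (x * of_real q powi \<nu>) * (x * of_real q powi \<nu>)) summable_on UNIV"
  shows "lattice_sum q (\<lambda>z. f z - c * g z) x = lattice_sum q f x - c * lattice_sum q g x"
  unfolding lattice_sum_def
proof -
  let ?z = "\<lambda>\<nu>::int. x * of_real q powi \<nu>"
  have "(\<Sum>\<^sub>\<infinity>\<nu>. (f (?z \<nu>) - c * g (?z \<nu>)) * ?z \<nu>) = (\<Sum>\<^sub>\<infinity>\<nu>. f (?z \<nu>) * ?z \<nu> + (- c) * (g (?z \<nu>) * ?z \<nu>))"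
    by (simp add: algebra_simps)
  also have "\<dots> = (\<Sum>\<^sub>\<infinity>\<nu>. f (?z \<nu>) * ?z \<nu>) + (- c) * (\<Sum>\<^sub>\<infinity>\<nu>. g (?z \<nu>) * ?z \<nu>)"
    using assms by (subst infsum_add) (auto intro!: summable_on_cmult_right simp only: infsum_cmult_right)
  finally show "(\<Sum>\<^sub>\<infinity>\<nu>. (f (?z \<nu>) - c * g (?z \<nu>)) * ?z \<nu>) =
      (\<Sum>\<^sub>\<infinity>\<nu>. f (?z \<nu>) * ?z \<nu>) - c * (\<Sum>\<^sub>\<infinity>\<nu>. g (?z \<nu>) * ?z \<nu>)"
    by simp
qed

text \<open>The shifted integral is the integral minus \<open>b1\<close> times the first moment.
  Eliminating the moment with \<open>wint_moment\<close> leaves a quadratic in \<open>b1\<close>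
  that factors as \<open>- (b1 - c1) * (b1 - c2)\<close>.\<close>

lemma wint_shift_b1:
  assumes adm: "admissible b1 b2" and conv: "norm (c1 * c2) < norm (b1 * b2)"
  shows "(b1 * b2 - c1 * c2) * wint c1 c2 (b1 * of_real q) b2 = - (b1 - c1) * (b1 - c2) * wint c1 c2 b1 b2"
proof -
  have "q * norm (c1 * c2) \<le> norm (c1 * c2)"
    using q by (intro mult_left_le_one_le) auto
  then have conv': "q * norm (c1 * c2) < norm (b1 * b2)"
    using conv by linarith
  have ls: "lattice_sum q (wt q c1 c2 (b1 * of_real q) b2) x =
      lattice_sum q (wt q c1 c2 b1 b2) x - b1 * lattice_sum q (\<lambda>z. z * wt q c1 c2 b1 b2 z) x"
    if xx: "x \<in> {x1, x2}" for x
  proof -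
    have off: "off_lattice q (x * b1)"
      using adm xx by (auto simp: admissible_def)
    have "lattice_sum q (wt q c1 c2 (b1 * of_real q) b2) x =
        lattice_sum q (\<lambda>z. wt q c1 c2 b1 b2 z - b1 * (z * wt q c1 c2 b1 b2 z)) x"
      unfolding lattice_sum_def wt_shift_b1[OF qinf_lattice_nonzero[OF q off]]
      by (simp add: algebra_simps)
    also have "\<dots> = lattice_sum q (wt q c1 c2 b1 b2) x - b1 * lattice_sum q (\<lambda>z. z * wt q c1 c2 b1 b2 z) x"
      by (intro lattice_sum_diff wt_summable_admissible wt_moment_summable adm xx conv conv')
    finally show ?thesis .
  qed
  define M where "M = lattice_sum q (\<lambda>z. z * wt q c1 c2 b1 b2 z) x2 - lattice_sum q (\<lambda>z. z * wt q c1 c2 b1 b2 z) x1"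
  have "wint c1 c2 (b1 * of_real q) b2 = wint c1 c2 b1 b2 - b1 * M"
    using ls[of x1] ls[of x2] by (simp add: wint_def M_def algebra_simps)
  moreover have "(c1 * c2 - b1 * b2) * M = - (b1 + b2 - c1 - c2) * wint c1 c2 b1 b2"
    unfolding M_def by (rule wint_moment[OF adm conv])
  ultimately show ?thesis
    by algebra
qed

text \<open>Same elimination, with the moment taken at the parameter \<open>q * c1\<close>; there
  the weaker convergence condition at \<open>c1\<close> becomes exactly the one required by
  \<open>wint_moment\<close>.\<close>

lemma wint_shift_c1:
  assumes adm: "admissible b1 b2" and conv: "q * norm (c1 * c2) < norm (b1 * b2)"
  shows "(b1 * b2 - of_real q * c1 * c2) * wint c1 c2 b1 b2 =
    (b1 - of_real q * c1) * (b2 - of_real q * c1) * wint (of_real q * c1) c2 b1 b2"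
proof -
  define d where "d = complex_of_real q * c1"
  have conv1: "norm (d * c2) < norm (b1 * b2)"
    using conv q by (simp add: d_def norm_mult mult_ac)
  have "q * norm (d * c2) \<le> norm (d * c2)"
    using q by (intro mult_left_le_one_le) auto
  then have conv': "q * norm (d * c2) < norm (b1 * b2)"
    using conv1 by linarith
  have ls: "lattice_sum q (wt q c1 c2 b1 b2) x =
      lattice_sum q (wt q d c2 b1 b2) x - d * lattice_sum q (\<lambda>z. z * wt q d c2 b1 b2 z) x"
    if xx: "x \<in> {x1, x2}" for x
  proof -
    have "wt q c1 c2 b1 b2 = (\<lambda>z. wt q d c2 b1 b2 z - d * (z * wt q d c2 b1 b2 z))"
      by (rule ext, subst wt_shift_c1) (simp add: d_def algebra_simps)
    then show ?thesis
      by (simp only:) (intro lattice_sum_diff wt_summable_admissible wt_moment_summable adm xx conv1 conv')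
  qed
  define M where "M = lattice_sum q (\<lambda>z. z * wt q d c2 b1 b2 z) x2 - lattice_sum q (\<lambda>z. z * wt q d c2 b1 b2 z) x1"
  have "wint c1 c2 b1 b2 = wint d c2 b1 b2 - d * M"
    using ls[of x1] ls[of x2] by (simp add: wint_def M_def algebra_simps)
  moreover have "(d * c2 - b1 * b2) * M = - (b1 + b2 - d - c2) * wint d c2 b1 b2"
    unfolding M_def by (rule wint_moment[OF adm conv1])
  ultimately show ?thesis
    unfolding d_def[symmetric] by algebra
qed

end

end

section \<open>Evaluation of the one-dimensional integral\<close>

context
  fixes q :: real
  assumes q: "0 < q" "q < 1"
begin

lemma qtheta_shift:
  assumes "y \<noteq> 0"
  shows "qtheta q (of_real q * y) = - qtheta q y / y"
proof -
  have "y * qinf q (1 / y) = (y - 1) * qinf q (of_real q / y)"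
    using qinf_shift[OF q, of "1 / y"] assms by (simp add: field_simps)
  moreover have "qinf q y = (1 - y) * qinf q (of_real q * y)"
    by (rule qinf_shift[OF q])
  ultimately have "y * qinf q (1 / y) * qinf q (of_real q * y) = - (qinf q y * qinf q (of_real q / y))"
    by algebra
  then show ?thesis
    using assms q by (simp add: qtheta_def field_simps)
qed

lemma qtheta_reflect: "y \<noteq> 0 \<Longrightarrow> qtheta q (of_real q / y) = qtheta q y"
  using q by (simp add: qtheta_def)

lemma qtheta_off_lattice: "off_lattice q y \<Longrightarrow> qtheta q y \<noteq> 0"
  using qinf_off_lattice[OF q] off_lattice_div[OF q] by (simp add: qtheta_def)

lemma qtheta_q: "qtheta q (of_real q) = 0"
  using q qinf_shift[OF q, of 1] by (simp add: qtheta_def)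

text \<open>The powers of \<open>x\<close> produced by the quasi-periodicity cancel because \<open>c1 * c2 = b1 * b2\<close>.\<close>

lemma theta_quotient_limit:
  fixes c1 c2 b1 b2 x :: complex
  assumes nz: "b1 \<noteq> 0" "b2 \<noteq> 0" "c1 \<noteq> 0" "c2 \<noteq> 0" "x \<noteq> 0" and eq: "c1 * c2 = b1 * b2"
    and off: "off_lattice q (x * b1)" "off_lattice q (x * b2)"
  shows "(\<lambda>n. (1 - c1 * (x * of_real q powi (- int n))) * (1 - c2 * (x * of_real q powi (- int n)))
        * wt q c1 c2 b1 b2 (x * of_real q powi (- int n)))
     \<longlonglongrightarrow> qtheta q (c1 * x) * qtheta q (c2 * x) / (qtheta q (b1 * x) * qtheta q (b2 * x))"
proof -
  let ?F = "\<lambda>c n. qinf q (c * x) * qfin q (of_real q / (c * x)) n"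
  have eq': "(1 - c1 * (x * of_real q powi (- int n))) * (1 - c2 * (x * of_real q powi (- int n)))
        * wt q c1 c2 b1 b2 (x * of_real q powi (- int n)) = ?F c1 n * ?F c2 n / (?F b1 n * ?F b2 n)" for n
  proof -
    define z where "z = x / of_real q ^ n"
    define T where "T = (\<Prod>j<n. inverse (complex_of_real q ^ Suc j))"
    have z: "x * of_real q powi (- int n) = z"
      by (simp add: z_def power_int_minus field_simps)
    have F: "qinf q (c * z) = (- (c * x)) ^ n * T * ?F c n" if "c \<noteq> 0" for c
      using qinf_div_power[OF q, of "c * x" n] nz that by (simp add: z_def T_def mult_ac)
    have c: "(1 - c * z) * qinf q (of_real q * c * z) = qinf q (c * z)" for c
      using qinf_shift[OF q, of "c * z"] by (simp add: mult_ac)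
    have "(1 - c1 * z) * (1 - c2 * z) * wt q c1 c2 b1 b2 z =
        ((1 - c1 * z) * qinf q (of_real q * c1 * z)) * ((1 - c2 * z) * qinf q (of_real q * c2 * z))
          / (qinf q (b1 * z) * qinf q (b2 * z))"
      by (simp add: wt_def)
    also have "\<dots> = ((- (c1 * x)) ^ n * (- (c2 * x)) ^ n * T * T * (?F c1 n * ?F c2 n))
        / ((- (b1 * x)) ^ n * (- (b2 * x)) ^ n * T * T * (?F b1 n * ?F b2 n))"
      unfolding c F[OF nz(1)] F[OF nz(2)] F[OF nz(3)] F[OF nz(4)] by (simp add: mult_ac)
    also have "(- (c1 * x)) ^ n * (- (c2 * x)) ^ n = (- (b1 * x)) ^ n * (- (b2 * x)) ^ n"
    proof -
      have "(- (c1 * x)) * (- (c2 * x)) = (- (b1 * x)) * (- (b2 * x))"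
        using eq by algebra
      then show ?thesis
        by (simp only: power_mult_distrib[symmetric])
    qed
    also have "(- (b1 * x)) ^ n * (- (b2 * x)) ^ n * T * T * (?F c1 n * ?F c2 n)
        / ((- (b1 * x)) ^ n * (- (b2 * x)) ^ n * T * T * (?F b1 n * ?F b2 n))
        = ?F c1 n * ?F c2 n / (?F b1 n * ?F b2 n)"
      using nz q by (subst mult_divide_mult_cancel_left) (auto simp: T_def)
    finally show ?thesis unfolding z .
  qed
  have lim: "?F c \<longlonglongrightarrow> qtheta q (c * x)" for c
    unfolding qtheta_def by (intro tendsto_mult tendsto_const qfin_tendsto_qinf[OF q])
  have "qtheta q (b1 * x) \<noteq> 0" "qtheta q (b2 * x) \<noteq> 0"
    using off by (auto intro!: qtheta_off_lattice simp: mult.commute)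
  then show ?thesis
    unfolding eq' by (intro tendsto_divide tendsto_mult lim) auto
qed

section \<open>Sending \<open>a1\<close> and \<open>a2\<close> to infinity, and the remaining
  integral\<close>

context
  fixes x1 x2 :: complex
  assumes x: "x1 \<noteq> 0" "x2 \<noteq> 0"
begin

lemma wint_c1_iterate:
  assumes adm: "admissible q x1 x2 b1 b2" and conv: "q * norm (c1 * c2) < norm (b1 * b2)"
  shows "qfin q (of_real q * c1 * c2 / (b1 * b2)) K * wint q x1 x2 c1 c2 b1 b2 =
    qfin q (of_real q * c1 / b1) K * qfin q (of_real q * c1 / b2) K * wint q x1 x2 (of_real q ^ K * c1) c2 b1 b2"
proof (induction K)
  case (Suc K)
  define d where "d = complex_of_real q ^ K * c1"
  have b: "b1 \<noteq> 0" "b2 \<noteq> 0"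
    using adm by (auto simp: admissible_def[OF q x])
  have "q ^ K * (q * norm (c1 * c2)) \<le> q * norm (c1 * c2)"
    using q by (intro mult_left_le_one_le power_le_one) auto
  moreover have "q ^ K * (q * norm (c1 * c2)) = q * norm (d * c2)"
    using q by (simp add: d_def norm_mult norm_power)
  ultimately have "q * norm (d * c2) < norm (b1 * b2)"
    using conv by linarith
  from wint_shift_c1[OF q x adm this]
  have step: "(1 - of_real q ^ K * (of_real q * c1 * c2 / (b1 * b2))) * wint q x1 x2 d c2 b1 b2 =
     (1 - of_real q ^ K * (of_real q * c1 / b1)) * (1 - of_real q ^ K * (of_real q * c1 / b2))
        * wint q x1 x2 (of_real q * d) c2 b1 b2"
    using b by (simp add: d_def field_simps)
  have "qfin q (of_real q * c1 * c2 / (b1 * b2)) (Suc K) * wint q x1 x2 c1 c2 b1 b2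
      = qfin q (of_real q * c1 / b1) K * qfin q (of_real q * c1 / b2) K *
        ((1 - of_real q ^ K * (of_real q * c1 * c2 / (b1 * b2))) * wint q x1 x2 d c2 b1 b2)"
    unfolding qfin_Suc using Suc.IH unfolding d_def[symmetric] by (simp add: mult_ac)
  also have "\<dots> = qfin q (of_real q * c1 / b1) (Suc K) * qfin q (of_real q * c1 / b2) (Suc K)
      * wint q x1 x2 (of_real q * d) c2 b1 b2"
    unfolding step qfin_Suc by (simp only: mult_ac)
  finally show ?case
    by (simp add: d_def mult_ac)
qed simp

text \<open>Limit of \<open>wint_c1_iterate\<close>. Since
  \<open>norm (q ^ K * c1) \<le> norm c1\<close>, a single \<open>wt_bound\<close> dominates all the
  weights, and the limit may be taken under the bilateral sums.\<close>

lemma wint_c1_to_0: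
  assumes adm: "admissible q x1 x2 b1 b2" and conv: "q * norm (c1 * c2) < norm (b1 * b2)"
  shows "qinf q (of_real q * c1 * c2 / (b1 * b2)) * wint q x1 x2 c1 c2 b1 b2 =
    qinf q (of_real q * c1 / b1) * qinf q (of_real q * c1 / b2) * wint q x1 x2 0 c2 b1 b2"
proof -
  obtain C1 C2 where C: "C1 > 0" "C2 > 0" "q * C1 * C2 < norm (b1 * b2)" "norm c1 \<le> C1" "norm c2 \<le> C2"
    using exists_majorant_constants[OF q conv] by metis
  have lim: "(\<lambda>K. lattice_sum q (wt q (of_real q ^ K * c1) c2 b1 b2) y) \<longlonglongrightarrow> lattice_sum q (wt q 0 c2 b1 b2) y"
    if y: "y \<in> {x1, x2}" for y
    unfolding lattice_sum_def
  proof (rule infsum_dominated_convergence)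
    show "(\<lambda>\<nu>::int. wt_bound q C1 C2 b1 b2 (y * of_real q powi \<nu>)) summable_on UNIV"
      using y adm x by (intro wt_bound_summable[OF q C(1-3)]) (auto simp: admissible_def[OF q x])
  next
    fix K :: nat and \<nu> :: int
    have "q ^ K * norm c1 \<le> norm c1"
      using q by (intro mult_left_le_one_le power_le_one) auto
    then have "norm (of_real q ^ K * c1) \<le> C1"
      using C(4) q by (simp add: norm_mult norm_power)
    then show "norm (wt q (of_real q ^ K * c1) c2 b1 b2 (y * of_real q powi \<nu>) * (y * of_real q powi \<nu>))
        \<le> wt_bound q C1 C2 b1 b2 (y * of_real q powi \<nu>)"
      by (intro norm_wt_le[OF q] C)
  next
    fix \<nu> :: int
    let ?z = "y * complex_of_real q powi \<nu>"
    have "(\<lambda>K. complex_of_real q ^ K * (of_real q * c1 * ?z)) \<longlonglongrightarrow> 0"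
      using q by (intro tendsto_mult_left_zero LIMSEQ_power_zero) auto
    then have "(\<lambda>K. of_real q * (of_real q ^ K * c1) * ?z) \<longlonglongrightarrow> 0"
      by (simp add: mult_ac)
    from tendsto_qinf_0[OF q this]
    have "(\<lambda>K. qinf q (of_real q * (of_real q ^ K * c1) * ?z)) \<longlonglongrightarrow> qinf q (of_real q * 0 * ?z)"
      by (simp add: qinf_0[OF q])
    moreover have "qinf q (b1 * ?z) \<noteq> 0" "qinf q (b2 * ?z) \<noteq> 0"
      using adm y by (auto simp: admissible_def[OF q x] intro!: qinf_lattice_nonzero[OF q])
    ultimately show "(\<lambda>K. wt q (of_real q ^ K * c1) c2 b1 b2 ?z * ?z) \<longlonglongrightarrow> wt q 0 c2 b1 b2 ?z * ?z"
      unfolding wt_def by (intro tendsto_mult tendsto_divide tendsto_const)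
  qed
  have "(\<lambda>K. wint q x1 x2 (of_real q ^ K * c1) c2 b1 b2) \<longlonglongrightarrow> wint q x1 x2 0 c2 b1 b2"
    unfolding wint_def[OF q x] by (intro tendsto_diff lim) auto
  then have "(\<lambda>K. qfin q (of_real q * c1 * c2 / (b1 * b2)) K * wint q x1 x2 c1 c2 b1 b2)
     \<longlonglongrightarrow> qinf q (of_real q * c1 / b1) * qinf q (of_real q * c1 / b2) * wint q x1 x2 0 c2 b1 b2"
    unfolding wint_c1_iterate[OF adm conv] by (intro tendsto_mult qfin_tendsto_qinf[OF q])
  moreover have "(\<lambda>K. qfin q (of_real q * c1 * c2 / (b1 * b2)) K * wint q x1 x2 c1 c2 b1 b2)
     \<longlonglongrightarrow> qinf q (of_real q * c1 * c2 / (b1 * b2)) * wint q x1 x2 c1 c2 b1 b2"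
    by (intro tendsto_mult tendsto_const qfin_tendsto_qinf[OF q])
  ultimately show ?thesis
    using LIMSEQ_unique by blast
qed

lemma wint_c_to_0:
  assumes adm: "admissible q x1 x2 b1 b2" and conv: "q * norm (c1 * c2) < norm (b1 * b2)"
  shows "qinf q (of_real q * c1 * c2 / (b1 * b2)) * wint q x1 x2 c1 c2 b1 b2 =
    qinf q (of_real q * c1 / b1) * qinf q (of_real q * c1 / b2) *
    qinf q (of_real q * c2 / b1) * qinf q (of_real q * c2 / b2) * wint q x1 x2 0 0 b1 b2"
proof -
  have "b1 * b2 \<noteq> 0"
    using adm by (auto simp: admissible_def[OF q x])
  then have "q * norm (c2 * 0) < norm (b1 * b2)"
    by simp
  from wint_c1_to_0[OF adm this]
  have "wint q x1 x2 0 c2 b1 b2 = qinf q (of_real q * c2 / b1) * qinf q (of_real q * c2 / b2) * wint q x1 x2 0 0 b1 b2"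
    by (simp add: qinf_0[OF q] wint_commute_c[OF q x, of c2 0])
  with wint_c1_to_0[OF adm conv] show ?thesis
    by (simp add: mult_ac)
qed

text \<open>
  For \<open>c1 = q / x1\<close> and \<open>c2 = x1 * b1 * b2 / q\<close> the weight itself is a \<open>q\<close>-difference, so the
  integral is the difference of its boundary values at infinity, and the one on the lattice of \<open>x1\<close>
  vanishes.
\<close>

lemma wint_0_0:
  assumes adm: "admissible q x1 x2 b1 b2"
  shows "wint q x1 x2 0 0 b1 b2 = qinf q (of_real q) * x2 * qtheta q (x1 / x2) * qtheta q (x1 * x2 * b1 * b2)
     / (qtheta q (x1 * b1) * qtheta q (x1 * b2) * qtheta q (x2 * b1) * qtheta q (x2 * b2))"
proof -
  define c1 c2 where "c1 = of_real q / x1" and "c2 = x1 * b1 * b2 / of_real q"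
  have b: "b1 \<noteq> 0" "b2 \<noteq> 0"
    using adm by (auto simp: admissible_def[OF q x])
  have c: "c1 \<noteq> 0" "c2 \<noteq> 0" "c1 * c2 = b1 * b2"
    using b x q by (auto simp: c1_def c2_def)
  have conv: "q * norm (c1 * c2) < norm (b1 * b2)"
    unfolding c using b q by auto
  \<comment> \<open>As \<open>c1 * c2 = b1 * b2\<close>, the linear coefficient in
    \<open>lattice_sum_telescope\<close> vanishes and only this constant multiplies the
    weight.\<close>
  define \<alpha> where "\<alpha> = b1 + b2 - c1 - c2"
  define B where "B y = qtheta q (c1 * y) * qtheta q (c2 * y) / (qtheta q (b1 * y) * qtheta q (b2 * y))" for y
  have "\<alpha> * lattice_sum q (wt q c1 c2 b1 b2) y = B y - 1" if y: "y \<in> {x1, x2}" for y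
  proof -
    let ?z = "\<lambda>\<nu>::int. y * of_real q powi \<nu>"
    let ?w = "wt q c1 c2 b1 b2"
    note s = wt_summable_admissible[OF q x adm y conv]
    have off: "off_lattice q (y * b1)" "off_lattice q (y * b2)" and "y \<noteq> 0"
      using y adm x by (auto simp: admissible_def[OF q x])
    note lim = theta_quotient_limit[OF b c(1,2) \<open>y \<noteq> 0\<close> c(3) off]
    have eq: "((b1 + b2 - c1 - c2) + (c1 * c2 - b1 * b2) * ?z \<nu>) * ?w (?z \<nu>) * ?z \<nu> = \<alpha> * (?w (?z \<nu>) * ?z \<nu>)" for \<nu>
      unfolding c(3) \<alpha>_def by simp
    have "lattice_sum q (\<lambda>z. ((b1 + b2 - c1 - c2) + (c1 * c2 - b1 * b2) * z) * ?w z) y = B y - 1"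
      unfolding B_def
      by (rule lattice_sum_telescope[OF q off _ lim], unfold eq) (intro summable_on_cmult_right s)
    then show ?thesis
      unfolding lattice_sum_def eq by (simp add: infsum_cmult_right s)
  qed
  from this[of x1, simplified] this[of x2, simplified]
  have int: "\<alpha> * wint q x1 x2 c1 c2 b1 b2 = B x2 - B x1"
    by (simp add: wint_def[OF q x] right_diff_distrib)
  have B1: "B x1 = 0"
    using x by (simp add: B_def c1_def qtheta_q)
  define y1 y2 where "y1 = x1 * b1" and "y2 = x1 * b2"
  have y: "y1 \<noteq> 0" "y2 \<noteq> 0" and th: "qtheta q y1 \<noteq> 0" "qtheta q y2 \<noteq> 0"
      "qtheta q (x2 * b1) \<noteq> 0" "qtheta q (x2 * b2) \<noteq> 0"
    using b x adm by (auto simp: y1_def y2_def admissible_def[OF q x] intro!: qtheta_off_lattice)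
  have qn: "complex_of_real q \<noteq> 0"
    using q by simp
  have sh: "qinf q (of_real q / y) = (1 - of_real q / y) * qinf q (of_real q * of_real q / y)" for y
    using qinf_shift[OF q, of "of_real q / y"] by simp
  have args: "of_real q * c1 * c2 / (b1 * b2) = of_real q" "of_real q * c1 / b1 = of_real q * of_real q / y1"
    "of_real q * c1 / b2 = of_real q * of_real q / y2" "of_real q * c2 / b1 = y2" "of_real q * c2 / b2 = y1"
    using b c(3) qn x by (auto simp: c1_def c2_def y1_def y2_def field_simps)
  have "qtheta q y1 * qtheta q y2 * wint q x1 x2 0 0 b1 b2
      = (1 - of_real q / y1) * (1 - of_real q / y2) * (qinf q (of_real q) * wint q x1 x2 c1 c2 b1 b2)"
    using wint_c_to_0[OF adm conv] unfolding args qtheta_def sh by (simp add: mult_ac)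
  \<comment> \<open>The factor left over from lowering \<open>q * q / y\<close> to
    \<open>q / y\<close> in the infinite products is itself a multiple of \<open>\<alpha>\<close>.
    Thus \<open>\<alpha>\<close> is absorbed without a division, and the case
    \<open>\<alpha> = 0\<close> needs no special treatment.\<close>
  also have "(1 - of_real q / y1) * (1 - of_real q / y2) = - (of_real q * x1 / (y1 * y2)) * \<alpha>"
    using b x qn by (simp add: \<alpha>_def c1_def c2_def y1_def y2_def field_simps)
  also have "- (of_real q * x1 / (y1 * y2)) * \<alpha> * (qinf q (of_real q) * wint q x1 x2 c1 c2 b1 b2) =
     - (of_real q * x1 / (y1 * y2)) * qinf q (of_real q) * B x2"
    using int B1 by (simp add: mult_ac)
  also have "B x2 = qtheta q (x1 / x2) * (- (x1 * x2 * b1 * b2 / of_real q) * qtheta q (x1 * x2 * b1 * b2))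
      / (qtheta q (x2 * b1) * qtheta q (x2 * b2))"
  proof -
    have 1: "qtheta q (c1 * x2) = qtheta q (x1 / x2)"
      using qtheta_reflect[of "x1 / x2"] x by (simp add: c1_def)
    have 2: "qtheta q (c2 * x2) = - (x1 * x2 * b1 * b2 / of_real q) * qtheta q (x1 * x2 * b1 * b2)"
      using qtheta_shift[of "c2 * x2"] c(2) x b qn by (simp add: c2_def field_simps)
    show ?thesis
      unfolding B_def 1 2 by (simp add: mult.commute)
  qed
  finally show ?thesis
    using y th x b qn unfolding y1_def y2_def by (simp add: field_simps)
qed

lemma wint_eq:
  assumes adm: "admissible q x1 x2 b1 b2" and conv: "q * norm (c1 * c2) < norm (b1 * b2)"
  shows "qinf q (of_real q * c1 * c2 / (b1 * b2)) * wint q x1 x2 c1 c2 b1 b2 =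
    qinf q (of_real q) * (qinf q (of_real q * c1 / b1) * qinf q (of_real q * c1 / b2) *
    qinf q (of_real q * c2 / b1) * qinf q (of_real q * c2 / b2)) *
    (x2 * qtheta q (x1 / x2) * qtheta q (x1 * x2 * b1 * b2)
     / (qtheta q (x1 * b1) * qtheta q (x1 * b2) * qtheta q (x2 * b1) * qtheta q (x2 * b2)))"
  unfolding wint_c_to_0[OF adm conv] wint_0_0[OF adm] by simp

end

end

section \<open>Multivariate Newton expansions\<close>

definition newton :: "real \<Rightarrow> nat set \<Rightarrow> (nat \<Rightarrow> nat) \<Rightarrow> (nat \<Rightarrow> complex) \<Rightarrow> complex" where
  "newton q I k y = (\<Prod>i\<in>I. qfin q (y i) (k i))"

text \<open>The zeros of the one-variable shifted factorials. A Newton product with multi-index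
  \<open>k\<close> vanishes at \<open>node q \<nu>\<close> unless \<open>k \<le> \<nu>\<close> in
  every coordinate, so evaluation at nodes is triangular.\<close>

definition node :: "real \<Rightarrow> (nat \<Rightarrow> nat) \<Rightarrow> nat \<Rightarrow> complex" where
  "node q k i = 1 / of_real q ^ k i"

text \<open>\<open>B J\<close> bounds the joint degree in the variables with index in \<open>J\<close>.\<close>

definition exps :: "nat set \<Rightarrow> (nat set \<Rightarrow> nat) \<Rightarrow> (nat \<Rightarrow> nat) set" where
  "exps I B = {k. (\<forall>i. i \<notin> I \<longrightarrow> k i = 0) \<and> (\<forall>J\<subseteq>I. sum k J \<le> B J)}"

definition newton_span ::
  "real \<Rightarrow> nat set \<Rightarrow> (nat set \<Rightarrow> nat) \<Rightarrow> ((nat \<Rightarrow> complex) \<Rightarrow> complex) \<Rightarrow> bool" where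
  "newton_span q I B F \<longleftrightarrow> (\<exists>c. \<forall>y. F y = (\<Sum>k\<in>exps I B. c k * newton q I k y))"

definition offdiag :: "'a set \<Rightarrow> ('a \<times> 'a) set" where
  "offdiag I = {(j, k). j \<in> I \<and> k \<in> I \<and> j \<noteq> k}"

text \<open>A q-analogue of an even power of the Vandermonde determinant: the kernel of the integral
  multiplied by its monomials \<open>z i ^ ((n - 1) * \<tau>)\<close>, hence a homogeneous
  polynomial; see \<open>qdisc_eq_qfin\<close>.\<close>

definition qdisc :: "real \<Rightarrow> nat \<Rightarrow> nat set \<Rightarrow> (nat \<Rightarrow> complex) \<Rightarrow> complex" where
  "qdisc q \<tau> I y = (\<Prod>(j, k)\<in>offdiag I. \<Prod>i<\<tau>. y k - of_real q ^ i * y j)"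

lemma finite_exps:
  assumes "finite I"
  shows "finite (exps I B)"
proof (rule finite_subset)
  have "k i \<le> (\<Sum>i\<in>I. B {i})" if k: "k \<in> exps I B" and i: "i \<in> I" for k i
  proof -
    have "k i \<le> B {i}"
    proof -
      have "sum k {i} \<le> B {i}"
        using k i unfolding exps_def by blast
      then show ?thesis by simp
    qed
    also have "\<dots> \<le> (\<Sum>i\<in>I. B {i})"
      using assms i by (intro member_le_sum) auto
    finally show ?thesis .
  qed
  then show "exps I B \<subseteq> {k. \<forall>i. (i \<in> I \<longrightarrow> k i \<in> {..\<Sum>i\<in>I. B {i}}) \<and> (i \<notin> I \<longrightarrow> k i = 0)}"
    by (auto simp: exps_def)
  show "finite {k. \<forall>i. (i \<in> I \<longrightarrow> k i \<in> {..\<Sum>i\<in>I. B {i}}) \<and> (i \<notin> I \<longrightarrow> k i = (0::nat))}"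
    using assms by (intro finite_set_of_finite_funs) auto
qed

context
  fixes q :: real and I :: "nat set"
  assumes q: "0 < q" "q < 1" and I: "finite I"
begin

lemma newton_span_newton:
  assumes "k \<in> exps I B"
  shows "newton_span q I B (newton q I k)"
  unfolding newton_span_def
proof (intro exI allI)
  fix y
  have "(\<Sum>l\<in>exps I B. (if l = k then 1 else 0) * newton q I l y) =
      (\<Sum>l\<in>exps I B. if l = k then newton q I l y else 0)"
    by (intro sum.cong) auto
  then show "newton q I k y = (\<Sum>l\<in>exps I B. (if l = k then 1 else 0) * newton q I l y)"
    using assms finite_exps[OF I, of B] by simp
qed

lemma newton_span_0: "newton_span q I B (\<lambda>y. 0)"
  unfolding newton_span_def by (intro exI[of _ "\<lambda>_. 0"]) simp

lemma newton_span_cmult_add: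
  assumes "newton_span q I B F" "newton_span q I B G"
  shows "newton_span q I B (\<lambda>y. a * F y + G y)"
proof -
  obtain c d where "\<And>y. F y = (\<Sum>k\<in>exps I B. c k * newton q I k y)"
    "\<And>y. G y = (\<Sum>k\<in>exps I B. d k * newton q I k y)"
    using assms unfolding newton_span_def by metis
  then show ?thesis
    unfolding newton_span_def
    by (intro exI[of _ "\<lambda>k. a * c k + d k"]) (simp add: sum.distrib sum_distrib_left algebra_simps)
qed

lemma newton_span_sum:
  "finite S \<Longrightarrow> (\<And>s. s \<in> S \<Longrightarrow> newton_span q I B (F s)) \<Longrightarrow> newton_span q I B (\<lambda>y. \<Sum>s\<in>S. a s * F s y)"
proof (induction S rule: finite_induct)
  case empty
  show ?case using newton_span_0 by simp
next
  case (insert s S)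
  then show ?case
    using newton_span_cmult_add[of B "F s" "\<lambda>y. \<Sum>s\<in>S. a s * F s y" "a s"] by simp
qed

lemma newton_mult_var:
  assumes "j \<in> I"
  shows "y j * newton q I k y =
    (1 / of_real q ^ k j) * (newton q I k y - newton q I (k(j := Suc (k j))) y)"
proof -
  have "newton q I (k(j := Suc (k j))) y = newton q I k y * (1 - of_real q ^ k j * y j)"
    using I assms by (simp add: newton_def prod.remove[of I j] qfin_Suc)
  then show ?thesis
    using q by (simp add: field_simps)
qed

lemma newton_span_mult_var:
  assumes F: "newton_span q I B F" and j: "j \<in> I"
    and B': "\<And>J. J \<subseteq> I \<Longrightarrow> B J + (if j \<in> J then 1 else 0) \<le> B' J"
  shows "newton_span q I B' (\<lambda>y. y j * F y)"
proof -
  obtain c where c: "\<And>y. F y = (\<Sum>k\<in>exps I B. c k * newton q I k y)"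
    using F unfolding newton_span_def by metis
  have "newton_span q I B' (\<lambda>y. \<Sum>k\<in>exps I B. (c k / of_real q ^ k j) *
      (- 1 * newton q I (k(j := Suc (k j))) y + newton q I k y))"
  proof (intro newton_span_sum finite_exps I newton_span_cmult_add newton_span_newton)
    fix k assume k: "k \<in> exps I B"
    then show "k \<in> exps I B'"
      by (auto simp: exps_def) (meson B' add_leD1 order_trans)
    have "sum (k(j := Suc (k j))) J \<le> B' J" if J: "J \<subseteq> I" for J
    proof -
      have "finite J" using J I finite_subset by blast
      then have eq: "sum (k(j := Suc (k j))) J = sum k J + (if j \<in> J then 1 else 0)"
      proof (cases "j \<in> J")
        case False
        then show ?thesis by (auto intro!: sum.cong)
      qed (simp add: sum.remove[of J j])
      have "sum k J \<le> B J"
        using k J by (simp add: exps_def)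
      with eq B'[OF J] show ?thesis by linarith
    qed
    then show "k(j := Suc (k j)) \<in> exps I B'"
      using k j by (auto simp: exps_def)
  qed
  moreover have "y j * F y = (\<Sum>k\<in>exps I B. (c k / of_real q ^ k j) *
      (- 1 * newton q I (k(j := Suc (k j))) y + newton q I k y))" for y
    unfolding c sum_distrib_left
    by (intro sum.cong refl) (simp add: mult.left_commute[of "y j"] newton_mult_var[OF j] algebra_simps)
  ultimately show ?thesis by simp
qed

text \<open>The two terms of the factor raise different indices, never both at once. The joint
  degree on a set \<open>J\<close> therefore grows by one at most, even when \<open>J\<close>
  contains both indices; the sharp upper bounds of \<open>qdisc_expansion\<close> depend on
  this.\<close>

lemma newton_span_mult_factor:
  assumes F: "newton_span q I B F" and jk: "j \<in> I" "k \<in> I"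
    and B': "\<And>J. J \<subseteq> I \<Longrightarrow> B J + (if j \<in> J \<or> k \<in> J then 1 else 0) \<le> B' J"
  shows "newton_span q I B' (\<lambda>y. (y k - \<alpha> * y j) * F y)"
proof -
  have "B J + (if i \<in> J then 1 else 0) \<le> B' J" if "J \<subseteq> I" "i = j \<or> i = k" for i J
    using B'[OF that(1)] that(2) by (auto split: if_splits)
  then have "newton_span q I B' (\<lambda>y. y i * F y)" if "i = j \<or> i = k" for i
    using that jk by (intro newton_span_mult_var[OF F]) auto
  then have "newton_span q I B' (\<lambda>y. - \<alpha> * (y j * F y) + y k * F y)"
    by (intro newton_span_cmult_add) auto
  then show ?thesis
    by (simp add: algebra_simps)
qed

lemma newton_span_prod:
  assumes "finite S" "\<And>s. s \<in> S \<Longrightarrow> j s \<in> I \<and> k s \<in> I"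
  shows "newton_span q I (\<lambda>J. card {s\<in>S. j s \<in> J \<or> k s \<in> J}) (\<lambda>y. \<Prod>s\<in>S. y (k s) - \<alpha> s * y (j s))"
  using assms
proof (induction S rule: finite_induct)
  case empty
  have "newton_span q I (\<lambda>_. 0) (newton q I (\<lambda>_. 0))"
    by (rule newton_span_newton) (simp add: exps_def)
  moreover have "newton q I (\<lambda>_. 0) = (\<lambda>y. 1)"
    by (simp add: newton_def fun_eq_iff)
  ultimately show ?case by simp
next
  case (insert s S)
  have "newton_span q I (\<lambda>J. card {s\<in>S. j s \<in> J \<or> k s \<in> J}) (\<lambda>y. \<Prod>s\<in>S. y (k s) - \<alpha> s * y (j s))"
    using insert by auto
  moreover have "card {s'\<in>S. j s' \<in> J \<or> k s' \<in> J} + (if j s \<in> J \<or> k s \<in> J then 1 else 0)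
      = card {s'\<in>insert s S. j s' \<in> J \<or> k s' \<in> J}" for J
  proof (cases "j s \<in> J \<or> k s \<in> J")
    case True
    then have "{s'\<in>insert s S. j s' \<in> J \<or> k s' \<in> J} = insert s {s'\<in>S. j s' \<in> J \<or> k s' \<in> J}"
      by auto
    then show ?thesis
      using True insert.hyps by simp
  next
    case False
    then have "{s'\<in>insert s S. j s' \<in> J \<or> k s' \<in> J} = {s'\<in>S. j s' \<in> J \<or> k s' \<in> J}"
      by auto
    then show ?thesis
      using False by simp
  qed
  ultimately show ?case
    unfolding prod.insert[OF insert.hyps] using insert.prems
    by (intro newton_span_mult_factor[where B = "\<lambda>J. card {s\<in>S. j s \<in> J \<or> k s \<in> J}"]) simp_all
qed

lemma newton_node_nonzero: "newton q I k (node q k) \<noteq> 0"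
proof -
  have "of_real q ^ i * (1 / complex_of_real q ^ m) \<noteq> 1" if "i < m" for i m :: nat
  proof
    assume "of_real q ^ i * (1 / complex_of_real q ^ m) = 1"
    then have "complex_of_real (q ^ i) = of_real (q ^ m)"
      using q by (simp add: field_simps)
    then have "q ^ i = q ^ m"
      by (simp only: of_real_eq_iff)
    then show False
      using that q power_strict_decreasing[of i m q] by simp
  qed
  then show ?thesis
    using I by (auto simp: newton_def node_def qfin_eq_0_iff)
qed

lemma newton_node_zero:
  assumes "i \<in> I" "\<nu> i < k i"
  shows "newton q I k (node q \<nu>) = 0"
proof -
  have "qfin q (node q \<nu> i) (k i) = 0"
    using assms q by (auto simp: qfin_eq_0_iff node_def intro!: exI[of _ "\<nu> i"])
  then show ?thesis
    using I assms by (auto simp: newton_def)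
qed

context
  fixes E :: "(nat \<Rightarrow> nat) set" and c :: "(nat \<Rightarrow> nat) \<Rightarrow> complex" and F :: "(nat \<Rightarrow> complex) \<Rightarrow> complex"
  assumes E: "finite E" "\<And>k i. k \<in> E \<Longrightarrow> i \<notin> I \<Longrightarrow> k i = 0"
    and F: "\<And>y. F y = (\<Sum>k\<in>E. c k * newton q I k y)"
begin

text \<open>By triangularity only indices below \<open>k\<close> survive at the node of
  \<open>k\<close>. If all of them but \<open>k\<close> have zero coefficients, the value of
  \<open>F\<close> there exhibits the coefficient of \<open>k\<close>.\<close>

lemma newton_coeff_at_node:
  assumes "\<And>i. i \<notin> I \<Longrightarrow> k i = 0"
    and "\<And>l. l \<in> E \<Longrightarrow> l \<noteq> k \<Longrightarrow> (\<And>i. l i \<le> k i) \<Longrightarrow> c l = 0"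
  shows "F (node q k) = (if k \<in> E then c k else 0) * newton q I k (node q k)"
proof -
  have "c l * newton q I l (node q k) = 0" if l: "l \<in> E" "l \<noteq> k" for l
  proof (cases "\<forall>i. l i \<le> k i")
    case True
    then show ?thesis using assms(2) l by auto
  next
    case False
    then obtain i where i: "k i < l i" by (auto simp: not_le)
    then have "i \<in> I" using E(2)[OF l(1)] by fastforce
    then show ?thesis using newton_node_zero i by auto
  qed
  then have "F (node q k) = (\<Sum>l\<in>E. if l = k then c l * newton q I l (node q k) else 0)"
    unfolding F by (intro sum.cong) auto
  then show ?thesis
    using E(1) by simp
qed

text \<open>The coefficient of \<open>k\<close> is determined by the values of \<open>F\<close> at
  the nodes below \<open>k\<close>; induction on the total of \<open>k\<close> removes the smaller
  indices first.\<close>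

lemma newton_coeff_zero:
  assumes "k \<in> E" "\<And>\<nu>. (\<And>i. \<nu> i \<le> k i) \<Longrightarrow> F (node q \<nu>) = 0"
  shows "c k = 0"
  using assms
proof (induction "sum k I" arbitrary: k rule: less_induct)
  case less
  have "c l = 0" if l: "l \<in> E" "l \<noteq> k" "\<And>i. l i \<le> k i" for l
  proof (rule less.hyps)
    obtain i where i: "l i \<noteq> k i" using l(2) by auto
    then have "i \<in> I" using E(2)[OF l(1), of i] E(2)[OF less.prems(1), of i] by metis
    then show "sum l I < sum k I"
      using I i l(3) by (intro sum_strict_mono_ex1) (auto intro!: bexI[of _ i] simp: le_neq_trans)
    show "F (node q \<nu>) = 0" if "\<And>i. \<nu> i \<le> l i" for \<nu>
      using less.prems(2) l(3) that order_trans by blast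
  qed (rule l)
  then have "F (node q k) = (if k \<in> E then c k else 0) * newton q I k (node q k)"
    using E(2)[OF less.prems(1)] by (intro newton_coeff_at_node) auto
  moreover have "F (node q k) = 0"
    using less.prems(2) by blast
  ultimately show ?case
    using less.prems(1) newton_node_nonzero[of k] by simp
qed

end

end

section \<open>Sorting, separated indices, and counting pairs\<close>

lemma obtain_sorting:
  fixes k :: "nat \<Rightarrow> nat"
  assumes "finite I" "card I = n"
  obtains f where "bij_betw f {..<n} I" "\<And>i j. i \<le> j \<Longrightarrow> j < n \<Longrightarrow> k (f i) \<le> k (f j)"
proof -
  define xs where "xs = sort_key k (sorted_list_of_set I)"
  have xs: "distinct xs" "set xs = I" "length xs = n"
    using assms by (auto simp: xs_def)
  have "bij_betw (\<lambda>i. xs ! i) {..<n} I"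
    using bij_betw_nth[OF xs(1), of "{..<n}" I] xs by simp
  moreover have "k (xs ! i) \<le> k (xs ! j)" if "i \<le> j" "j < n" for i j
  proof -
    have "sorted (map k xs)" by (simp add: xs_def)
    then have "map k xs ! i \<le> map k xs ! j"
      using that xs by (intro sorted_nth_mono) auto
    then show ?thesis using that xs by simp
  qed
  ultimately show thesis by (rule that)
qed

text \<open>Numbers at pairwise distance at least \<open>\<tau>\<close> have different quotients by
  \<open>\<tau>\<close>, and only \<open>M div \<tau> + 1\<close> quotients are available.\<close>

lemma card_separated_le:
  fixes \<nu> :: "'a \<Rightarrow> nat"
  assumes "finite A" "\<tau> > 0" "\<And>i. i \<in> A \<Longrightarrow> \<nu> i \<le> M"
    and sep: "\<And>i j. i \<in> A \<Longrightarrow> j \<in> A \<Longrightarrow> i \<noteq> j \<Longrightarrow> \<nu> i \<le> \<nu> j \<Longrightarrow> \<nu> i + \<tau> \<le> \<nu> j"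
  shows "(card A - 1) * \<tau> \<le> M"
proof -
  have "inj_on (\<lambda>i. \<nu> i div \<tau>) A"
  proof (rule inj_onI, rule ccontr)
    fix i j assume ij: "i \<in> A" "j \<in> A" "\<nu> i div \<tau> = \<nu> j div \<tau>" "i \<noteq> j"
    have "\<nu> i + \<tau> \<le> \<nu> j \<or> \<nu> j + \<tau> \<le> \<nu> i"
      using sep[OF ij(1,2,4)] sep[OF ij(2,1)] ij(4) by (cases "\<nu> i \<le> \<nu> j") auto
    moreover have "(a + \<tau>) div \<tau> \<le> b div \<tau>" if "a + \<tau> \<le> b" for a b
      using that by (rule div_le_mono)
    ultimately show False
      using ij(3) assms(2) by fastforce
  qed
  then have "card A = card ((\<lambda>i. \<nu> i div \<tau>) ` A)"
    by (simp add: card_image)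
  also have "\<dots> \<le> card {..M div \<tau>}"
    using assms(3) by (intro card_mono) (auto intro: div_le_mono)
  finally have "card A - 1 \<le> M div \<tau>"
    by simp
  then show ?thesis
    using assms(2) by (simp add: less_eq_div_iff_mult_less_eq)
qed

lemma finite_offdiag [simp]: "finite I \<Longrightarrow> finite (offdiag I)"
  by (rule finite_subset[of _ "I \<times> I"]) (auto simp: offdiag_def)

lemma card_offdiag:
  assumes "finite I"
  shows "card (offdiag I) = card I * (card I - 1)"
proof -
  have "offdiag I = I \<times> I - (\<lambda>i. (i, i)) ` I"
    by (auto simp: offdiag_def)
  moreover have "card ((\<lambda>i. (i, i)) ` I) = card I"
    by (rule card_image) (auto intro: inj_onI)
  ultimately show ?thesis
    using assms by (subst \<open>offdiag I = _\<close>, subst card_Diff_subset) (auto simp: card_cartesian_product diff_mult_distrib2)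
qed

text \<open>All ordered pairs minus those lying entirely outside \<open>J\<close>. Multiplied by
  \<open>\<tau>\<close>, this is the joint degree of \<open>qdisc\<close> in the variables of
  \<open>J\<close>.\<close>

lemma card_offdiag_touching:
  assumes "finite I" "J \<subseteq> I"
  shows "card {(j, k)\<in>offdiag I. j \<in> J \<or> k \<in> J} = card J * (2 * card I - 1 - card J)"
proof -
  have "{(j, k)\<in>offdiag I. j \<in> J \<or> k \<in> J} = offdiag I - offdiag (I - J)"
    by (auto simp: offdiag_def)
  moreover have "offdiag (I - J) \<subseteq> offdiag I"
    by (auto simp: offdiag_def)
  ultimately have "card {(j, k)\<in>offdiag I. j \<in> J \<or> k \<in> J} = card (offdiag I) - card (offdiag (I - J))"
    using assms by (simp add: card_Diff_subset)
  also have "\<dots> = card I * (card I - 1) - (card I - card J) * (card I - card J - 1)"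
    using assms by (simp add: card_offdiag card_Diff_subset finite_subset)
  also have "\<dots> = card J * (2 * card I - 1 - card J)"
  proof -
    obtain m where m: "card I = card J + m"
      using card_mono[OF assms] le_Suc_ex by blast
    show ?thesis
      unfolding m by (cases m; cases "card J") (auto simp: algebra_simps)
  qed
  finally show ?thesis .
qed

section \<open>The expansion of the kernel\<close>

lemma prod_qfin_blocks: "(\<Prod>d<m. qfin q (of_real q ^ (d * \<tau>) * a) \<tau>) = qfin q a (m * \<tau>)"
proof (induction m)
  case (Suc m)
  then show ?case
    using qfin_add[of q a "m * \<tau>" \<tau>] by (simp add: add.commute)
qed simp

lemma qdisc_permute:
  assumes "p permutes I"
  shows "qdisc q \<tau> I (y \<circ> p) = qdisc q \<tau> I y"
proof -
  have inj: "inj p" and p: "p i \<in> I \<longleftrightarrow> i \<in> I" for i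
    using assms permutes_inj permutes_in_image by metis+
  have "bij_betw (\<lambda>(j, k). (p j, p k)) (offdiag I) (offdiag I)"
  proof (rule bij_betw_byWitness[where f' = "\<lambda>(j, k). (inv p j, inv p k)"])
    have p': "inv p i \<in> I \<longleftrightarrow> i \<in> I" for i
      using permutes_in_image[OF permutes_inv[OF assms]] .
    have i: "inv p (p i) = i" "p (inv p i) = i" for i
      using permutes_inverses[OF assms] by auto
    show "\<forall>a\<in>offdiag I. (case case a of (j, k) \<Rightarrow> (p j, p k) of (j, k) \<Rightarrow> (inv p j, inv p k)) = a"
      "\<forall>a'\<in>offdiag I. (case case a' of (j, k) \<Rightarrow> (inv p j, inv p k) of (j, k) \<Rightarrow> (p j, p k)) = a'"
      by (auto simp: i)
    show "(\<lambda>(j, k). (p j, p k)) ` offdiag I \<subseteq> offdiag I"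
      using inj p by (auto simp: offdiag_def inj_eq)
    show "(\<lambda>(j, k). (inv p j, inv p k)) ` offdiag I \<subseteq> offdiag I"
      using p' i by (auto simp: offdiag_def) metis
  qed
  from prod.reindex_bij_betw[OF this, of "\<lambda>(j, k). \<Prod>i<\<tau>. y k - of_real q ^ i * y j"]
  show ?thesis
    by (simp add: qdisc_def case_prod_unfold)
qed

lemma qdisc_scale:
  assumes "finite I"
  shows "qdisc q \<tau> I (\<lambda>i. b * y i) = b ^ (card I * (card I - 1) * \<tau>) * qdisc q \<tau> I y"
proof -
  have "qdisc q \<tau> I (\<lambda>i. b * y i) = (\<Prod>(j, k)\<in>offdiag I. b ^ \<tau> * (\<Prod>i<\<tau>. y k - of_real q ^ i * y j))"
    unfolding qdisc_def
  proof (intro prod.cong refl, clarify)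
    fix j k
    have "(\<Prod>i<\<tau>. b * y k - of_real q ^ i * (b * y j)) = (\<Prod>i<\<tau>. b * (y k - of_real q ^ i * y j))"
      by (intro prod.cong refl) (simp add: algebra_simps)
    then show "(\<Prod>i<\<tau>. b * y k - of_real q ^ i * (b * y j)) = b ^ \<tau> * (\<Prod>i<\<tau>. y k - of_real q ^ i * y j)"
      by (simp add: prod.distrib)
  qed
  also have "\<dots> = (b ^ \<tau>) ^ card (offdiag I) * qdisc q \<tau> I y"
    by (simp add: qdisc_def prod.distrib case_prod_unfold)
  finally show ?thesis
    using assms by (simp add: card_offdiag power_mult[symmetric] mult.commute)
qed

text \<open>Up to permutation, the least multi-index that occurs in the Newton expansion of \<open>qdisc\<close>.\<close>

definition kmin :: "nat \<Rightarrow> nat \<Rightarrow> nat \<Rightarrow> nat" where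
  "kmin n \<tau> i = (if i \<in> {1..n} then (i - 1) * \<tau> else 0)"

lemma prod_offdiag_atLeastAtMost:
  fixes h :: "nat \<Rightarrow> nat \<Rightarrow> 'a::comm_monoid_mult"
  shows "(\<Prod>(j, k)\<in>offdiag {1..n}. h j k) = (\<Prod>k=1..n. \<Prod>j=1..<k. h j k * h k j)"
proof -
  let ?L = "SIGMA k:{1..n}. {1..<k}"
  have "(\<Prod>(j, k)\<in>offdiag {1..n}. h j k) =
      (\<Prod>(j, k)\<in>prod.swap ` ?L. h j k) * (\<Prod>(j, k)\<in>?L. h j k)"
  proof -
    have "offdiag {1..n} = prod.swap ` ?L \<union> ?L"
      by (auto simp: offdiag_def image_iff)
    moreover have "prod.swap ` ?L \<inter> ?L = {}"
      by auto
    ultimately show ?thesis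
      by (simp add: prod.union_disjoint)
  qed
  also have "(\<Prod>(j, k)\<in>prod.swap ` ?L. h j k) = (\<Prod>(k, j)\<in>?L. h j k)"
    by (subst prod.reindex) (auto simp: case_prod_unfold)
  also have "\<dots> * (\<Prod>(j, k)\<in>?L. h j k) = (\<Prod>(k, j)\<in>?L. h j k * h k j)"
    by (simp add: prod.distrib case_prod_unfold)
  finally show ?thesis
    by (simp add: prod.Sigma)
qed

lemma prod_offdiag_snd:
  fixes g :: "'a \<Rightarrow> 'b::comm_monoid_mult"
  assumes "finite I"
  shows "(\<Prod>(j, k)\<in>offdiag I. g k) = (\<Prod>k\<in>I. g k ^ (card I - 1))"
proof -
  have "(\<Prod>(j, k)\<in>offdiag I. g k) = (\<Prod>(k, j)\<in>(SIGMA k:I. I - {k}). g k)"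
    by (rule prod.reindex_bij_witness[of _ prod.swap prod.swap]) (auto simp: offdiag_def)
  also have "\<dots> = (\<Prod>k\<in>I. \<Prod>j\<in>I - {k}. g k)"
    using assms by (subst prod.Sigma) auto
  also have "\<dots> = (\<Prod>k\<in>I. g k ^ (card I - 1))"
    using assms by (intro prod.cong refl) (simp add: card_Diff_singleton)
  finally show ?thesis .
qed

context
  fixes q :: real
  assumes q: "0 < q" "q < 1"
begin

lemma qdisc_eq_qfin:
  assumes "finite I" "\<And>i. i \<in> I \<Longrightarrow> y i \<noteq> 0"
  shows "qdisc q \<tau> I y = (\<Prod>k\<in>I. y k ^ ((card I - 1) * \<tau>)) * (\<Prod>(j, k)\<in>offdiag I. qfin q (y j / y k) \<tau>)"
proof -
  have "qdisc q \<tau> I y = (\<Prod>(j, k)\<in>offdiag I. y k ^ \<tau> * qfin q (y j / y k) \<tau>)"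
    unfolding qdisc_def
  proof (intro prod.cong refl, clarify)
    fix j k assume "(j, k) \<in> offdiag I"
    then have nz: "y k \<noteq> 0" using assms by (auto simp: offdiag_def)
    have "(\<Prod>i<\<tau>. y k - of_real q ^ i * y j) = (\<Prod>i<\<tau>. y k * (1 - of_real q ^ i * (y j / y k)))"
      using nz by (intro prod.cong refl) (simp add: field_simps)
    then show "(\<Prod>i<\<tau>. y k - of_real q ^ i * y j) = y k ^ \<tau> * qfin q (y j / y k) \<tau>"
      by (simp add: prod.distrib qfin_def)
  qed
  also have "\<dots> = (\<Prod>(j, k)\<in>offdiag I. y k ^ \<tau>) * (\<Prod>(j, k)\<in>offdiag I. qfin q (y j / y k) \<tau>)"
    by (simp add: prod.distrib case_prod_unfold)
  also have "(\<Prod>(j, k)\<in>offdiag I. y k ^ \<tau>) = (\<Prod>k\<in>I. y k ^ ((card I - 1) * \<tau>))"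
    using prod_offdiag_snd[OF assms(1), of "\<lambda>k. y k ^ \<tau>"] by (simp add: power_mult[symmetric] mult.commute)
  finally show ?thesis .
qed

text \<open>The linear factor of the pair \<open>(j, i)\<close> with exponent
  \<open>\<nu> j - \<nu> i\<close>, which is below \<open>\<tau>\<close>, vanishes at the
  node.\<close>

lemma qdisc_node_zero:
  assumes "finite I" "i \<in> I" "j \<in> I" "i \<noteq> j" "\<nu> i \<le> \<nu> j" "\<nu> j < \<nu> i + \<tau>"
  shows "qdisc q \<tau> I (node q \<nu>) = 0"
proof -
  have "complex_of_real q ^ \<nu> j = of_real q ^ (\<nu> j - \<nu> i) * of_real q ^ \<nu> i"
    using assms(5) by (metis le_add_diff_inverse2 power_add)
  then have "node q \<nu> i - of_real q ^ (\<nu> j - \<nu> i) * node q \<nu> j = 0"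
    using q by (simp add: node_def field_simps)
  then have "(\<Prod>l<\<tau>. node q \<nu> i - of_real q ^ l * node q \<nu> j) = 0"
    using assms by (auto intro!: bexI[of _ "\<nu> j - \<nu> i"])
  moreover have "(j, i) \<in> offdiag I"
    using assms by (auto simp: offdiag_def)
  ultimately show ?thesis
    using assms(1) unfolding qdisc_def by (intro prod_zero) (auto intro!: bexI[of _ "(j, i)"])
qed

text \<open>The enumeration \<open>f\<close> sorts \<open>k\<close> increasingly. The lower bounds
  come from the zeros of \<open>qdisc\<close> at the nodes, the upper ones from its joint degrees;
  they are counted from \<open>i = 0\<close>.\<close>

lemma qdisc_expansion:
  assumes I: "finite I" "card I = n" and \<tau>: "\<tau> > 0"
  obtains E c where "finite E" "\<And>k i. k \<in> E \<Longrightarrow> i \<notin> I \<Longrightarrow> k i = 0"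
    and "\<And>y. qdisc q \<tau> I y = (\<Sum>k\<in>E. c k * newton q I k y)"
    and "\<And>k. k \<in> E \<Longrightarrow> c k \<noteq> 0 \<Longrightarrow>
      \<exists>f. bij_betw f {..<n} I \<and> (\<forall>i<n. i * \<tau> \<le> k (f i) \<and> k (f i) \<le> (n - 1 + i) * \<tau>)"
proof -
  let ?S = "offdiag I \<times> {..<\<tau>}"
  let ?B = "\<lambda>J. card {s\<in>?S. fst (fst s) \<in> J \<or> snd (fst s) \<in> J}"
  have "newton_span q I ?B (\<lambda>y. \<Prod>s\<in>?S. y (snd (fst s)) - of_real q ^ snd s * y (fst (fst s)))"
    using I by (intro newton_span_prod[OF q I(1)] finite_cartesian_product finite_offdiag)
      (auto simp: offdiag_def)
  moreover have "(\<Prod>s\<in>?S. y (snd (fst s)) - of_real q ^ snd s * y (fst (fst s))) = qdisc q \<tau> I y" for y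
    using I(1) by (simp add: qdisc_def case_prod_unfold prod.cartesian_product)
  ultimately obtain c where c: "\<And>y. qdisc q \<tau> I y = (\<Sum>k\<in>exps I ?B. c k * newton q I k y)"
    unfolding newton_span_def by auto
  show thesis
  proof (rule that[of "exps I ?B" c])
    show fin: "finite (exps I ?B)"
      by (rule finite_exps[OF I(1)])
    show supp: "k i = 0" if "k \<in> exps I ?B" "i \<notin> I" for k i
      using that by (simp add: exps_def)
    show "qdisc q \<tau> I y = (\<Sum>k\<in>exps I ?B. c k * newton q I k y)" for y
      by (rule c)
    fix k assume k: "k \<in> exps I ?B" "c k \<noteq> 0"
    \<comment> \<open>A nonzero coefficient forces a nonzero value at some node below
      \<open>k\<close>. The entries of this \<open>\<nu>\<close> are pairwise at least
      \<open>\<tau>\<close> apart, although those of \<open>k\<close> need not be.\<close>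
    obtain \<nu> where \<nu>: "\<And>i. \<nu> i \<le> k i" "qdisc q \<tau> I (node q \<nu>) \<noteq> 0"
    proof (rule ccontr)
      assume "\<not> thesis"
      then have zero: "\<And>\<nu>. (\<And>i. \<nu> i \<le> k i) \<Longrightarrow> qdisc q \<tau> I (node q \<nu>) = 0"
        using that by blast
      have "c k = 0"
      proof (rule newton_coeff_zero[where F = "qdisc q \<tau> I" and c = c and k = k, OF q I(1) fin _ c k(1)])
        show "k' i = 0" if "k' \<in> exps I ?B" "i \<notin> I" for k' i
          by (rule supp[OF that])
        show "qdisc q \<tau> I (node q \<nu>) = 0" if "\<And>i. \<nu> i \<le> k i" for \<nu>
          using that by (rule zero)
      qed
      with k(2) show False by simp
    qed
    obtain f where f: "bij_betw f {..<n} I" "\<And>i j. i \<le> j \<Longrightarrow> j < n \<Longrightarrow> k (f i) \<le> k (f j)"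
      using obtain_sorting[OF I] by metis
    have inj: "inj_on f A" if "A \<subseteq> {..<n}" for A
      using f(1) that by (auto simp: bij_betw_def intro: inj_on_subset)
    have fI: "f i \<in> I" if "i < n" for i
      using f(1) that by (auto simp: bij_betw_def)
    have "i * \<tau> \<le> k (f i) \<and> k (f i) \<le> (n - 1 + i) * \<tau>" if i: "i < n" for i
    proof
      have "(card (f ` {..i}) - 1) * \<tau> \<le> k (f i)"
      proof (rule card_separated_le[OF _ \<tau>])
        fix a assume "a \<in> f ` {..i}"
        then show "\<nu> a \<le> k (f i)"
          using f(2) \<nu>(1) i order_trans by (metis atMost_iff imageE)
      next
        fix a b assume ab: "a \<in> f ` {..i}" "b \<in> f ` {..i}" "a \<noteq> b" "\<nu> a \<le> \<nu> b"
        then have "a \<in> I" "b \<in> I"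
          using fI i by auto
        then show "\<nu> a + \<tau> \<le> \<nu> b"
          using qdisc_node_zero[OF I(1), of a b \<nu> \<tau>] ab \<nu>(2) by (meson not_le)
      qed simp
      moreover have "inj_on f {..i}"
        using i by (intro inj) auto
      then have "card (f ` {..i}) = Suc i"
        by (simp add: card_image)
      ultimately show "i * \<tau> \<le> k (f i)" by simp
    next
      \<comment> \<open>The positions of the \<open>n - i\<close> largest entries. Together they are
        bounded by the joint degree \<open>(n - i) * (n - 1 + i) * \<tau>\<close>, so the smallest
        of them is at most the average.\<close>
      let ?J = "f ` {i..<n}"
      have injJ: "inj_on f {i..<n}"
        by (intro inj) auto
      have J: "?J \<subseteq> I" "card ?J = n - i"
        using fI injJ by (auto simp: card_image)
      have "(n - i) * k (f i) = (\<Sum>j\<in>{i..<n}. k (f i))"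
        by simp
      also have "\<dots> \<le> (\<Sum>j\<in>{i..<n}. k (f j))"
        using f(2) by (intro sum_mono) auto
      also have "\<dots> = sum k ?J"
        using injJ by (simp add: sum.reindex)
      also have "\<dots> \<le> ?B ?J"
        using k(1) J(1) by (simp add: exps_def)
      also have "{s\<in>?S. fst (fst s) \<in> ?J \<or> snd (fst s) \<in> ?J} = {(j, k)\<in>offdiag I. j \<in> ?J \<or> k \<in> ?J} \<times> {..<\<tau>}"
        by auto
      also have "card \<dots> = card {(j, k)\<in>offdiag I. j \<in> ?J \<or> k \<in> ?J} * \<tau>"
        by (simp add: card_cartesian_product)
      also have "\<dots> = (n - i) * (2 * n - 1 - (n - i)) * \<tau>"
        by (subst card_offdiag_touching[OF I(1) J(1)]) (simp only: J(2) I(2))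
      also have "2 * n - 1 - (n - i) = n - 1 + i"
        using i by simp
      finally show "k (f i) \<le> (n - 1 + i) * \<tau>"
        using i by simp
    qed
    with f(1) show "\<exists>f. bij_betw f {..<n} I \<and> (\<forall>i<n. i * \<tau> \<le> k (f i) \<and> k (f i) \<le> (n - 1 + i) * \<tau>)"
      by blast
  qed
qed

text \<open>At these nodes the ratios are powers of \<open>q ^ \<tau>\<close>, so for fixed
  \<open>k\<close> the factorials of length \<open>\<tau>\<close> join end to end. One chain starts
  at \<open>q ^ \<tau>\<close>, the other at the node itself; the latter makes up the Newton
  product, which cancels when the coefficient is read off.\<close>

lemma qdisc_kmin:
  "qdisc q \<tau> {1..n} (node q (kmin n \<tau>)) =
    (\<Prod>k=1..n. node q (kmin n \<tau>) k ^ ((n - 1) * \<tau>)) * (\<Prod>k=1..n. qfin q (of_real q ^ \<tau>) ((k - 1) * \<tau>))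
     * newton q {1..n} (kmin n \<tau>) (node q (kmin n \<tau>))"
proof -
  let ?Y = "node q (kmin n \<tau>)"
  have Y: "?Y k \<noteq> 0" for k
    using q by (simp add: node_def)
  have ratio: "?Y k / ?Y j * of_real q ^ ((k - j) * \<tau>) = 1" "?Y j / ?Y k = of_real q ^ ((k - j) * \<tau>)"
    if "1 \<le> j" "j < k" "k \<le> n" for j k
  proof -
    have "(k - 1) * \<tau> = (k - j) * \<tau> + (j - 1) * \<tau>"
      using that by (simp flip: add_mult_distrib)
    then have "complex_of_real q ^ ((k - 1) * \<tau>) = of_real q ^ ((k - j) * \<tau>) * of_real q ^ ((j - 1) * \<tau>)"
      by (simp only: power_add)
    then show "?Y k / ?Y j * of_real q ^ ((k - j) * \<tau>) = 1" "?Y j / ?Y k = of_real q ^ ((k - j) * \<tau>)"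
      using q that by (auto simp: node_def kmin_def field_simps)
  qed
  have "(\<Prod>j=1..<k. qfin q (?Y j / ?Y k) \<tau> * qfin q (?Y k / ?Y j) \<tau>) =
      qfin q (of_real q ^ \<tau>) ((k - 1) * \<tau>) * qfin q (?Y k) ((k - 1) * \<tau>)" if k: "k \<in> {1..n}" for k
  proof -
    have 1: "(\<Prod>j=1..<k. qfin q (?Y j / ?Y k) \<tau>) = (\<Prod>d<k - 1. qfin q (of_real q ^ (d * \<tau>) * of_real q ^ \<tau>) \<tau>)"
    proof (rule prod.reindex_bij_witness[of _ "\<lambda>d. k - 1 - d" "\<lambda>j. k - 1 - j"])
      fix j assume j: "j \<in> {1..<k}"
      then have "(k - j) * \<tau> = (k - 1 - j) * \<tau> + \<tau>"
        by (metis Suc_diff_Suc atLeastLessThan_iff diff_Suc_eq_diff_pred mult_Suc add.commute One_nat_def)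
      then show "qfin q (of_real q ^ ((k - 1 - j) * \<tau>) * of_real q ^ \<tau>) \<tau> = qfin q (?Y j / ?Y k) \<tau>"
        using ratio(2)[of j k] j k by (simp add: power_add)
    qed auto
    have 2: "(\<Prod>j=1..<k. qfin q (?Y k / ?Y j) \<tau>) = (\<Prod>d<k - 1. qfin q (of_real q ^ (d * \<tau>) * ?Y k) \<tau>)"
    proof (rule prod.reindex_bij_witness[of _ "\<lambda>d. Suc d" "\<lambda>j. j - 1"])
      fix j assume j: "j \<in> {1..<k}"
      then have "?Y k / ?Y j = of_real q ^ ((j - 1) * \<tau>) * ?Y k"
        using k by (simp add: node_def kmin_def)
      then show "qfin q (of_real q ^ ((j - 1) * \<tau>) * ?Y k) \<tau> = qfin q (?Y k / ?Y j) \<tau>"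
        by simp
    qed auto
    show ?thesis
      by (simp only: prod.distrib 1 2 prod_qfin_blocks)
  qed
  then have "(\<Prod>k=1..n. \<Prod>j=1..<k. qfin q (?Y j / ?Y k) \<tau> * qfin q (?Y k / ?Y j) \<tau>) =
      (\<Prod>k=1..n. qfin q (of_real q ^ \<tau>) ((k - 1) * \<tau>) * qfin q (?Y k) (kmin n \<tau> k))"
    by (intro prod.cong) (auto simp: kmin_def)
  then have "(\<Prod>(j, k)\<in>offdiag {1..n}. qfin q (?Y j / ?Y k) \<tau>) =
      (\<Prod>k=1..n. qfin q (of_real q ^ \<tau>) ((k - 1) * \<tau>)) * newton q {1..n} (kmin n \<tau>) ?Y"
    unfolding prod_offdiag_atLeastAtMost by (simp only: prod.distrib newton_def)
  then show ?thesis
    using Y by (subst qdisc_eq_qfin) (simp_all add: mult.assoc)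
qed

text \<open>The minimal multi-indices are the permutations of \<open>kmin\<close>, and they are
  \<open>n!\<close> in number because \<open>\<tau> > 0\<close> separates the entries. Each
  coefficient can be read off at its own node, and by the symmetry of \<open>qdisc\<close> all of
  them are equal.\<close>

lemma sum_minimal_coeffs:
  assumes \<tau>: "\<tau> > 0" and E: "finite E" "\<And>k i. k \<in> E \<Longrightarrow> i \<notin> {1..n} \<Longrightarrow> k i = 0"
    and c: "\<And>y. qdisc q \<tau> {1..n} y = (\<Sum>k\<in>E. c k * newton q {1..n} k y)"
    and lower: "\<And>k. k \<in> E \<Longrightarrow> c k \<noteq> 0 \<Longrightarrow> \<exists>f. bij_betw f {..<n} {1..n} \<and> (\<forall>i<n. i * \<tau> \<le> k (f i))"
  shows "(\<Sum>k | k \<in> E \<and> c k \<noteq> 0 \<and> (\<exists>f. bij_betw f {..<n} {1..n} \<and> (\<forall>i<n. k (f i) = i * \<tau>)). c k) =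
    fact n * ((\<Prod>k=1..n. node q (kmin n \<tau>) k ^ ((n - 1) * \<tau>))
      * (\<Prod>k=1..n. qfin q (of_real q ^ \<tau>) ((k - 1) * \<tau>)))"
    (is "sum c ?A = _ * ?C")
proof -
  let ?k = "kmin n \<tau>" and ?I = "{1..n}"
  define M where "M = (\<lambda>p. ?k \<circ> p) ` {p. p permutes ?I}"
  have k_bij: "?k (Suc i) = i * \<tau>" if "i < n" for i
    using that by (simp add: kmin_def)
  have sum_min: "sum k ?I = (\<Sum>i<n. k (f i))" if "bij_betw f {..<n} ?I" for f and k :: "nat \<Rightarrow> nat"
    by (rule sum.reindex_bij_betw[OF that, symmetric])
  have "complex_of_real q ^ i * of_real q ^ \<tau> \<noteq> 1" for i
  proof -
    have "q ^ (i + \<tau>) < 1"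
      using q \<tau> power_strict_decreasing[of 0 "i + \<tau>" q] by simp
    then show ?thesis
      by (metis of_real_1 of_real_eq_iff of_real_power power_add less_irrefl)
  qed
  \<comment> \<open>\<open>E\<close> is not assumed to contain the minimal multi-indices; that it
    does, with nonzero coefficients, follows from this value.\<close>
  then have C0: "?C \<noteq> 0"
    using q by (auto simp: node_def qfin_eq_0_iff)
  have M: "k \<in> ?A \<and> c k = ?C" if "k \<in> M" for k
  proof -
    obtain p where p: "p permutes ?I" "k = ?k \<circ> p"
      using \<open>k \<in> M\<close> by (auto simp: M_def)
    define f where "f = inv p \<circ> Suc"
    have "bij_betw Suc {..<n} ?I"
      by (rule bij_betw_byWitness[where f' = "\<lambda>i. i - 1"]) auto
    then have f: "bij_betw f {..<n} ?I"
      unfolding f_def using permutes_imp_bij[OF permutes_inv[OF p(1)]] by (rule bij_betw_trans)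
    have kf: "k (f i) = i * \<tau>" if "i < n" for i
      using permutes_inverses(1)[OF p(1)] k_bij that by (simp add: p f_def)
    have supp: "k i = 0" if "i \<notin> ?I" for i
      using that permutes_not_in[OF p(1) that] by (auto simp: p kmin_def)
    have "qdisc q \<tau> ?I (node q k) = (if k \<in> E then c k else 0) * newton q ?I k (node q k)"
    proof (rule newton_coeff_at_node[where F = "qdisc q \<tau> ?I" and c = c and k = k,
          OF q finite_atLeastAtMost E(1) _ c])
      show "k' i = 0" if "k' \<in> E" "i \<notin> ?I" for k' i
        using E(2) that by blast
    next
      fix l assume l: "l \<in> E" "l \<noteq> k" "\<And>i. l i \<le> k i"
      show "c l = 0"
      proof (rule ccontr)
        assume "c l \<noteq> 0"
        then obtain g where g: "bij_betw g {..<n} ?I" "\<And>i. i < n \<Longrightarrow> i * \<tau> \<le> l (g i)"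
          using lower[OF l(1)] by blast
        obtain i where i: "l i \<noteq> k i"
          using l(2) by auto
        then have "i \<in> ?I"
          using E(2)[OF l(1), of i] supp[of i] by metis
        \<comment> \<open>The total of \<open>k\<close> is already the least one possible for an
          index with nonzero coefficient, so nothing strictly below \<open>k\<close> contributes at
          its node.\<close>
        then have "sum l ?I < sum k ?I"
          using l(3) i by (intro sum_strict_mono_ex1) (auto intro!: bexI[of _ i] simp: le_neq_trans)
        also have "\<dots> = (\<Sum>i<n. i * \<tau>)"
          unfolding sum_min[OF f] by (intro sum.cong) (auto simp: kf)
        also have "\<dots> \<le> sum l ?I"
          unfolding sum_min[OF g(1)] by (intro sum_mono) (auto intro: g(2))
        finally show False by simp
      qed
    qed (rule supp)
    moreover have "node q k = node q ?k \<circ> p"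
      by (auto simp: node_def p)
    then have "qdisc q \<tau> ?I (node q k) = qdisc q \<tau> ?I (node q ?k)"
      by (simp only: qdisc_permute[OF p(1)])
    moreover have "newton q ?I k (node q k) = newton q ?I ?k (node q ?k)"
      unfolding newton_def
      using prod.permute[OF p(1), of "\<lambda>i. qfin q (node q ?k i) (?k i)"] by (simp add: p node_def o_def)
    ultimately have "(if k \<in> E then c k else 0) = ?C"
      using newton_node_nonzero[OF q finite_atLeastAtMost, of 1 n ?k] qdisc_kmin[of \<tau> n] by simp
    with C0 have "k \<in> E" "c k = ?C"
      by (auto split: if_splits)
    with C0 f kf show ?thesis
      by auto
  qed
  moreover have "?A \<subseteq> M"
  proof
    fix k assume "k \<in> ?A"
    then obtain f where k: "k \<in> E" and f: "bij_betw f {..<n} ?I" "\<And>i. i < n \<Longrightarrow> k (f i) = i * \<tau>"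
      by auto
    define p where "p i = (if i \<in> ?I then Suc (inv_into {..<n} f i) else i)" for i
    have g: "bij_betw (inv_into {..<n} f) ?I {..<n}"
      by (rule bij_betw_inv_into[OF f(1)])
    have "bij_betw Suc {..<n} ?I"
      by (rule bij_betw_byWitness[where f' = "\<lambda>i. i - 1"]) auto
    from bij_betw_trans[OF g this] have "bij_betw p ?I ?I"
      by (rule bij_betw_cong[THEN iffD1, rotated]) (auto simp: p_def)
    then have p: "p permutes ?I"
      by (rule bij_imp_permutes) (auto simp: p_def)
    have "k i = ?k (p i)" for i
    proof (cases "i \<in> ?I")
      case True
      have "inv_into {..<n} f i < n"
        using bij_betwE[OF g] True by auto
      moreover have "f (inv_into {..<n} f i) = i"
        using bij_betw_inv_into_right[OF f(1) True] .
      ultimately show ?thesis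
        using f(2)[of "inv_into {..<n} f i"] True by (simp add: p_def k_bij)
    next
      case False
      then show ?thesis
        using E(2)[OF k False] by (simp only: p_def kmin_def False if_False)
    qed
    then have "k = ?k \<circ> p"
      by (simp add: fun_eq_iff)
    then show "k \<in> M"
      using p unfolding M_def by blast
  qed
  ultimately have "?A = M"
    by blast
  have "inj_on (\<lambda>p. ?k \<circ> p) {p. p permutes ?I}"
  proof (rule inj_onI)
    fix p p' assume pp: "p \<in> {p. p permutes ?I}" "p' \<in> {p. p permutes ?I}" "?k \<circ> p = ?k \<circ> p'"
    show "p = p'"
    proof
      fix i
      show "p i = p' i"
      proof (cases "i \<in> ?I")
        case True
        then have "p i \<in> ?I" "p' i \<in> ?I"
          using pp permutes_in_image by fastforce+
        moreover have "?k (p i) = ?k (p' i)"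
          using pp(3) by (simp add: fun_eq_iff)
        ultimately show ?thesis
          using \<tau> by (auto simp: kmin_def)
      next
        case False
        then show ?thesis
          using pp by (simp add: permutes_not_in)
      qed
    qed
  qed
  then have "card M = fact n"
    unfolding M_def by (simp add: card_image card_permutations)
  then show ?thesis
    unfolding \<open>?A = M\<close> using M by simp
qed

end

section \<open>The finite sum as a polynomial in \<open>p\<close>\<close>

definition newton_sum ::
  "real \<Rightarrow> nat set \<Rightarrow> (nat \<Rightarrow> nat) set \<Rightarrow> ((nat \<Rightarrow> nat) \<Rightarrow> complex) \<Rightarrow> complex \<Rightarrow> complex \<Rightarrow> complex \<Rightarrow> complex" where
  "newton_sum q I E c u v p =
     (\<Sum>k\<in>E. c k * (\<Prod>i\<in>I. qfin q u (k i) * qfin q v (k i) / qfin q p (k i)))"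

definition qfin_poly :: "real \<Rightarrow> complex \<Rightarrow> nat \<Rightarrow> complex poly" where
  "qfin_poly q \<alpha> m = (\<Prod>j<m. [:1, - (of_real q ^ j * \<alpha>):])"

lemma poly_qfin_poly [simp]: "poly (qfin_poly q \<alpha> m) p = qfin q (\<alpha> * p) m"
  by (simp add: qfin_poly_def qfin_def poly_prod mult_ac)

lemma qfin_poly_props:
  assumes "q \<noteq> 0" "\<alpha> \<noteq> 0"
  shows "degree (qfin_poly q \<alpha> m) = m" "lead_coeff (qfin_poly q \<alpha> m) = (\<Prod>j<m. - (of_real q ^ j * \<alpha>))"
    "qfin_poly q \<alpha> m \<noteq> 0"
proof -
  show "degree (qfin_poly q \<alpha> m) = m"
    unfolding qfin_poly_def using assms by (subst degree_prod_eq_sum_degree) auto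
  show "lead_coeff (qfin_poly q \<alpha> m) = (\<Prod>j<m. - (of_real q ^ j * \<alpha>))"
    unfolding qfin_poly_def lead_coeff_prod using assms by simp
  show "qfin_poly q \<alpha> m \<noteq> 0"
    using assms by (auto simp: qfin_poly_def)
qed

text \<open>Since \<open>U\<close> does not vanish at 0, the whole power of the variable must divide
  \<open>Q\<close>. Then \<open>T\<close> is a polynomial multiple of \<open>U\<close>, and the
  degrees leave only a constant, determined by the coefficient of order \<open>N\<close>.\<close>

lemma poly_eq_smult_of_power_multiple:
  fixes T U Q :: "'a::field poly"
  assumes eq: "T * monom 1 N = smult a (U * Q)" and U0: "poly U 0 \<noteq> 0"
    and deg: "degree T \<le> N" "degree U = N" and a: "a \<noteq> 0"
  shows "T = smult (coeff T N / lead_coeff U) U"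
proof (cases "T = 0")
  case True
  then show ?thesis by simp
next
  case False
  have U: "U \<noteq> 0" using U0 by auto
  have "T * monom 1 N \<noteq> 0"
    using False by (simp add: monom_eq_0_iff)
  then have UQ: "U * Q \<noteq> 0" and Q: "Q \<noteq> 0"
    using eq by auto
  have "monom 1 N dvd smult a (U * Q)"
    unfolding eq[symmetric] by simp
  then have "monom 1 N dvd U * Q"
    using a dvd_smult_iff by blast
  then have "N \<le> order 0 (U * Q)"
    using UQ by (simp add: monom_1_dvd_iff)
  also have "\<dots> = order 0 Q"
    using U0 UQ by (simp add: order_mult order_0I)
  finally have "monom 1 N dvd Q"
    using Q by (simp add: monom_1_dvd_iff)
  then obtain R where R: "Q = monom 1 N * R" by (rule dvdE)
  have "monom 1 N * (T - smult a (U * R)) = 0"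
    using eq R by (simp add: algebra_simps)
  then have T: "T = smult a (U * R)"
    by (simp add: monom_eq_0_iff)
  have R0: "R \<noteq> 0" using Q R by auto
  have "degree T = N + degree R"
    unfolding T using a U R0 deg by (simp add: degree_mult_eq)
  then have "degree R = 0"
    using deg by simp
  then obtain r where r: "R = [:r:]"
    by (rule degree_eq_zeroE)
  have T': "T = smult (a * r) U"
    unfolding T r by simp
  have "coeff T N = a * r * lead_coeff U"
    unfolding T' using deg by simp
  then have "coeff T N / lead_coeff U = a * r"
    using U by simp
  with T' show ?thesis
    by simp
qed

lemma sum_offset_index: "(\<Sum>i<n. (n - 1) * \<tau>) = 2 * (\<Sum>i<n. i * \<tau>)" for n \<tau> :: nat
proof -
  have "2 * (\<Sum>i<n. i) = n * (n - 1)"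
  proof (induction n)
    case (Suc m)
    then show ?case by (cases m) auto
  qed simp
  then show ?thesis
    by (simp flip: sum_distrib_right add: mult.assoc[symmetric])
qed

context
  fixes q :: real
  assumes q: "0 < q" "q < 1"
begin

text \<open>Multiplied by the common denominator, both sides of \<open>sym\<close> become
  polynomials in \<open>p\<close>. The right one visibly contains a product of degree
  \<open>N\<close>, so \<open>poly_eq_smult_of_power_multiple\<close> applies. Any infinite
  \<open>Z\<close> will do, which leaves a convenient choice to the application.\<close>

lemma newton_sum_product:
  fixes u v :: complex and n \<tau> :: nat and I :: "nat set" and E :: "(nat \<Rightarrow> nat) set" and c :: "(nat \<Rightarrow> nat) \<Rightarrow> complex"
  defines "U \<equiv> \<lambda>x. \<Prod>i<n. qfin q x (i * \<tau>)"
  defines "S \<equiv> newton_sum q I E c"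
  assumes uv: "u \<noteq> 0" "v \<noteq> 0" and E: "finite E"
    and bounds: "\<And>k. k \<in> E \<Longrightarrow> c k \<noteq> 0 \<Longrightarrow>
      \<exists>f. bij_betw f {..<n} I \<and> (\<forall>i<n. i * \<tau> \<le> k (f i) \<and> k (f i) \<le> (n - 1 + i) * \<tau>)"
    and Z: "infinite Z" "\<And>p. p \<in> Z \<Longrightarrow> p \<noteq> 0" "\<And>p m. p \<in> Z \<Longrightarrow> m \<le> (2 * n - 2) * \<tau> \<Longrightarrow> qfin q p m \<noteq> 0"
    and sym: "\<And>p. p \<in> Z \<Longrightarrow>
      S u v p * p ^ (n * (n - 1) * \<tau>) = (u * v) ^ (n * (n - 1) * \<tau>) * S (p / v) (p / u) p"
    and p: "\<And>m. m \<le> (2 * n - 2) * \<tau> \<Longrightarrow> qfin q p m \<noteq> 0"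
  shows "S u v p * (\<Prod>i<n. qfin q p ((n - 1 + i) * \<tau>)) =
    (\<Sum>k | k \<in> E \<and> c k \<noteq> 0 \<and> (\<exists>f. bij_betw f {..<n} I \<and> (\<forall>i<n. k (f i) = i * \<tau>)). c k) *
    U u * U v * U (p / u) * U (p / v) *
    ((\<Prod>i<n. \<Prod>j<(n - 1) * \<tau>. - (of_real q ^ j * of_real q ^ (i * \<tau>)))
      / (\<Prod>i<n. \<Prod>j<i * \<tau>. (of_real q ^ j) ^ 2 / (u * v)))"
proof -
  have qn: "q \<noteq> 0" "complex_of_real q \<noteq> 0"
    using q by auto
  define E' where "E' = {k\<in>E. c k \<noteq> 0}"
  have E': "finite E'"
    using E by (simp add: E'_def)
  \<comment> \<open>One enumeration of \<open>I\<close> is fixed for every multi-index that occurs;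
    all products over \<open>I\<close> are rewritten along it.\<close>
  obtain f where f: "\<And>k. k \<in> E' \<Longrightarrow> bij_betw (f k) {..<n} I"
      "\<And>k i. k \<in> E' \<Longrightarrow> i < n \<Longrightarrow> i * \<tau> \<le> k (f k i)"
      "\<And>k i. k \<in> E' \<Longrightarrow> i < n \<Longrightarrow> k (f k i) \<le> (n - 1 + i) * \<tau>"
  proof -
    have "\<forall>k\<in>E'. \<exists>f. bij_betw f {..<n} I \<and> (\<forall>i<n. i * \<tau> \<le> k (f i) \<and> k (f i) \<le> (n - 1 + i) * \<tau>)"
      using bounds by (auto simp: E'_def)
    then obtain f where "\<forall>k\<in>E'. bij_betw (f k) {..<n} I \<and> (\<forall>i<n. i * \<tau> \<le> k (f k i) \<and> k (f k i) \<le> (n - 1 + i) * \<tau>)"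
      by (rule bchoice[THEN exE])
    then show thesis using that by blast
  qed
  define N where "N = n * (n - 1) * \<tau>"
  define Den where "Den p = (\<Prod>i<n. qfin q p ((n - 1 + i) * \<tau>))" for p
  \<comment> \<open>\<open>R k\<close> is \<open>Den\<close> divided by the product of the
    \<open>qfin q p (k i)\<close>, a polynomial by the upper bounds. \<open>W a k\<close> is the
    product of the \<open>qfin q (p / a) (k i)\<close> without its part common to all
    \<open>k\<close>, a polynomial by the lower bounds. That common part, for \<open>u\<close> and
    \<open>v\<close>, is \<open>UU\<close>.\<close>
  define R where "R k = (\<Prod>i<n. qfin_poly q (of_real q ^ k (f k i)) ((n - 1 + i) * \<tau> - k (f k i)))" for k
  define W where "W a k = (\<Prod>i<n. qfin_poly q (of_real q ^ (i * \<tau>) / a) (k (f k i) - i * \<tau>))" for a k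
  define UU where "UU = (\<Prod>i<n. qfin_poly q (1 / u) (i * \<tau>) * qfin_poly q (1 / v) (i * \<tau>))"
  define T where "T = (\<Sum>k\<in>E'. smult (c k * (\<Prod>i\<in>I. qfin q u (k i) * qfin q v (k i))) (R k))"
  define Q where "Q = (\<Sum>k\<in>E'. smult (c k) (R k * (W u k * W v k)))"
  have reindex: "(\<Prod>i\<in>I. g (k i)) = (\<Prod>i<n. g (k (f k i)))" if "k \<in> E'" for k and g :: "nat \<Rightarrow> complex"
    using prod.reindex_bij_betw[OF f(1)[OF that], of "\<lambda>i. g (k i)"] by simp
  have S_E': "S u v p = (\<Sum>k\<in>E'. c k * (\<Prod>i\<in>I. qfin q u (k i) * qfin q v (k i) / qfin q p (k i)))" for u v p
    unfolding S_def newton_sum_def E'_def using E by (intro sum.mono_neutral_right) auto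
  have R: "poly (R k) p * (\<Prod>i\<in>I. qfin q p (k i)) = Den p" if k: "k \<in> E'" for k p
    unfolding reindex[OF k] R_def poly_prod Den_def prod.distrib[symmetric] poly_qfin_poly
  proof (rule prod.cong[OF refl])
    fix i assume "i \<in> {..<n}"
    then show "qfin q (of_real q ^ k (f k i) * p) ((n - 1 + i) * \<tau> - k (f k i)) * qfin q p (k (f k i))
        = qfin q p ((n - 1 + i) * \<tau>)"
      using f(3)[OF k, of i] qfin_add[of q p "k (f k i)" "(n - 1 + i) * \<tau> - k (f k i)"] by simp
  qed
  have W: "(\<Prod>i<n. qfin q (p / a) (i * \<tau>)) * poly (W a k) p = (\<Prod>i\<in>I. qfin q (p / a) (k i))"
    if k: "k \<in> E'" for k a p
    unfolding reindex[OF k] W_def poly_prod prod.distrib[symmetric] poly_qfin_poly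
  proof (rule prod.cong[OF refl])
    fix i assume "i \<in> {..<n}"
    then show "qfin q (p / a) (i * \<tau>) * qfin q (of_real q ^ (i * \<tau>) / a * p) (k (f k i) - i * \<tau>)
        = qfin q (p / a) (k (f k i))"
      using f(2)[OF k, of i] qfin_add[of q "p / a" "i * \<tau>" "k (f k i) - i * \<tau>"] by simp
  qed
  have nz: "(\<Prod>i\<in>I. qfin q p (k i)) \<noteq> 0"
    if k: "k \<in> E'" and p: "\<And>m. m \<le> (2 * n - 2) * \<tau> \<Longrightarrow> qfin q p m \<noteq> 0" for k p
  proof -
    have "k (f k i) \<le> (2 * n - 2) * \<tau>" if i: "i < n" for i
      using f(3)[OF k i] by (rule order_trans) (use i in \<open>intro mult_right_mono, auto\<close>)
    then show ?thesis
      unfolding reindex[OF k] using p by auto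
  qed
  have T: "poly T p = Den p * S u v p" if p: "\<And>m. m \<le> (2 * n - 2) * \<tau> \<Longrightarrow> qfin q p m \<noteq> 0" for p
    unfolding T_def S_E' poly_sum sum_distrib_left
  proof (rule sum.cong[OF refl])
    fix k assume k: "k \<in> E'"
    show "poly (smult (c k * (\<Prod>i\<in>I. qfin q u (k i) * qfin q v (k i))) (R k)) p =
        Den p * (c k * (\<Prod>i\<in>I. qfin q u (k i) * qfin q v (k i) / qfin q p (k i)))"
      unfolding R[OF k, symmetric] prod_dividef using nz[OF k p] by simp
  qed
  have UU: "poly UU p = U (p / u) * U (p / v)" for p
    by (simp add: UU_def U_def poly_prod prod.distrib)
  have Q: "poly (UU * Q) p = Den p * S (p / v) (p / u) p"
    if p: "\<And>m. m \<le> (2 * n - 2) * \<tau> \<Longrightarrow> qfin q p m \<noteq> 0" for p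
    unfolding Q_def S_E' poly_mult poly_sum sum_distrib_left UU
  proof (rule sum.cong[OF refl])
    fix k assume k: "k \<in> E'"
    have WU: "U (p / a) * poly (W a k) p = (\<Prod>i\<in>I. qfin q (p / a) (k i))" for a
      unfolding U_def by (rule W[OF k])
    have "U (p / u) * U (p / v) * poly (smult (c k) (R k * (W u k * W v k))) p =
       c k * poly (R k) p * (U (p / u) * poly (W u k) p) * (U (p / v) * poly (W v k) p)"
      by simp
    then show "U (p / u) * U (p / v) * poly (smult (c k) (R k * (W u k * W v k))) p =
        Den p * (c k * (\<Prod>i\<in>I. qfin q (p / v) (k i) * qfin q (p / u) (k i) / qfin q p (k i)))"
      unfolding R[OF k, symmetric] prod_dividef WU prod.distrib using nz[OF k p]
      by (simp add: mult.commute[of "\<Prod>i\<in>I. qfin q (p / v) (k i)"])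
  qed
  \<comment> \<open>Two polynomials in \<open>p\<close> that agree on the infinite set
    \<open>Z\<close> are equal; this frees the symmetry from all restrictions on
    \<open>p\<close>.\<close>
  have "T * monom 1 N - smult ((u * v) ^ N) (UU * Q) = 0"
  proof (rule ccontr)
    assume "T * monom 1 N - smult ((u * v) ^ N) (UU * Q) \<noteq> 0"
    then have "finite {x. poly (T * monom 1 N - smult ((u * v) ^ N) (UU * Q)) x = 0}"
      by (rule poly_roots_finite)
    moreover have "Z \<subseteq> {x. poly (T * monom 1 N - smult ((u * v) ^ N) (UU * Q)) x = 0}"
    proof
      fix z assume z: "z \<in> Z"
      have "poly T z * z ^ N = (u * v) ^ N * poly (UU * Q) z"
        using sym[OF z] T[OF Z(3)[OF z]] Q[OF Z(3)[OF z]] by (simp add: N_def mult_ac)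
      then show "z \<in> {x. poly (T * monom 1 N - smult ((u * v) ^ N) (UU * Q)) x = 0}"
        by (simp add: poly_monom)
    qed
    ultimately show False
      using Z(1) finite_subset by blast
  qed
  then have eq: "T * monom 1 N = smult ((u * v) ^ N) (UU * Q)"
    by simp
  have N2: "(\<Sum>i<n. i * \<tau> + i * \<tau>) = N"
    using sum_offset_index[of n \<tau>] by (simp add: sum.distrib N_def mult_2)
  have degU: "degree UU = N"
    unfolding UU_def N2[symmetric] using uv qn
    by (subst degree_prod_eq_sum_degree) (auto simp: qfin_poly_props degree_mult_eq)
  have leadU: "lead_coeff UU = (\<Prod>i<n. \<Prod>j<i * \<tau>. (of_real q ^ j) ^ 2 / (u * v))"
  proof -
    have nz: "1 / u \<noteq> 0" "1 / v \<noteq> 0" using uv by auto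
    show ?thesis
      unfolding UU_def lead_coeff_prod lead_coeff_mult
        qfin_poly_props(2)[OF qn(1) nz(1)] qfin_poly_props(2)[OF qn(1) nz(2)] prod.distrib[symmetric]
      by (simp add: power2_eq_square)
  qed
  have degR: "degree (R k) = (\<Sum>i<n. (n - 1 + i) * \<tau> - k (f k i))" for k
    unfolding R_def using qn by (subst degree_prod_eq_sum_degree) (auto simp: qfin_poly_props)
  have le: "(n - 1 + i) * \<tau> - k (f k i) \<le> (n - 1) * \<tau>" if "k \<in> E'" "i < n" for k i
    using f(2)[OF that] by (simp add: add_mult_distrib)
  have degR_le: "degree (R k) \<le> N" if k: "k \<in> E'" for k
  proof -
    have "degree (R k) \<le> (\<Sum>i<n. (n - 1) * \<tau>)"
      unfolding degR by (intro sum_mono le[OF k]) auto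
    then show ?thesis
      by (simp add: N_def)
  qed
  have degT: "degree T \<le> N"
    unfolding T_def by (intro degree_sum_le E') (use degR_le degree_smult_le order_trans in blast)
  define L where "L = (\<Prod>i<n. \<Prod>j<(n - 1) * \<tau>. - (complex_of_real q ^ j * of_real q ^ (i * \<tau>)))"
  define A where "A = {k. k \<in> E \<and> c k \<noteq> 0 \<and> (\<exists>f. bij_betw f {..<n} I \<and> (\<forall>i<n. k (f i) = i * \<tau>))}"
  \<comment> \<open>\<open>R k\<close> attains degree \<open>N\<close> only if every lower bound is
    an equality, so the other multi-indices contribute nothing to the leading coefficient.\<close>
  have coeff: "c k * (\<Prod>i\<in>I. qfin q u (k i) * qfin q v (k i)) * coeff (R k) N =
      (if k \<in> A then c k else 0) * (U u * U v * L)" if k: "k \<in> E'" for k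
  proof (cases "\<forall>i<n. k (f k i) = i * \<tau>")
    case True
    then have "k \<in> A"
      using k f(1)[OF k] by (auto simp: A_def E'_def)
    moreover have "(\<Prod>i\<in>I. qfin q u (k i) * qfin q v (k i)) = U u * U v"
      unfolding reindex[OF k, of "\<lambda>m. qfin q u m * qfin q v m"] U_def prod.distrib[symmetric]
      using True by (intro prod.cong) auto
    moreover have "coeff (R k) N = L"
    proof -
      have d: "(n - 1 + i) * \<tau> - k (f k i) = (n - 1) * \<tau>" if "i < n" for i
        using True that by (simp only: add_mult_distrib add_diff_cancel_right')
      then have "degree (R k) = N"
        unfolding degR N_def by simp
      then have "coeff (R k) N = lead_coeff (R k)" by simp
      also have "\<dots> = L"
        unfolding R_def lead_coeff_prod L_def
      proof (rule prod.cong[OF refl])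
        fix i assume "i \<in> {..<n}"
        then show "lead_coeff (qfin_poly q (of_real q ^ k (f k i)) ((n - 1 + i) * \<tau> - k (f k i))) =
            (\<Prod>j<(n - 1) * \<tau>. - (complex_of_real q ^ j * of_real q ^ (i * \<tau>)))"
          using True d qn by (subst qfin_poly_props(2)) auto
      qed
      finally show ?thesis .
    qed
    ultimately show ?thesis by simp
  next
    case False
    then obtain i where i: "i < n" "k (f k i) \<noteq> i * \<tau>" by auto
    then have "i * \<tau> < k (f k i)"
      using f(2)[OF k i(1)] by simp
    have "degree (R k) < (\<Sum>i<n. (n - 1) * \<tau>)"
      unfolding degR
    proof (rule sum_strict_mono_ex1)
      have "(n - 1 + i) * \<tau> = (n - 1) * \<tau> + i * \<tau>"
        by (rule add_mult_distrib)
      then have "(n - 1 + i) * \<tau> - k (f k i) < (n - 1) * \<tau>"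
        using \<open>i * \<tau> < k (f k i)\<close> f(3)[OF k i(1)] by linarith
      then show "\<exists>i\<in>{..<n}. (n - 1 + i) * \<tau> - k (f k i) < (n - 1) * \<tau>"
        using i(1) by blast
    qed (use le[OF k] in auto)
    then have "coeff (R k) N = 0"
      by (intro coeff_eq_0) (simp add: N_def)
    \<comment> \<open>Membership in \<open>A\<close> allows any enumeration, not just
      \<open>f k\<close>; comparing the totals of all entries excludes the others too.\<close>
    moreover have "k \<notin> A"
    proof
      assume "k \<in> A"
      then obtain g where g: "bij_betw g {..<n} I" "\<And>i. i < n \<Longrightarrow> k (g i) = i * \<tau>"
        by (auto simp: A_def)
      have "(\<Sum>i<n. i * \<tau>) = sum k I"
        using sum.reindex_bij_betw[OF g(1), of k] g(2) by simp
      also have "\<dots> = (\<Sum>i<n. k (f k i))"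
        using sum.reindex_bij_betw[OF f(1)[OF k], of k] by simp
      also have "\<dots> > (\<Sum>i<n. i * \<tau>)"
        using f(2)[OF k] i(1) \<open>i * \<tau> < k (f k i)\<close> by (intro sum_strict_mono_ex1) auto
      finally show False by simp
    qed
    ultimately show ?thesis by simp
  qed
  have "coeff T N = (\<Sum>k\<in>E'. (if k \<in> A then c k else 0) * (U u * U v * L))"
    unfolding T_def by (simp add: coeff_sum coeff)
  also have "\<dots> = (\<Sum>k\<in>E'. if k \<in> A then c k else 0) * (U u * U v * L)"
    by (simp add: sum_distrib_right)
  also have "(\<Sum>k\<in>E'. if k \<in> A then c k else 0) = (\<Sum>k\<in>E' \<inter> A. c k)"
    by (simp add: sum.inter_restrict[OF E'])
  also have "E' \<inter> A = A"
    by (auto simp: A_def E'_def)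
  finally have coeffT: "coeff T N = sum c A * (U u * U v * L)" .
  have "poly UU 0 \<noteq> 0"
    by (simp add: UU U_def qfin_def)
  with poly_eq_smult_of_power_multiple[OF eq _ degT degU] uv
  have "T = smult (coeff T N / lead_coeff UU) UU"
    by simp
  then have "poly T p = coeff T N / lead_coeff UU * poly UU p"
    by (metis poly_smult)
  with T[OF p] have "S u v p * Den p = coeff T N / lead_coeff UU * poly UU p"
    by (simp add: mult.commute)
  then show ?thesis
    unfolding UU coeffT leadU A_def L_def Den_def by (simp add: mult_ac)
qed

end

section \<open>The multiple integral\<close>

lemma jackson0_eq: "jackson0 q f a = (1 - of_real q) * lattice_sum q f a"
  by (simp add: jackson0_def lattice_sum_def)

definition lattice :: "real \<Rightarrow> complex \<Rightarrow> complex \<Rightarrow> complex set" where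
  "lattice q a b = {c * of_real q powi \<nu> |c \<nu>. c \<in> {a, b}}"

lemma jackson_cong:
  assumes "\<And>w. w \<in> lattice q a b \<Longrightarrow> f w = g w"
  shows "jackson q a b f = jackson q a b g"
    and "jackson_converges q a b f \<longleftrightarrow> jackson_converges q a b g"
proof -
  have "f (c * of_real q powi \<nu>) = g (c * of_real q powi \<nu>)" if "c \<in> {a, b}" for c \<nu>
    using that by (intro assms) (auto simp: lattice_def)
  then show "jackson q a b f = jackson q a b g" "jackson_converges q a b f \<longleftrightarrow> jackson_converges q a b g"
    by (simp_all add: jackson_def jackson0_def jackson_converges_def jackson0_converges_def)
qed

lemma jackson_sum:
  assumes "finite S" "\<And>s. s \<in> S \<Longrightarrow> jackson_converges q a b (f s)"
  shows "jackson_converges q a b (\<lambda>w. \<Sum>s\<in>S. \<alpha> s * f s w)"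
    and "jackson q a b (\<lambda>w. \<Sum>s\<in>S. \<alpha> s * f s w) = (\<Sum>s\<in>S. \<alpha> s * jackson q a b (f s))"
proof -
  have *: "((\<lambda>\<nu>::int. (\<Sum>s\<in>S. \<alpha> s * f s (c * of_real q powi \<nu>)) * (c * of_real q powi \<nu>)) has_sum
      (\<Sum>s\<in>S. \<alpha> s * (\<Sum>\<^sub>\<infinity>\<nu>::int. f s (c * of_real q powi \<nu>) * (c * of_real q powi \<nu>)))) UNIV"
    if c: "c \<in> {a, b}" for c
  proof -
    let ?g = "\<lambda>s \<nu>. f s (c * of_real q powi \<nu>) * (c * of_real q powi \<nu>)"
    have "(?g s has_sum infsum (?g s) UNIV) UNIV" if "s \<in> S" for s
      using assms(2)[OF that] c
      by (intro has_sum_infsum) (auto simp: jackson_converges_def jackson0_converges_def)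
    then have "((\<lambda>\<nu>. \<Sum>s\<in>S. \<alpha> s * ?g s \<nu>) has_sum (\<Sum>s\<in>S. \<alpha> s * infsum (?g s) UNIV)) UNIV"
      using assms(1)
    proof (induction S rule: infinite_finite_induct)
      case (insert s S)
      then show ?case
        by (simp add: has_sum_add has_sum_cmult_right)
    qed simp_all
    then show ?thesis
      by (simp add: sum_distrib_right mult.assoc)
  qed
  show "jackson_converges q a b (\<lambda>w. \<Sum>s\<in>S. \<alpha> s * f s w)"
    using *[of a] *[of b] by (auto simp: jackson_converges_def jackson0_converges_def summable_on_def)
  show "jackson q a b (\<lambda>w. \<Sum>s\<in>S. \<alpha> s * f s w) = (\<Sum>s\<in>S. \<alpha> s * jackson q a b (f s))"
    using infsumI[OF *[of a]] infsumI[OF *[of b]]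
    by (simp add: jackson_def jackson0_def sum_distrib_left right_diff_distrib sum_subtractf mult.left_commute)
qed

text \<open>No infinite sums are interchanged: a finite sum of products is integrated one variable
  at a time, with the factors in the other variables as constants. The expansion of \<open>F\<close>
  is assumed at lattice points only, since it is there that multiplying the weight by a shifted
  factorial amounts to shifting \<open>b1\<close>.\<close>

lemma jackson_iter_sum_of_products:
  fixes F :: "(nat \<Rightarrow> complex) \<Rightarrow> complex" and h :: "'s \<Rightarrow> nat \<Rightarrow> complex \<Rightarrow> complex"
  assumes S: "finite S"
    and F: "\<And>z. (\<And>i. i \<in> {1..n} \<Longrightarrow> z i \<in> lattice q a b) \<Longrightarrow> F z = (\<Sum>s\<in>S. \<alpha> s * (\<Prod>i=1..n. h s i (z i)))"
    and h: "\<And>s i. s \<in> S \<Longrightarrow> i \<in> {1..n} \<Longrightarrow> jackson_converges q a b (h s i)"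
  shows "m \<le> n \<Longrightarrow> (\<And>i. i \<in> {m<..n} \<Longrightarrow> z i \<in> lattice q a b) \<Longrightarrow>
    jackson_iter_converges q a b m F z \<and>
    jackson_iter q a b m F z =
      (\<Sum>s\<in>S. \<alpha> s * (\<Prod>i=1..m. jackson q a b (h s i)) * (\<Prod>i\<in>{m<..n}. h s i (z i)))"
proof (induction m arbitrary: z)
  case 0
  have "{0<..n} = {1..n}" by auto
  with 0 F[of z] show ?case by simp
next
  case (Suc m)
  let ?\<beta> = "\<lambda>s. \<alpha> s * (\<Prod>i=1..m. jackson q a b (h s i)) * (\<Prod>i\<in>{Suc m<..n}. h s i (z i))"
  have IH: "jackson_iter_converges q a b m F (z(Suc m := w)) \<and>
      jackson_iter q a b m F (z(Suc m := w)) = (\<Sum>s\<in>S. ?\<beta> s * h s (Suc m) w)"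
    if w: "w \<in> lattice q a b" for w
  proof -
    have ivl: "{m<..n} = insert (Suc m) {Suc m<..n}"
      using Suc.prems(1) by auto
    have prod_eq: "(\<Prod>i\<in>{m<..n}. h s i ((z(Suc m := w)) i)) = h s (Suc m) w * (\<Prod>i\<in>{Suc m<..n}. h s i (z i))" for s
      unfolding ivl by (subst prod.insert) auto
    have "(z(Suc m := w)) i \<in> lattice q a b" if "i \<in> {m<..n}" for i
      using that Suc.prems(2)[of i] w by auto
    with Suc.prems(1) have "jackson_iter_converges q a b m F (z(Suc m := w)) \<and>
        jackson_iter q a b m F (z(Suc m := w)) = (\<Sum>s\<in>S. \<alpha> s * (\<Prod>i=1..m. jackson q a b (h s i))
          * (\<Prod>i\<in>{m<..n}. h s i ((z(Suc m := w)) i)))"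
      by (intro Suc.IH) auto
    then show ?thesis
      unfolding prod_eq by (simp only: mult_ac)
  qed
  have conv: "jackson_converges q a b (h s (Suc m))" if "s \<in> S" for s
    using h[OF that] Suc.prems(1) by simp
  let ?f = "\<lambda>w. jackson_iter q a b m F (z(Suc m := w))" and ?g = "\<lambda>w. \<Sum>s\<in>S. ?\<beta> s * h s (Suc m) w"
  have eq: "?f w = ?g w" if "w \<in> lattice q a b" for w
    using IH[OF that] by (rule conjunct2)
  have cong: "jackson q a b ?f = jackson q a b ?g" "jackson_converges q a b ?f \<longleftrightarrow> jackson_converges q a b ?g"
    by (rule jackson_cong, erule eq)+
  have "jackson_converges q a b ?f"
    unfolding cong(2) by (rule jackson_sum(1)[OF S conv])
  moreover have "jackson_iter_converges q a b m F (z(Suc m := c * of_real q powi \<nu>))" if "c \<in> {a, b}" for c \<nu>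
    using that by (intro IH[THEN conjunct1]) (auto simp: lattice_def)
  ultimately have "jackson_iter_converges q a b (Suc m) F z"
    by simp
  moreover have "jackson_iter q a b (Suc m) F z = (\<Sum>s\<in>S. ?\<beta> s * jackson q a b (h s (Suc m)))"
    unfolding jackson_iter.simps cong(1) by (rule jackson_sum(2)[OF S conv])
  moreover have "\<dots> = (\<Sum>s\<in>S. \<alpha> s * (\<Prod>i=1..Suc m. jackson q a b (h s i)) * (\<Prod>i\<in>{Suc m<..n}. h s i (z i)))"
    by (intro sum.cong refl) (simp add: mult_ac)
  ultimately show ?case
    by simp
qed

section \<open>Generic end points\<close>

lemma exists_not_in_countable:
  assumes "countable A"
  obtains x :: complex where "x \<notin> A"
  using uncountable_UNIV_complex assms by (metis UNIV_eq_I)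

lemma countable_not_off_lattice: "b \<noteq> 0 \<Longrightarrow> countable {x. \<not> off_lattice q (x * b)}"
proof (rule countable_subset)
  show "b \<noteq> 0 \<Longrightarrow> {x. \<not> off_lattice q (x * b)} \<subseteq> range (\<lambda>m::int. of_real q powi m / b)"
    by (auto simp: off_lattice_def field_simps image_iff)
qed auto

definition selberg_integrand ::
  "real \<Rightarrow> nat \<Rightarrow> nat \<Rightarrow> complex \<Rightarrow> complex \<Rightarrow> complex \<Rightarrow> complex \<Rightarrow> (nat \<Rightarrow> complex) \<Rightarrow> complex" where
  "selberg_integrand q n \<tau> c1 c2 b1 b2 z =
     (\<Prod>i=1..n. z i ^ ((n - 1) * \<tau>) * wt q c1 c2 b1 b2 (z i))
     * (\<Prod>k=1..n. \<Prod>j=1..<k. qfin q (z j / z k) \<tau> * qfin q (z k / z j) \<tau>)"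

lemma selberg_integrand_commute_b: "selberg_integrand q n \<tau> c1 c2 b1 b2 = selberg_integrand q n \<tau> c1 c2 b2 b1"
  unfolding selberg_integrand_def by (subst wt_commute_b) (rule refl)

context
  fixes q :: real
  assumes q: "0 < q" "q < 1"
begin

lemma wt_mult_qfin:
  assumes "off_lattice q (x * b1)"
  shows "wt q c1 c2 (b1 * of_real q ^ k) b2 (x * of_real q powi \<nu>) =
    qfin q (b1 * (x * of_real q powi \<nu>)) k * wt q c1 c2 b1 b2 (x * of_real q powi \<nu>)"
proof (induction k)
  case (Suc k)
  have "qinf q (b1 * of_real q ^ k * (x * of_real q powi \<nu>)) \<noteq> 0"
    using qinf_lattice_nonzero[OF q off_lattice_mult_power[OF q assms, of k, unfolded mult.assoc]] .
  from wt_shift_b1[OF q this, of c1 c2 b2]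
  have "wt q c1 c2 (b1 * of_real q ^ Suc k) b2 (x * of_real q powi \<nu>) =
      (1 - b1 * of_real q ^ k * (x * of_real q powi \<nu>)) * wt q c1 c2 (b1 * of_real q ^ k) b2 (x * of_real q powi \<nu>)"
    by (simp add: mult_ac)
  then show ?case
    unfolding Suc.IH qfin_Suc by (simp add: mult_ac)
qed simp

text \<open>Each condition excludes countably many points. The last two keep the theta functions in
  the numerator of \<open>wint_eq\<close> away from zero.\<close>

lemma exists_generic_points:
  assumes "b1 \<noteq> 0" "b2 \<noteq> 0"
  obtains x1 x2 where "x1 \<noteq> 0" "x2 \<noteq> 0" "admissible q x1 x2 b1 b2"
    "off_lattice q (x1 / x2)" "off_lattice q (x1 * x2 * b1 * b2)"
proof -
  obtain x1 where x1: "x1 \<notin> {0} \<union> {x. \<not> off_lattice q (x * b1)} \<union> {x. \<not> off_lattice q (x * b2)}"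
    using assms by (elim exists_not_in_countable[rotated] | intro countable_Un countable_not_off_lattice | simp)+
  then have x1': "x1 \<noteq> 0" by simp
  obtain x2 where x2: "x2 \<notin> {0} \<union> {x. \<not> off_lattice q (x * b1)} \<union> {x. \<not> off_lattice q (x * b2)}
      \<union> {x. \<not> off_lattice q (x * (1 / x1))} \<union> {x. \<not> off_lattice q (x * (x1 * b1 * b2))}"
    using assms x1' by (elim exists_not_in_countable[rotated] | intro countable_Un countable_not_off_lattice | simp)+
  have x2': "x2 \<noteq> 0" using x2 by simp
  show thesis
  proof (rule that[OF x1' x2'])
    show "admissible q x1 x2 b1 b2"
      using x1 x2 assms by (auto simp: admissible_def[OF q x1' x2'])
    show "off_lattice q (x1 * x2 * b1 * b2)"
      using x2 by (simp add: mult_ac)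
    have "off_lattice q (of_real q / (x2 * (1 / x1)))"
      using x2 by (intro off_lattice_div[OF q]) simp
    moreover have "of_real q / (x2 * (1 / x1)) * of_real q powi (- 1) = x1 / x2"
      using q x1' x2' by (simp add: power_int_minus field_simps)
    ultimately show "off_lattice q (x1 / x2)"
      using off_lattice_mult_powi[OF q, of _ "- 1"] by metis
  qed
qed

context
  fixes x1 x2 :: complex
  assumes x: "x1 \<noteq> 0" "x2 \<noteq> 0"
begin

text \<open>Iteration of \<open>wint_shift_b1\<close>. At each shift the convergence condition for
  the new parameter says \<open>norm (c1 * c2) < norm (d * b2)\<close>, so the new factor of the
  denominator is nonzero.\<close>

lemma wint_newton:
  assumes adm: "admissible q x1 x2 b1 b2" and c: "c1 \<noteq> 0" "c2 \<noteq> 0"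
    and conv: "q * norm (c1 * c2) < norm (b1 * b2) * q ^ k"
  shows "qfin q (b1 * b2 / (c1 * c2)) k \<noteq> 0 \<and> wint q x1 x2 c1 c2 (b1 * of_real q ^ k) b2 =
    qfin q (b1 / c1) k * qfin q (b1 / c2) k / qfin q (b1 * b2 / (c1 * c2)) k * wint q x1 x2 c1 c2 b1 b2"
  using conv
proof (induction k)
  case (Suc k)
  define d where "d = b1 * complex_of_real q ^ k"
  have conv1: "norm (c1 * c2) < norm (b1 * b2) * q ^ k"
    using Suc.prems q by simp
  moreover have "q * norm (c1 * c2) \<le> norm (c1 * c2)"
    using q by (intro mult_left_le_one_le) auto
  ultimately have IH: "qfin q (b1 * b2 / (c1 * c2)) k \<noteq> 0"
    "wint q x1 x2 c1 c2 d b2 =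
    qfin q (b1 / c1) k * qfin q (b1 / c2) k / qfin q (b1 * b2 / (c1 * c2)) k * wint q x1 x2 c1 c2 b1 b2"
    using Suc.IH by (auto simp: d_def)
  have nd: "norm (d * b2) = norm (b1 * b2) * q ^ k"
    using q by (simp add: d_def norm_mult norm_power)
  have adm': "admissible q x1 x2 d b2"
    unfolding d_def by (rule admissible_shift[OF q x adm])
  have "(d * b2 - c1 * c2) * wint q x1 x2 c1 c2 (d * of_real q) b2 = - (d - c1) * (d - c2) * wint q x1 x2 c1 c2 d b2"
    using conv1 by (intro wint_shift_b1[OF q x adm']) (simp add: nd)
  moreover have "d * b2 \<noteq> c1 * c2"
    using conv1 nd by auto
  ultimately have step: "wint q x1 x2 c1 c2 (d * of_real q) b2 =
      (1 - d / c1) * (1 - d / c2) / (1 - d * b2 / (c1 * c2)) * wint q x1 x2 c1 c2 d b2"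
    and nz: "1 - d * b2 / (c1 * c2) \<noteq> 0"
    using c by (simp_all add: divide_simps) (simp_all add: algebra_simps)
  have arg: "of_real q ^ k * (b1 / c1) = d / c1" "of_real q ^ k * (b1 / c2) = d / c2"
      "of_real q ^ k * (b1 * b2 / (c1 * c2)) = d * b2 / (c1 * c2)"
    by (simp_all add: d_def)
  have "wint q x1 x2 c1 c2 (b1 * of_real q ^ Suc k) b2 = wint q x1 x2 c1 c2 (d * of_real q) b2"
    by (simp add: d_def mult_ac)
  then show ?case
    unfolding qfin_Suc arg step IH(2) using IH(1) nz by (simp add: mult_ac)
qed simp

lemma jackson_wt:
  assumes "admissible q x1 x2 b1 b2" "q * norm (c1 * c2) < norm (b1 * b2)"
  shows "jackson_converges q x1 x2 (wt q c1 c2 b1 b2)"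
    and "jackson q x1 x2 (wt q c1 c2 b1 b2) = (1 - of_real q) * wint q x1 x2 c1 c2 b1 b2"
  using wt_summable_admissible[OF q x assms(1) _ assms(2)]
  by (auto simp: jackson_converges_def jackson0_converges_def jackson_def jackson0_eq wint_def[OF q x]
      right_diff_distrib)

text \<open>The expansion of the kernel is evaluated at the points \<open>b1 * z i\<close>, which
  costs a power of \<open>b1\<close> by homogeneity. Each shifted factorial then merges with its
  weight, and the integrand becomes a finite sum of products of weights.\<close>

lemma jackson_iter_selberg:
  assumes adm: "admissible q x1 x2 b1 b2" and c: "c1 \<noteq> 0" "c2 \<noteq> 0"
    and conv: "q * norm (c1 * c2) < norm (b1 * b2) * q ^ ((2 * n - 2) * \<tau>)"
    and E: "finite E" "\<And>y. qdisc q \<tau> {1..n} y = (\<Sum>k\<in>E. C k * newton q {1..n} k y)"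
    and le: "\<forall>k\<in>E. C k \<noteq> 0 \<longrightarrow> (\<forall>i\<in>{1..n}. k i \<le> (2 * n - 2) * \<tau>)"
  shows "jackson_iter_converges q x1 x2 n (selberg_integrand q n \<tau> c1 c2 b1 b2) z"
    and "b1 ^ (n * (n - 1) * \<tau>) * jackson_iter q x1 x2 n (selberg_integrand q n \<tau> c1 c2 b1 b2) z =
      ((1 - of_real q) * wint q x1 x2 c1 c2 b1 b2) ^ n *
      newton_sum q {1..n} E C (b1 / c1) (b1 / c2) (b1 * b2 / (c1 * c2))"
proof -
  have b1: "b1 \<noteq> 0"
    using adm by (simp add: admissible_def[OF q x])
  define N where "N = n * (n - 1) * \<tau>"
  \<comment> \<open>Indices with zero coefficient are dropped, as \<open>le\<close> does not bound
    them and the integrals belonging to them need not converge.\<close>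
  define S where "S = {k\<in>E. C k \<noteq> 0}"
  have S: "finite S" using E(1) by (simp add: S_def)
  let ?h = "\<lambda>k i. wt q c1 c2 (b1 * of_real q ^ k i) b2"
  let ?I = "((1 - of_real q) * wint q x1 x2 c1 c2 b1 b2)"
  have conv': "q * norm (c1 * c2) < norm (b1 * b2) * q ^ k i" if "k \<in> S" "i \<in> {1..n}" for k i
  proof -
    have "q ^ ((2 * n - 2) * \<tau>) \<le> q ^ k i"
      using le that q by (intro power_decreasing) (auto simp: S_def)
    then have "norm (b1 * b2) * q ^ ((2 * n - 2) * \<tau>) \<le> norm (b1 * b2) * q ^ k i"
      by (rule mult_left_mono) simp
    with conv show ?thesis by linarith
  qed
  have h_conv: "jackson_converges q x1 x2 (?h k i)" if "k \<in> S" "i \<in> {1..n}" for k i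
    using conv'[OF that] q
    by (intro jackson_wt admissible_shift[OF q x adm]) (simp add: norm_mult norm_power mult_ac)
  have h_int: "jackson q x1 x2 (?h k i) = ?I *
      (qfin q (b1 / c1) (k i) * qfin q (b1 / c2) (k i) / qfin q (b1 * b2 / (c1 * c2)) (k i))"
    if "k \<in> S" "i \<in> {1..n}" for k i
  proof -
    have "jackson q x1 x2 (?h k i) = (1 - of_real q) * wint q x1 x2 c1 c2 (b1 * of_real q ^ k i) b2"
      using conv'[OF that] q
      by (intro jackson_wt admissible_shift[OF q x adm]) (simp add: norm_mult norm_power mult_ac)
    then show ?thesis
      using wint_newton[OF adm c conv'[OF that]] by simp
  qed
  have F: "selberg_integrand q n \<tau> c1 c2 b1 b2 z = (\<Sum>k\<in>S. (C k / b1 ^ N) * (\<Prod>i=1..n. ?h k i (z i)))"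
    if z: "\<And>i. i \<in> {1..n} \<Longrightarrow> z i \<in> lattice q x1 x2" for z
  proof -
    have z0: "z i \<noteq> 0" if "i \<in> {1..n}" for i
      using z[OF that] x q by (auto simp: lattice_def)
    have h: "?h k i (z i) = qfin q (b1 * z i) (k i) * wt q c1 c2 b1 b2 (z i)" if "i \<in> {1..n}" for k i
      using z[OF that] adm by (auto simp: lattice_def admissible_def[OF q x] intro!: wt_mult_qfin)
    have "qdisc q \<tau> {1..n} z = (\<Prod>k=1..n. z k ^ ((n - 1) * \<tau>)) *
        (\<Prod>k=1..n. \<Prod>j=1..<k. qfin q (z j / z k) \<tau> * qfin q (z k / z j) \<tau>)"
      using qdisc_eq_qfin[OF q, of "{1..n}" z \<tau>] z0
      unfolding prod_offdiag_atLeastAtMost by simp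
    then have "selberg_integrand q n \<tau> c1 c2 b1 b2 z = qdisc q \<tau> {1..n} z * (\<Prod>i=1..n. wt q c1 c2 b1 b2 (z i))"
      by (simp add: selberg_integrand_def prod.distrib mult_ac)
    also have "qdisc q \<tau> {1..n} z = qdisc q \<tau> {1..n} (\<lambda>i. b1 * z i) / b1 ^ N"
      using b1 by (subst qdisc_scale) (auto simp: N_def)
    also have "qdisc q \<tau> {1..n} (\<lambda>i. b1 * z i) = (\<Sum>k\<in>S. C k * newton q {1..n} k (\<lambda>i. b1 * z i))"
      unfolding E(2) S_def using E(1) by (intro sum.mono_neutral_right) auto
    also have "\<dots> / b1 ^ N * (\<Prod>i=1..n. wt q c1 c2 b1 b2 (z i)) =
        (\<Sum>k\<in>S. (C k / b1 ^ N) * (newton q {1..n} k (\<lambda>i. b1 * z i) * (\<Prod>i=1..n. wt q c1 c2 b1 b2 (z i))))"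
      by (simp add: sum_distrib_left sum_divide_distrib mult_ac)
    also have "\<dots> = (\<Sum>k\<in>S. (C k / b1 ^ N) * (\<Prod>i=1..n. ?h k i (z i)))"
    proof -
      have "newton q {1..n} k (\<lambda>i. b1 * z i) * (\<Prod>i=1..n. wt q c1 c2 b1 b2 (z i)) = (\<Prod>i=1..n. ?h k i (z i))" for k
        unfolding newton_def prod.distrib[symmetric] by (rule prod.cong[OF refl], rule h[symmetric])
      then show ?thesis
        by (simp only:)
    qed
    finally show ?thesis .
  qed
  have iter: "jackson_iter_converges q x1 x2 n (selberg_integrand q n \<tau> c1 c2 b1 b2) z \<and>
      jackson_iter q x1 x2 n (selberg_integrand q n \<tau> c1 c2 b1 b2) z =
      (\<Sum>k\<in>S. C k / b1 ^ N * (\<Prod>i=1..n. jackson q x1 x2 (?h k i)) * (\<Prod>i\<in>{n<..n}. ?h k i (z i)))"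
  proof (rule jackson_iter_sum_of_products[OF S])
    show "selberg_integrand q n \<tau> c1 c2 b1 b2 z = (\<Sum>k\<in>S. C k / b1 ^ N * (\<Prod>i=1..n. ?h k i (z i)))"
      if "\<And>i. i \<in> {1..n} \<Longrightarrow> z i \<in> lattice q x1 x2" for z
      using that by (rule F)
    show "jackson_converges q x1 x2 (?h k i)" if "k \<in> S" "i \<in> {1..n}" for k i
      using that by (rule h_conv)
  qed auto
  show "jackson_iter_converges q x1 x2 n (selberg_integrand q n \<tau> c1 c2 b1 b2) z"
    using iter by simp
  have const: "(\<Prod>i=1..n. ?I * g i) = ?I ^ n * (\<Prod>i=1..n. g i)" for g :: "nat \<Rightarrow> complex"
    by (simp add: prod.distrib power_mult_distrib)
  have "jackson_iter q x1 x2 n (selberg_integrand q n \<tau> c1 c2 b1 b2) z =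
      (\<Sum>k\<in>S. C k / b1 ^ N * (\<Prod>i=1..n. jackson q x1 x2 (?h k i)))"
    using iter by simp
  also have "\<dots> = (\<Sum>k\<in>S. C k / b1 ^ N * (?I ^ n *
      (\<Prod>i=1..n. qfin q (b1 / c1) (k i) * qfin q (b1 / c2) (k i) / qfin q (b1 * b2 / (c1 * c2)) (k i))))"
  proof (intro sum.cong refl)
    fix k assume "k \<in> S"
    then have "(\<Prod>i=1..n. jackson q x1 x2 (?h k i)) = (\<Prod>i=1..n. ?I *
      (qfin q (b1 / c1) (k i) * qfin q (b1 / c2) (k i) / qfin q (b1 * b2 / (c1 * c2)) (k i)))"
      by (intro prod.cong refl h_int)
    then show "C k / b1 ^ N * (\<Prod>i=1..n. jackson q x1 x2 (?h k i)) = C k / b1 ^ N * (?I ^ n *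
      (\<Prod>i=1..n. qfin q (b1 / c1) (k i) * qfin q (b1 / c2) (k i) / qfin q (b1 * b2 / (c1 * c2)) (k i)))"
      by (simp only: const)
  qed
  finally have J: "jackson_iter q x1 x2 n (selberg_integrand q n \<tau> c1 c2 b1 b2) z =
      (\<Sum>k\<in>S. C k / b1 ^ N * (?I ^ n *
      (\<Prod>i=1..n. qfin q (b1 / c1) (k i) * qfin q (b1 / c2) (k i) / qfin q (b1 * b2 / (c1 * c2)) (k i))))" .
  have "b1 ^ N * jackson_iter q x1 x2 n (selberg_integrand q n \<tau> c1 c2 b1 b2) z = ?I ^ n * (\<Sum>k\<in>S. C k *
      (\<Prod>i=1..n. qfin q (b1 / c1) (k i) * qfin q (b1 / c2) (k i) / qfin q (b1 * b2 / (c1 * c2)) (k i)))"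
    unfolding J using b1 by (simp add: sum_distrib_left mult_ac)
  also have "(\<Sum>k\<in>S. C k *
      (\<Prod>i=1..n. qfin q (b1 / c1) (k i) * qfin q (b1 / c2) (k i) / qfin q (b1 * b2 / (c1 * c2)) (k i))) =
      newton_sum q {1..n} E C (b1 / c1) (b1 / c2) (b1 * b2 / (c1 * c2))"
    unfolding newton_sum_def S_def using E(1) by (intro sum.mono_neutral_left) auto
  finally show "b1 ^ (n * (n - 1) * \<tau>) * jackson_iter q x1 x2 n (selberg_integrand q n \<tau> c1 c2 b1 b2) z =
      ?I ^ n * newton_sum q {1..n} E C (b1 / c1) (b1 / c2) (b1 * b2 / (c1 * c2))"
    by (simp add: N_def)
qed

end

end

section \<open>Evaluation of the finite sum\<close>

text \<open>The sign and power of \<open>q\<close> in the quasi-periodicity of theta under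
  \<open>m\<close> shifts, see \<open>qtheta_mult_power\<close>.\<close>

definition theta_factor :: "real \<Rightarrow> nat \<Rightarrow> complex" where
  "theta_factor q m = (\<Prod>j<m. - 1 / of_real q ^ j)"

text \<open>\<open>q\<close> to the power \<open>m (m - 1) / 2\<close>, written as a product so that
  no exponent has to be halved.\<close>

definition qtri :: "real \<Rightarrow> nat \<Rightarrow> complex" where
  "qtri q m = (\<Prod>j<m. of_real q ^ j)"

lemma qtri_add: "qtri q (a + b) = qtri q a * qtri q b * of_real q ^ (a * b)"
  by (induction b) (simp_all add: qtri_def power_add mult_ac)

text \<open>All monomials produced by the shifts, with \<open>m = i \<tau>\<close> and
  \<open>e = (n - 1 - i) \<tau>\<close> in the application. The constants and the powers of
  \<open>b1, b2, x1, x2\<close> balance; what remains is the power of \<open>a1 * a2 * q ^ m\<close>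
  found in the value of the finite sum.\<close>

lemma quadratic_monomial_cancel:
  fixes a1 a2 b1 b2 x1 x2 Q \<kappa> \<kappa>' :: complex
  assumes "a1 \<noteq> 0" "a2 \<noteq> 0" "b1 \<noteq> 0" "b2 \<noteq> 0" "x1 \<noteq> 0" "x2 \<noteq> 0" "\<kappa> \<noteq> 0" "\<kappa>' \<noteq> 0"
  shows "(\<kappa> / (a1 * b1) ^ m) * (\<kappa> / (a1 * b2) ^ m) * (\<kappa> / (a2 * b1) ^ m) * (\<kappa> / (a2 * b2) ^ m)
      * (x1 * x2 * Q) ^ e * (\<kappa>' / (x1 * x2 * b1 * b2) ^ (e + m + m))
      / ((\<kappa>' / (a1 * a2 * b1 * b2) ^ (e + m + m)) *
        ((\<kappa> / (x1 * b1) ^ m) * (\<kappa> / (x1 * b2) ^ m) * (\<kappa> / (x2 * b1) ^ m) * (\<kappa> / (x2 * b2) ^ m)))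
     = (a1 * a2) ^ e * Q ^ e"
  using assms by (simp add: power_mult_distrib power_add field_simps)

context
  fixes q :: real
  assumes q: "0 < q" "q < 1"
begin

lemma qinf_nonzero_of_norm_less_1:
  assumes "norm a < 1"
  shows "qinf q a \<noteq> 0"
proof -
  have "of_real q ^ i * a \<noteq> 1" for i
  proof
    assume "of_real q ^ i * a = 1"
    then have "q ^ i * norm a = 1"
      using q by (metis abs_of_pos norm_mult norm_of_real norm_one norm_power)
    moreover have "q ^ i * norm a \<le> 1 * norm a"
      using q by (intro mult_right_mono power_le_one) auto
    ultimately show False using assms by simp
  qed
  then show ?thesis
    using qinf_eq_0_iff[OF q] by auto
qed

lemma theta_factor_nonzero: "theta_factor q m \<noteq> 0"
  using q by (simp add: theta_factor_def)

lemma qtheta_mult_power: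
  assumes "y \<noteq> 0"
  shows "qtheta q (y * of_real q ^ m) = theta_factor q m / y ^ m * qtheta q y"
proof (induction m)
  case (Suc m)
  have "qtheta q (y * of_real q ^ Suc m) = qtheta q (of_real q * (y * of_real q ^ m))"
    by (simp add: mult_ac)
  also have "\<dots> = - qtheta q (y * of_real q ^ m) / (y * of_real q ^ m)"
    using assms q by (intro qtheta_shift[OF q]) simp
  finally show ?case
    unfolding Suc.IH by (simp add: theta_factor_def field_simps)
qed (simp add: theta_factor_def)

text \<open>The monomial is the one of \<open>qtheta_mult_power\<close>, which is why the two kinds
  of shift can cancel in the final formula.\<close>

lemma qinf_div_mult_power:
  assumes "y \<noteq> 0"
  shows "qinf q (of_real q / (y * of_real q ^ m)) = theta_factor q m / y ^ m * qfin q y m * qinf q (of_real q / y)"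
proof (induction m)
  case (Suc m)
  have qn: "complex_of_real q \<noteq> 0" using q by simp
  have "qinf q (of_real q / (y * of_real q ^ Suc m)) = qinf q (1 / (y * of_real q ^ m))"
    using qn by simp
  also have "\<dots> = (1 - 1 / (y * of_real q ^ m)) * qinf q (of_real q / (y * of_real q ^ m))"
    using qinf_shift[OF q, of "1 / (y * of_real q ^ m)"] by simp
  also have "1 - 1 / (y * of_real q ^ m) = - 1 / of_real q ^ m / y * (1 - of_real q ^ m * y)"
    using qn assms by (simp add: field_simps)
  finally show ?case
    unfolding Suc.IH by (simp add: theta_factor_def qfin_Suc mult_ac)
qed (simp add: theta_factor_def)

text \<open>The powers of the nodes cancel the factors \<open>q ^ (i * \<tau>)\<close> of the
  leading coefficients; the triangular powers of \<open>q\<close> that are left combine by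
  \<open>qtri_add\<close>.\<close>

lemma minimal_term_value:
  fixes u v :: complex
  assumes "u \<noteq> 0" "v \<noteq> 0"
  shows "(\<Prod>k=1..n. node q (kmin n \<tau>) k ^ ((n - 1) * \<tau>)) *
      ((\<Prod>i<n. \<Prod>j<(n - 1) * \<tau>. - (of_real q ^ j * of_real q ^ (i * \<tau>)))
        / (\<Prod>i<n. \<Prod>j<i * \<tau>. (of_real q ^ j) ^ 2 / (u * v)))
    = (\<Prod>i<n. (u * v) ^ (i * \<tau>) * (of_real q ^ (i * \<tau>)) ^ ((n - 1 - i) * \<tau>))"
proof -
  have qn: "complex_of_real q \<noteq> 0" using q by simp
  have tri: "qtri q m \<noteq> 0" for m
    using qn by (simp add: qtri_def)
  define M where "M = (n - 1) * \<tau>"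
  have 1: "(\<Prod>k=1..n. node q (kmin n \<tau>) k ^ M) = (\<Prod>i<n. 1 / (of_real q ^ (i * \<tau>)) ^ M)"
    unfolding One_nat_def prod.atLeast1_atMost_eq
    by (intro prod.cong) (auto simp: node_def kmin_def power_divide)
  have 2: "(\<Prod>j<M. - (complex_of_real q ^ j * of_real q ^ (i * \<tau>))) = (- 1) ^ M * qtri q M * (of_real q ^ (i * \<tau>)) ^ M" for i
  proof -
    have "(\<Prod>j<M. - (complex_of_real q ^ j * of_real q ^ (i * \<tau>))) =
        (\<Prod>j<M. (- 1) * of_real q ^ j * of_real q ^ (i * \<tau>))"
      by simp
    then show ?thesis
      by (simp only: prod.distrib prod_constant card_lessThan qtri_def)
  qed
  have 3: "(\<Prod>j<m. (complex_of_real q ^ j) ^ 2 / (u * v)) = qtri q m * qtri q m / (u * v) ^ m" for m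
    by (simp add: prod_dividef power2_eq_square prod.distrib qtri_def)
  \<comment> \<open>The total sign has exponent \<open>n (n - 1) \<tau>\<close>.\<close>
  have "even (n * (n - 1))"
    by auto
  then have sign: "((- 1 :: complex) ^ M) ^ n = 1"
    by (simp add: M_def power_mult[symmetric] mult_ac)
  \<comment> \<open>Reversing the index turns one of the two equal products in the denominator into
    the form in which \<open>split\<close> supplies it.\<close>
  have rev: "(\<Prod>i<n. qtri q (i * \<tau>)) = (\<Prod>i<n. qtri q ((n - 1 - i) * \<tau>))"
    using prod.nat_diff_reindex[of "\<lambda>i. qtri q (i * \<tau>)" n] by simp
  have split: "qtri q M = qtri q (i * \<tau>) * qtri q ((n - 1 - i) * \<tau>) * (of_real q ^ (i * \<tau>)) ^ ((n - 1 - i) * \<tau>)"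
    if "i < n" for i
  proof -
    have "M = i * \<tau> + (n - 1 - i) * \<tau>"
      using that by (simp add: M_def flip: add_mult_distrib)
    then show ?thesis
      by (simp only: qtri_add power_mult)
  qed
  have "(\<Prod>i<n. 1 / (of_real q ^ (i * \<tau>)) ^ M) *
      ((\<Prod>i<n. (- 1) ^ M * qtri q M * (of_real q ^ (i * \<tau>)) ^ M)
        / (\<Prod>i<n. qtri q (i * \<tau>) * qtri q (i * \<tau>) / (u * v) ^ (i * \<tau>)))
     = (\<Prod>i<n. (- 1) ^ M) * (\<Prod>i<n. (u * v) ^ (i * \<tau>)) * (\<Prod>i<n. qtri q M)
        / ((\<Prod>i<n. qtri q (i * \<tau>)) * (\<Prod>i<n. qtri q (i * \<tau>)))"
    using qn assms by (simp add: prod.distrib prod_dividef power_mult_distrib)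
  also have "(\<Prod>i<n. (- 1 :: complex) ^ M) = 1"
    using sign by simp
  also have "(\<Prod>i<n. qtri q M) = (\<Prod>i<n. qtri q (i * \<tau>)) * (\<Prod>i<n. qtri q ((n - 1 - i) * \<tau>))
      * (\<Prod>i<n. (of_real q ^ (i * \<tau>)) ^ ((n - 1 - i) * \<tau>))"
    unfolding prod.distrib[symmetric] by (rule prod.cong[OF refl], rule split) simp
  also have "(\<Prod>i<n. qtri q ((n - 1 - i) * \<tau>)) = (\<Prod>i<n. qtri q (i * \<tau>))"
    by (rule rev[symmetric])
  finally show ?thesis
    unfolding M_def[symmetric] 1 2 3 using tri by (simp add: prod.distrib)
qed

text \<open>The two conditions on \<open>q / u\<close> and \<open>q / v\<close> concern the factors
  of the one-dimensional integral that do not depend on \<open>p\<close>; the others are kept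
  nonzero by choosing \<open>p\<close> large and the end points generic.\<close>

lemma newton_sum_value:
  assumes \<tau>: "\<tau> > 0" and uv: "u \<noteq> 0" "v \<noteq> 0"
    and quv: "qinf q (of_real q / u) \<noteq> 0" "qinf q (of_real q / v) \<noteq> 0"
    and E: "finite E" "\<And>k i. k \<in> E \<Longrightarrow> i \<notin> {1..n} \<Longrightarrow> k i = 0"
    and c: "\<And>y. qdisc q \<tau> {1..n} y = (\<Sum>k\<in>E. c k * newton q {1..n} k y)"
    and bounds: "\<And>k. k \<in> E \<Longrightarrow> c k \<noteq> 0 \<Longrightarrow>
      \<exists>f. bij_betw f {..<n} {1..n} \<and> (\<forall>i<n. i * \<tau> \<le> k (f i) \<and> k (f i) \<le> (n - 1 + i) * \<tau>)"
    and le: "\<forall>k\<in>E. c k \<noteq> 0 \<longrightarrow> (\<forall>i\<in>{1..n}. k i \<le> (2 * n - 2) * \<tau>)"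
    and p: "\<And>m. m \<le> (2 * n - 2) * \<tau> \<Longrightarrow> qfin q p m \<noteq> 0"
  shows "newton_sum q {1..n} E c u v p = fact n *
    (\<Prod>i<n. (u * v) ^ (i * \<tau>) * (of_real q ^ (i * \<tau>)) ^ ((n - 1 - i) * \<tau>) * qfin q (of_real q ^ \<tau>) (i * \<tau>)
      * (qfin q u (i * \<tau>) * qfin q v (i * \<tau>) * qfin q (p / u) (i * \<tau>) * qfin q (p / v) (i * \<tau>))
      / qfin q p ((n - 1 + i) * \<tau>))"
proof -
  \<comment> \<open>The entry 1 keeps \<open>z\<close> away from 0, the norms of \<open>u\<close>
    and \<open>v\<close> put \<open>q * u / z\<close> and \<open>q * v / z\<close> inside the unit
    disc, and the last entry gives convergence up to the largest index. Points of \<open>Z\<close>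
    are negative reals, so no factor \<open>1 - q ^ i * z\<close> vanishes.\<close>
  define M where "M = Max {1, norm u, norm v, q / q ^ ((2 * n - 2) * \<tau>)}"
  define Z where "Z = (\<lambda>r. - complex_of_real r) ` {M<..}"
  let ?S = "newton_sum q {1..n} E c"
  let ?N = "n * (n - 1) * \<tau>"
  have M: "1 \<le> M" "norm u \<le> M" "norm v \<le> M" "q / q ^ ((2 * n - 2) * \<tau>) \<le> M"
    by (auto simp: M_def intro!: Max_ge)
  have Zinf: "infinite Z"
    unfolding Z_def by (subst finite_image_iff) (auto intro!: inj_onI infinite_Ioi)
  have ZM: "norm z > M" if "z \<in> Z" for z
    using that M(1) by (auto simp: Z_def)
  have Z0: "z \<noteq> 0" if "z \<in> Z" for z
    using ZM[OF that] M(1) by auto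
  have Zq: "qfin q z m \<noteq> 0" if z: "z \<in> Z" for z m
  proof
    assume "qfin q z m = 0"
    then obtain i r where "of_real q ^ i * - complex_of_real r = 1" "r > M"
      using z by (auto simp: qfin_eq_0_iff Z_def)
    then have "complex_of_real (- (q ^ i * r)) = of_real 1"
      by simp
    then have "- (q ^ i * r) = 1"
      by (simp only: of_real_eq_iff)
    moreover have "q ^ i * r > 0"
      using q M(1) \<open>r > M\<close> by simp
    ultimately show False by simp
  qed
  \<comment> \<open>Any \<open>b1, b2\<close> and generic end points will do here: the integral is the same after exchanging
    \<open>b1\<close> and \<open>b2\<close>, and \<open>norm z > M\<close> makes it converge and keeps the one-dimensional integral nonzero.\<close>
  have sym: "?S u v z * z ^ ?N = (u * v) ^ ?N * ?S (z / v) (z / u) z" if z: "z \<in> Z" for z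
  proof -
    \<comment> \<open>With \<open>b1 = 1\<close>, \<open>a1 = u\<close> and \<open>a2 = v\<close>,
      this makes \<open>a1 * a2 * b1 * b2\<close> equal to \<open>z\<close>.\<close>
    define b2 where "b2 = z / (u * v)"
    have b2: "b2 \<noteq> 0"
      using Z0[OF z] uv by (simp add: b2_def)
    obtain x1 x2 where x: "x1 \<noteq> 0" "x2 \<noteq> 0" and adm: "admissible q x1 x2 1 b2"
      and gen: "off_lattice q (x1 / x2)" "off_lattice q (x1 * x2 * 1 * b2)"
      using exists_generic_points[OF q, of 1 b2] b2 by auto
    have c12: "1 / u \<noteq> 0" "1 / v \<noteq> 0"
      using uv by auto
    have nb: "norm (1 / u * (1 / v)) * norm z = norm (1 * b2)"
      by (simp add: b2_def norm_mult norm_divide)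
    have "q < norm z * q ^ ((2 * n - 2) * \<tau>)"
    proof -
      have "q / q ^ ((2 * n - 2) * \<tau>) < norm z"
        using M(4) ZM[OF z] by linarith
      then show ?thesis
        using q by (simp add: divide_less_eq)
    qed
    then have "q * norm (1 / u * (1 / v)) < norm z * q ^ ((2 * n - 2) * \<tau>) * norm (1 / u * (1 / v))"
      using uv by (intro mult_strict_right_mono) auto
    then have conv: "q * norm (1 / u * (1 / v)) < norm (1 * b2) * q ^ ((2 * n - 2) * \<tau>)"
      unfolding nb[symmetric] by (simp only: mult_ac)
    moreover have "norm (1 * b2) * q ^ ((2 * n - 2) * \<tau>) \<le> norm (1 * b2) * 1"
      using q by (intro mult_left_mono power_le_one) auto
    ultimately have conv': "q * norm (1 / u * (1 / v)) < norm (1 * b2)"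
      by linarith
    have conv2: "q * norm (1 / u * (1 / v)) < norm (b2 * 1) * q ^ ((2 * n - 2) * \<tau>)"
      using conv by (simp add: mult.commute)
    \<comment> \<open>The argument is \<open>q * w' / z\<close>, where \<open>w'\<close> is the
      other one of \<open>u\<close> and \<open>v\<close>.\<close>
    have small: "qinf q (of_real q * (1 / w) / b2) \<noteq> 0" if "w \<in> {u, v}" for w
    proof (rule qinf_nonzero_of_norm_less_1)
      define w' where "w' = (if w = u then v else u)"
      have "of_real q * (1 / w) / b2 = of_real q * w' / z"
        using that uv by (auto simp: b2_def w'_def)
      then have "norm (of_real q * (1 / w) / b2) = q * norm w' / norm z"
        using q by (simp add: norm_mult norm_divide)
      also have "\<dots> \<le> q * 1"
        using ZM[OF z] M(2,3) q Z0[OF z] by (simp add: w'_def divide_le_eq)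
      finally show "norm (of_real q * (1 / w) / b2) < 1"
        using q by simp
    qed
    have "qtheta q (x1 * 1) \<noteq> 0" "qtheta q (x1 * b2) \<noteq> 0" "qtheta q (x2 * 1) \<noteq> 0" "qtheta q (x2 * b2) \<noteq> 0"
      using adm by (auto simp: admissible_def[OF q x] intro!: qtheta_off_lattice[OF q])
    then have "wint q x1 x2 (1 / u) (1 / v) 1 b2 \<noteq> 0"
      using wint_eq[OF q x adm conv'] small[of u] small[of v] quv x qtheta_off_lattice[OF q gen(1)]
        qtheta_off_lattice[OF q gen(2)] qinf_nonzero_of_norm_less_1[of "of_real q"] q by auto
    then have I: "((1 - of_real q) * wint q x1 x2 (1 / u) (1 / v) 1 b2) ^ n \<noteq> 0"
      using q by simp
    let ?J = "jackson_iter q x1 x2 n (selberg_integrand q n \<tau> (1 / u) (1 / v) 1 b2) (\<lambda>_. 0)"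
    have "?J = ((1 - of_real q) * wint q x1 x2 (1 / u) (1 / v) 1 b2) ^ n * ?S u v z"
      using jackson_iter_selberg(2)[OF q x adm c12 conv E(1) c le, of "\<lambda>_. 0"] uv
      by (simp add: b2_def)
    moreover have "b2 ^ ?N * ?J = ((1 - of_real q) * wint q x1 x2 (1 / u) (1 / v) 1 b2) ^ n * ?S (z / v) (z / u) z"
    proof -
      have adm': "admissible q x1 x2 b2 1"
        using adm admissible_commute[OF q x] by blast
      have args: "b2 / (1 / u) = z / v" "b2 / (1 / v) = z / u" "b2 * 1 / (1 / u * (1 / v)) = z"
        using uv by (auto simp: b2_def)
      show ?thesis
        using jackson_iter_selberg(2)[OF q x adm' c12 conv2 E(1) c le, of "\<lambda>_. 0"]
        unfolding args selberg_integrand_commute_b[of q n \<tau> "1 / u" "1 / v" b2 1]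
          wint_commute_b[OF q x, of "1 / u" "1 / v" b2 1] .
    qed
    ultimately have "((1 - of_real q) * wint q x1 x2 (1 / u) (1 / v) 1 b2) ^ n * (b2 ^ ?N * ?S u v z) =
        ((1 - of_real q) * wint q x1 x2 (1 / u) (1 / v) 1 b2) ^ n * ?S (z / v) (z / u) z"
      by (metis mult.left_commute)
    then have "b2 ^ ?N * ?S u v z = ?S (z / v) (z / u) z"
      using mult_left_cancel[OF I] by blast
    then show ?thesis
      using uv by (simp add: b2_def power_divide field_simps)
  qed
  have Den: "(\<Prod>i<n. qfin q p ((n - 1 + i) * \<tau>)) \<noteq> 0"
  proof -
    have "qfin q p ((n - 1 + i) * \<tau>) \<noteq> 0" if "i < n" for i
      using that by (intro p mult_right_mono) auto
    then show ?thesis by simp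
  qed
  have sum_min: "(\<Sum>k | k \<in> E \<and> c k \<noteq> 0 \<and> (\<exists>f. bij_betw f {..<n} {1..n} \<and> (\<forall>i<n. k (f i) = i * \<tau>)). c k) =
    fact n * ((\<Prod>k=1..n. node q (kmin n \<tau>) k ^ ((n - 1) * \<tau>))
      * (\<Prod>k=1..n. qfin q (of_real q ^ \<tau>) ((k - 1) * \<tau>)))"
  proof (rule sum_minimal_coeffs[where E = E and c = c, OF q \<tau> E(1) _ c])
    show "k i = 0" if "k \<in> E" "i \<notin> {1..n}" for k i
      using that by (rule E(2))
    show "\<exists>f. bij_betw f {..<n} {1..n} \<and> (\<forall>i<n. i * \<tau> \<le> k (f i))" if "k \<in> E" "c k \<noteq> 0" for k
      using bounds[OF that] by blast
  qed
  let ?U = "\<lambda>x. \<Prod>i<n. qfin q x (i * \<tau>)"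
  let ?L = "(\<Prod>i<n. \<Prod>j<(n - 1) * \<tau>. - (of_real q ^ j * complex_of_real q ^ (i * \<tau>)))
      / (\<Prod>i<n. \<Prod>j<i * \<tau>. (of_real q ^ j) ^ 2 / (u * v))"
  have "?S u v p * (\<Prod>i<n. qfin q p ((n - 1 + i) * \<tau>)) =
    (\<Sum>k | k \<in> E \<and> c k \<noteq> 0 \<and> (\<exists>f. bij_betw f {..<n} {1..n} \<and> (\<forall>i<n. k (f i) = i * \<tau>)). c k) *
    ?U u * ?U v * ?U (p / u) * ?U (p / v) * ?L"
  proof (rule newton_sum_product[where Z = Z and c = c and E = E, OF q uv E(1) _ Zinf])
    show "\<exists>f. bij_betw f {..<n} {1..n} \<and> (\<forall>i<n. i * \<tau> \<le> k (f i) \<and> k (f i) \<le> (n - 1 + i) * \<tau>)"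
      if "k \<in> E" "c k \<noteq> 0" for k
      using that by (rule bounds)
  qed (use Z0 Zq sym p in auto)
  also have "\<dots> = fact n * ((\<Prod>k=1..n. node q (kmin n \<tau>) k ^ ((n - 1) * \<tau>)) * ?L) *
      (\<Prod>k=1..n. qfin q (of_real q ^ \<tau>) ((k - 1) * \<tau>)) * (?U u * ?U v * ?U (p / u) * ?U (p / v))"
    unfolding sum_min by (simp only: mult_ac)
  also have "(\<Prod>k=1..n. qfin q (of_real q ^ \<tau>) ((k - 1) * \<tau>)) = ?U (of_real q ^ \<tau>)"
    unfolding One_nat_def prod.atLeast1_atMost_eq by simp
  finally have "?S u v p = fact n * (\<Prod>i<n. (u * v) ^ (i * \<tau>) * (of_real q ^ (i * \<tau>)) ^ ((n - 1 - i) * \<tau>)) *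
      ?U (of_real q ^ \<tau>) * (?U u * ?U v * ?U (p / u) * ?U (p / v)) / (\<Prod>i<n. qfin q p ((n - 1 + i) * \<tau>))"
    unfolding minimal_term_value[OF uv] using Den by (simp add: eq_divide_eq)
  then show ?thesis
    by (simp only: prod.distrib prod_dividef times_divide_eq_right mult.assoc)
qed

end

text \<open>In the application \<open>tI\<close> is the infinite factorial of
  \<open>t ^ (i + 1)\<close>; inserted above and below, it turns the finite factorial
  \<open>qt\<close> into a quotient of infinite ones, as in \<open>C0\<close>.\<close>

lemma factor_rearrange:
  fixes s :: complex
  assumes "tI \<noteq> 0"
  shows "s * qq * A / P * (x2 * T1 * T2 / (T3 * T4 * T5 * T6)) * (B * X * K1 / (K2 * D) * qt * F / Dp) =
    s * (qq * (qt * tI) * (B * F * A) / (tI * (K2 * Dp * P))) * (X * x2 * T1 * (K1 * T2) / (D * (T3 * T4 * T5 * T6)))"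
proof -
  have "s * (qq * (qt * tI) * (B * F * A) / (tI * (K2 * Dp * P))) = s * (qq * qt * (B * F * A) / (K2 * Dp * P))"
    using assms by (simp add: mult_ac)
  then show ?thesis
    by (simp add: mult_ac)
qed

theorem corollary4p8:
  fixes q :: real and n \<tau> :: nat and t C0 :: complex
    and a b x :: "nat \<Rightarrow> complex"
    and \<Phi> :: "(nat \<Rightarrow> complex) \<Rightarrow> complex"
  assumes q: "0 < q" "q < 1"
    and n: "1 \<le> n"
    and tau: "1 \<le> \<tau>"
    and t: "t = of_real q ^ \<tau>"
    and a: "\<forall>i\<in>{1..2}. a i \<noteq> 0"
    and b: "\<forall>i\<in>{1..2}. b i \<noteq> 0"
    and conv: "\<forall>i\<in>{1..n}. q < norm (a 1 * a 2 * b 1 * b 2 * t ^ (2 * i - 2))"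
    and x: "\<forall>i\<in>{1..2}. x i \<noteq> 0"
    and xb: "\<forall>i\<in>{1..2}. \<forall>j\<in>{1..2}. \<forall>m::int. x i * b j \<noteq> of_real q powi m"
    and \<Phi>: "\<Phi> = (\<lambda>z.
          (\<Prod>i=1..n. z i ^ ((n - 1) * \<tau>)
             * (qinf q (of_real q * inverse (a 1) * z i) / qinf q (b 1 * z i))
             * (qinf q (of_real q * inverse (a 2) * z i) / qinf q (b 2 * z i)))
          * (\<Prod>k=1..n. \<Prod>j=1..<k. qfin q (z j / z k) \<tau> * qfin q (z k / z j) \<tau>))"
    and C0: "C0 = (1 - of_real q) ^ n *
          (\<Prod>k=1..n.
             (qinf q (of_real q) * qinf q t *
               (\<Prod>i=1..2. \<Prod>j=1..2.
                  qinf q (of_real q * inverse (a i) * inverse (b j) * inverse (t ^ (k - 1)))))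
             / (qinf q (t ^ k) *
                qinf q (of_real q * inverse (a 1) * inverse (a 2) * inverse (b 1) * inverse (b 2)
                        * inverse (t ^ (n + k - 2)))))"
  shows "jackson_iter_converges q (x 1) (x 2) n \<Phi> (\<lambda>_. 0) \<and>
         1 / fact n * jackson_iter q (x 1) (x 2) n \<Phi> (\<lambda>_. 0) =
         C0 * (\<Prod>j=1..n.
           ((x 1 * x 2 * of_real q ^ ((j - 1) * \<tau>)) ^ ((n - j) * \<tau>) * x 2
             * qtheta q (x 1 / x 2)
             * qtheta q (x 1 * x 2 * b 1 * b 2 * of_real q ^ ((n + j - 2) * \<tau>)))
           / (qtheta q (x 1 * b 1 * of_real q ^ ((j - 1) * \<tau>))
              * qtheta q (x 1 * b 2 * of_real q ^ ((j - 1) * \<tau>))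
              * qtheta q (x 2 * b 1 * of_real q ^ ((j - 1) * \<tau>))
              * qtheta q (x 2 * b 2 * of_real q ^ ((j - 1) * \<tau>))))"
proof -
  define a1 a2 b1 b2 x1 x2 where "a1 = a 1" and "a2 = a 2" and "b1 = b 1" and "b2 = b 2"
    and "x1 = x 1" and "x2 = x 2"
  note defs = a1_def a2_def b1_def b2_def x1_def x2_def
  have nz: "a1 \<noteq> 0" "a2 \<noteq> 0" "b1 \<noteq> 0" "b2 \<noteq> 0" and xnz: "x1 \<noteq> 0" "x2 \<noteq> 0"
    using a b x by (auto simp: defs)
  have qn: "complex_of_real q \<noteq> 0" using q by simp
  define c1 c2 where "c1 = inverse a1" and "c2 = inverse a2"
  have c: "c1 \<noteq> 0" "c2 \<noteq> 0"
    using nz by (auto simp: c1_def c2_def)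
  define p where "p = a1 * a2 * b1 * b2"
  have p0: "p \<noteq> 0" using nz by (simp add: p_def)
  have adm: "admissible q x1 x2 b1 b2"
    unfolding admissible_def[OF q xnz] using xb nz by (auto simp: off_lattice_def defs)
  \<comment> \<open>The instance \<open>i = n\<close>, the strongest one because
    \<open>norm t < 1\<close>.\<close>
  have pconv: "q < norm p * q ^ ((2 * n - 2) * \<tau>)"
    using conv[rule_format, of n] n q
    by (simp add: p_def defs t norm_mult norm_power power_mult[symmetric] mult.commute)
  have pm: "qfin q p m \<noteq> 0" if m: "m \<le> (2 * n - 2) * \<tau>" for m
  proof
    assume "qfin q p m = 0"
    then obtain i where i: "i < m" "of_real q ^ i * p = 1"
      by (auto simp: qfin_eq_0_iff)
    have "norm (of_real q ^ i * p) = q ^ i * norm p"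
      using q by (simp add: norm_mult norm_power)
    then have "q ^ i * norm p = 1"
      using i(2) by simp
    moreover have "q ^ ((2 * n - 2) * \<tau>) \<le> q ^ Suc i"
      using i(1) m q by (intro power_decreasing) auto
    then have "norm p * q ^ ((2 * n - 2) * \<tau>) \<le> norm p * q ^ Suc i"
      by (intro mult_left_mono) auto
    ultimately show False
      using pconv by (simp add: mult_ac)
  qed
  have "c1 * c2 * p = b1 * b2"
    using nz by (simp add: c1_def c2_def p_def field_simps)
  then have eq: "norm (c1 * c2) * norm p = norm (b1 * b2)"
    by (metis norm_mult)
  have "norm (c1 * c2) * q < norm (c1 * c2) * norm p * q ^ ((2 * n - 2) * \<tau>)"
    unfolding mult.assoc[of "norm (c1 * c2)"] using c by (intro mult_strict_left_mono pconv) simp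
  then have cconv: "q * norm (c1 * c2) < norm (b1 * b2) * q ^ ((2 * n - 2) * \<tau>)"
    unfolding eq by (simp only: mult.commute)
  moreover have "norm (b1 * b2) * q ^ ((2 * n - 2) * \<tau>) \<le> norm (b1 * b2) * 1"
    using q by (intro mult_left_mono power_le_one) auto
  ultimately have cconv': "q * norm (c1 * c2) < norm (b1 * b2)"
    by linarith

  obtain E C where E: "finite E" "\<And>k i. k \<in> E \<Longrightarrow> i \<notin> {1..n} \<Longrightarrow> k i = 0"
    and C: "\<And>y. qdisc q \<tau> {1..n} y = (\<Sum>k\<in>E. C k * newton q {1..n} k y)"
    and bounds: "\<And>k. k \<in> E \<Longrightarrow> C k \<noteq> 0 \<Longrightarrow>
      \<exists>f. bij_betw f {..<n} {1..n} \<and> (\<forall>i<n. i * \<tau> \<le> k (f i) \<and> k (f i) \<le> (n - 1 + i) * \<tau>)"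
    using qdisc_expansion[OF q finite_atLeastAtMost, of 1 n n \<tau>] tau by auto
  have le: "\<forall>k\<in>E. C k \<noteq> 0 \<longrightarrow> (\<forall>i\<in>{1..n}. k i \<le> (2 * n - 2) * \<tau>)"
  proof (intro ballI impI)
    fix k i assume k: "k \<in> E" "C k \<noteq> 0" "i \<in> {1..n}"
    obtain f where f: "bij_betw f {..<n} {1..n}" "\<And>i. i < n \<Longrightarrow> k (f i) \<le> (n - 1 + i) * \<tau>"
      using bounds[OF k(1,2)] by blast
    obtain j where j: "j < n" "i = f j"
      using f(1) k(3) by (metis bij_betw_imp_surj_on imageE lessThan_iff)
    have "k i \<le> (n - 1 + j) * \<tau>"
      using f(2) j by simp
    also have "\<dots> \<le> (2 * n - 2) * \<tau>"
      using j(1) by (intro mult_right_mono) auto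
    finally show "k i \<le> (2 * n - 2) * \<tau>" .
  qed

  have \<Phi>': "\<Phi> = selberg_integrand q n \<tau> c1 c2 b1 b2"
    unfolding \<Phi> selberg_integrand_def wt_def c1_def c2_def defs by (simp add: mult_ac)
  define I where "I = (1 - of_real q) * wint q x1 x2 c1 c2 b1 b2"
  define J where "J = jackson_iter q x1 x2 n \<Phi> (\<lambda>_. 0)"
  define u v where "u = a1 * b1" and "v = a2 * b1"
  have args: "b1 / c1 = u" "b1 / c2 = v" "b1 * b2 / (c1 * c2) = p" "p / u = a2 * b2" "p / v = a1 * b2"
    and uv: "u \<noteq> 0" "v \<noteq> 0"
    using nz by (auto simp: c1_def c2_def u_def v_def p_def field_simps)
  have J: "b1 ^ (n * (n - 1) * \<tau>) * J = I ^ n * newton_sum q {1..n} E C u v p"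
    using jackson_iter_selberg(2)[OF q xnz adm c cconv E(1) C le, of "\<lambda>_. 0"]
    unfolding args J_def \<Phi>' I_def .

  define A where "A = qinf q (of_real q / (a1 * b1)) * qinf q (of_real q / (a1 * b2)) *
    qinf q (of_real q / (a2 * b1)) * qinf q (of_real q / (a2 * b2))"
  define \<Theta> where "\<Theta> = x2 * qtheta q (x1 / x2) * qtheta q (x1 * x2 * b1 * b2)
     / (qtheta q (x1 * b1) * qtheta q (x1 * b2) * qtheta q (x2 * b1) * qtheta q (x2 * b2))"
  have P0: "qinf q (of_real q / p) \<noteq> 0"
  proof (rule qinf_nonzero_of_norm_less_1[OF q])
    have "norm p * q ^ ((2 * n - 2) * \<tau>) \<le> norm p * 1"
      using q by (intro mult_left_mono power_le_one) auto
    with pconv have "q < norm p"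
      by linarith
    then show "norm (of_real q / p) < 1"
      using p0 q by (simp add: norm_divide divide_less_eq)
  qed
  have I: "I = (1 - of_real q) * qinf q (of_real q) * A / qinf q (of_real q / p) * \<Theta>"
  proof -
    have "of_real q * c1 * c2 / (b1 * b2) = of_real q / p" "of_real q * c1 / b1 = of_real q / (a1 * b1)"
      "of_real q * c1 / b2 = of_real q / (a1 * b2)" "of_real q * c2 / b1 = of_real q / (a2 * b1)"
      "of_real q * c2 / b2 = of_real q / (a2 * b2)"
      using nz by (auto simp: c1_def c2_def p_def field_simps)
    with wint_eq[OF q xnz adm cconv']
    have "qinf q (of_real q / p) * wint q x1 x2 c1 c2 b1 b2 = qinf q (of_real q) * A * \<Theta>"
      by (simp add: A_def \<Theta>_def)
    then show ?thesis
      unfolding I_def using P0 by (simp add: field_simps)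
  qed

  define G where "G i = (a1 * a2 * of_real q ^ (i * \<tau>)) ^ ((n - 1 - i) * \<tau>) * qfin q (of_real q ^ \<tau>) (i * \<tau>)
      * (qfin q (a1 * b1) (i * \<tau>) * qfin q (a1 * b2) (i * \<tau>) * qfin q (a2 * b1) (i * \<tau>) * qfin q (a2 * b2) (i * \<tau>))
      / qfin q p ((n - 1 + i) * \<tau>)" for i
  have lhs: "1 / fact n * J = (\<Prod>i<n. I * G i)"
  \<comment> \<open>If \<open>I = 0\<close>, the conditions of \<open>newton_sum_value\<close> may
    fail, but then \<open>J\<close> and the product both vanish, as \<open>n \<ge> 1\<close>.
    Otherwise they hold because the factor \<open>A\<close> of \<open>I\<close> is nonzero.\<close>
  proof (cases "I = 0")
    case True
    then have "J = 0"
      using J n nz by (simp add: power_0_left)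
    moreover have "(\<Prod>i<n. I * G i) = 0"
      using True n by (auto intro!: bexI[of _ 0])
    ultimately show ?thesis by simp
  next
    case False
    then have "A \<noteq> 0"
      using I by auto
    then have quv: "qinf q (of_real q / u) \<noteq> 0" "qinf q (of_real q / v) \<noteq> 0"
      by (auto simp: A_def u_def v_def)
    define W where "W i = qfin q (of_real q ^ \<tau>) (i * \<tau>)
      * (qfin q u (i * \<tau>) * qfin q v (i * \<tau>) * qfin q (p / u) (i * \<tau>) * qfin q (p / v) (i * \<tau>))
      / qfin q p ((n - 1 + i) * \<tau>)" for i
    define R where "R i = (complex_of_real q ^ (i * \<tau>)) ^ ((n - 1 - i) * \<tau>)" for i
    have "newton_sum q {1..n} E C u v p = fact n * (\<Prod>i<n. (u * v) ^ (i * \<tau>) * R i * W i)"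
    proof -
      have "newton_sum q {1..n} E C u v p = fact n *
        (\<Prod>i<n. (u * v) ^ (i * \<tau>) * (of_real q ^ (i * \<tau>)) ^ ((n - 1 - i) * \<tau>) * qfin q (of_real q ^ \<tau>) (i * \<tau>)
          * (qfin q u (i * \<tau>) * qfin q v (i * \<tau>) * qfin q (p / u) (i * \<tau>) * qfin q (p / v) (i * \<tau>))
          / qfin q p ((n - 1 + i) * \<tau>))"
      proof (rule newton_sum_value[where E = E and c = C, OF q _ uv quv E(1) _ C _ le])
        show "k i = 0" if "k \<in> E" "i \<notin> {1..n}" for k i
          using that by (rule E(2))
        show "\<exists>f. bij_betw f {..<n} {1..n} \<and> (\<forall>i<n. i * \<tau> \<le> k (f i) \<and> k (f i) \<le> (n - 1 + i) * \<tau>)"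
          if "k \<in> E" "C k \<noteq> 0" for k
          using that by (rule bounds)
      qed (use tau pm in auto)
      then show ?thesis
        by (simp add: W_def R_def mult.assoc)
    qed
    also have "(\<Prod>i<n. (u * v) ^ (i * \<tau>) * R i * W i) =
        (\<Prod>i<n. b1 ^ (i * \<tau>)) * (\<Prod>i<n. b1 ^ (i * \<tau>)) * (\<Prod>i<n. (a1 * a2) ^ (i * \<tau>)) * (\<Prod>i<n. R i * W i)"
      unfolding prod.distrib[symmetric]
      by (intro prod.cong refl) (simp add: u_def v_def power_mult_distrib mult_ac)
    \<comment> \<open>Both \<open>u\<close> and \<open>v\<close> contain \<open>b1\<close>; their
      powers together make up exactly the power of \<open>b1\<close> that accompanies
      \<open>J\<close>.\<close>
    also have "(\<Prod>i<n. b1 ^ (i * \<tau>)) * (\<Prod>i<n. b1 ^ (i * \<tau>)) = b1 ^ (n * (n - 1) * \<tau>)"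
      using sum_offset_index[of n \<tau>] by (simp flip: power_sum power_add add: mult_2 mult.assoc)
    \<comment> \<open>Index reversal, so that these powers can be joined with \<open>R i\<close>,
      whose exponent is \<open>(n - 1 - i) * \<tau>\<close>.\<close>
    also have "(\<Prod>i<n. (a1 * a2) ^ (i * \<tau>)) = (\<Prod>i<n. (a1 * a2) ^ ((n - 1 - i) * \<tau>))"
      using prod.nat_diff_reindex[of "\<lambda>i. (a1 * a2) ^ (i * \<tau>)" n] by simp
    also have "b1 ^ (n * (n - 1) * \<tau>) * (\<Prod>i<n. (a1 * a2) ^ ((n - 1 - i) * \<tau>)) * (\<Prod>i<n. R i * W i)
       = b1 ^ (n * (n - 1) * \<tau>) * (\<Prod>i<n. (a1 * a2) ^ ((n - 1 - i) * \<tau>) * (R i * W i))"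
      by (simp only: prod.distrib mult.assoc)
    also have "(\<Prod>i<n. (a1 * a2) ^ ((n - 1 - i) * \<tau>) * (R i * W i)) = (\<Prod>i<n. G i)"
      unfolding G_def W_def R_def args u_def[symmetric] v_def[symmetric]
      by (intro prod.cong refl) (simp add: power_mult_distrib mult_ac)
    finally have "b1 ^ (n * (n - 1) * \<tau>) * J = b1 ^ (n * (n - 1) * \<tau>) * (I ^ n * fact n * (\<Prod>i<n. G i))"
      unfolding J by (simp only: mult_ac)
    then have "J = I ^ n * fact n * (\<Prod>i<n. G i)"
      using nz by simp
    then show ?thesis
      by (simp add: prod.distrib)
  qed

  \<comment> \<open>The theorem holds factor by factor: \<open>i\<close> corresponds to
    \<open>j = k = i + 1\<close> in the two products.\<close>
  have factor: "I * G i = (1 - of_real q) * ((qinf q (of_real q) * qinf q t *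
               (\<Prod>i'=1..2. \<Prod>j=1..2.
                  qinf q (of_real q * inverse (a i') * inverse (b j) * inverse (t ^ i))))
             / (qinf q (t ^ Suc i) *
                qinf q (of_real q * inverse (a 1) * inverse (a 2) * inverse (b 1) * inverse (b 2)
                        * inverse (t ^ (n - 1 + i))))) *
          (((x 1 * x 2 * of_real q ^ (i * \<tau>)) ^ ((n - 1 - i) * \<tau>) * x 2
             * qtheta q (x 1 / x 2)
             * qtheta q (x 1 * x 2 * b 1 * b 2 * of_real q ^ ((n - 1 + i) * \<tau>)))
           / (qtheta q (x 1 * b 1 * of_real q ^ (i * \<tau>))
              * qtheta q (x 1 * b 2 * of_real q ^ (i * \<tau>))
              * qtheta q (x 2 * b 1 * of_real q ^ (i * \<tau>))
              * qtheta q (x 2 * b 2 * of_real q ^ (i * \<tau>))))" if i: "i < n" for i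
  proof -
    define m e where "m = i * \<tau>" and "e = (n - 1 - i) * \<tau>"
    have "n - 1 + i = (n - 1 - i) + i + i"
      using i by simp
    then have m': "(n - 1 + i) * \<tau> = e + m + m"
      by (simp only: m_def e_def add_mult_distrib)
    define \<kappa> \<kappa>' Q where "\<kappa> = theta_factor q m" and "\<kappa>' = theta_factor q (e + m + m)"
      and "Q = complex_of_real q ^ m"
    have \<kappa>: "\<kappa> \<noteq> 0" "\<kappa>' \<noteq> 0"
      unfolding \<kappa>_def \<kappa>'_def by (rule theta_factor_nonzero[OF q])+
    have t_power: "t ^ j = of_real q ^ (j * \<tau>)" for j
      by (simp add: t power_mult[symmetric] mult.commute)
    have ti: "t ^ i = of_real q ^ m" "t ^ (n - 1 + i) = of_real q ^ (e + m + m)"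
      unfolding t_power m' by (simp_all only: m_def)
    have qi: "qinf q (of_real q * inverse y1 * inverse y2 * inverse (of_real q ^ m)) =
        \<kappa> / (y1 * y2) ^ m * qfin q (y1 * y2) m * qinf q (of_real q / (y1 * y2))" if "y1 \<noteq> 0" "y2 \<noteq> 0" for y1 y2
      using qinf_div_mult_power[OF q, of "y1 * y2" m] that by (simp add: \<kappa>_def field_simps)
    have qp: "qinf q (of_real q * inverse a1 * inverse a2 * inverse b1 * inverse b2 * inverse (of_real q ^ (e + m + m))) =
        \<kappa>' / p ^ (e + m + m) * qfin q p (e + m + m) * qinf q (of_real q / p)"
      using qinf_div_mult_power[OF q p0, of "e + m + m"] nz by (simp add: \<kappa>'_def p_def field_simps)
    have th: "qtheta q (y1 * y2 * of_real q ^ m) = \<kappa> / (y1 * y2) ^ m * qtheta q (y1 * y2)"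
      if "y1 \<noteq> 0" "y2 \<noteq> 0" for y1 y2
      unfolding \<kappa>_def using that by (intro qtheta_mult_power[OF q]) simp
    have th': "qtheta q (x1 * x2 * b1 * b2 * of_real q ^ (e + m + m)) =
        \<kappa>' / (x1 * x2 * b1 * b2) ^ (e + m + m) * qtheta q (x1 * x2 * b1 * b2)"
      unfolding \<kappa>'_def using nz xnz by (intro qtheta_mult_power[OF q]) simp
    have tt: "qinf q t = qfin q t m * qinf q (t ^ Suc i)"
      using qfin_mult_qinf[OF q, of t m] by (simp add: ti(1)[symmetric] mult.commute)
    have tn: "qinf q (t ^ Suc i) \<noteq> 0"
    proof (rule qinf_nonzero_of_norm_less_1[OF q])
      have "norm (t ^ Suc i) = q ^ (\<tau> * Suc i)"
        using q by (simp add: t norm_power norm_mult power_mult power_add)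
      also have "\<dots> < 1"
        using q tau power_strict_decreasing[of 0 "\<tau> * Suc i" q] by simp
      finally show "norm (t ^ Suc i) < 1" .
    qed
    have four: "(\<Prod>i'=1..2. \<Prod>j=1..2. h (a i') (b j)) = h a1 b1 * h a1 b2 * h a2 b1 * h a2 b2"
      for h :: "complex \<Rightarrow> complex \<Rightarrow> complex"
      by (simp add: defs numeral_2_eq_2 mult_ac)
    define F where "F = qfin q (a1 * b1) m * qfin q (a1 * b2) m * qfin q (a2 * b1) m * qfin q (a2 * b2) m"
    define B where "B = (\<kappa> / (a1 * b1) ^ m) * (\<kappa> / (a1 * b2) ^ m) * (\<kappa> / (a2 * b1) ^ m) * (\<kappa> / (a2 * b2) ^ m)"
    define D where "D = (\<kappa> / (x1 * b1) ^ m) * (\<kappa> / (x1 * b2) ^ m) * (\<kappa> / (x2 * b1) ^ m) * (\<kappa> / (x2 * b2) ^ m)"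
    \<comment> \<open>The power of \<open>a1 * a2 * Q\<close> in \<open>G i\<close> is traded for
      the monomials of the shifted thetas and infinite products, which brings in the power of
      \<open>x1 * x2 * Q\<close> of the final formula.\<close>
    have mono: "B * (x1 * x2 * Q) ^ e * (\<kappa>' / (x1 * x2 * b1 * b2) ^ (e + m + m))
        / (\<kappa>' / p ^ (e + m + m) * D) = (a1 * a2 * Q) ^ e"
      unfolding B_def D_def p_def power_mult_distrib[of "a1 * a2" Q]
      by (rule quadratic_monomial_cancel[OF nz xnz \<kappa>])
    have prods: "(\<Prod>i'=1..2. \<Prod>j=1..2. qinf q (of_real q * inverse (a i') * inverse (b j) * inverse (t ^ i))) = B * F * A"
      unfolding four[of "\<lambda>y1 y2. qinf q (of_real q * inverse y1 * inverse y2 * inverse (of_real q ^ m))"] ti(1) qi[OF nz(1) nz(3)] qi[OF nz(1) nz(4)] qi[OF nz(2) nz(3)] qi[OF nz(2) nz(4)]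
      by (simp only: B_def F_def A_def mult_ac)
    have thetas: "qtheta q (x1 * b1 * of_real q ^ m) * qtheta q (x1 * b2 * of_real q ^ m) *
        qtheta q (x2 * b1 * of_real q ^ m) * qtheta q (x2 * b2 * of_real q ^ m) =
        D * (qtheta q (x1 * b1) * qtheta q (x1 * b2) * qtheta q (x2 * b1) * qtheta q (x2 * b2))"
      unfolding th[OF xnz(1) nz(3)] th[OF xnz(1) nz(4)] th[OF xnz(2) nz(3)] th[OF xnz(2) nz(4)]
      by (simp only: D_def mult_ac)
    have "I * G i = (1 - of_real q) * qinf q (of_real q) * A / qinf q (of_real q / p) * \<Theta> *
        ((a1 * a2 * Q) ^ e * qfin q t m * F / qfin q p (e + m + m))"
      unfolding I G_def m' Q_def F_def m_def[symmetric] e_def[symmetric] t[symmetric] ..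
    also have "\<dots> = (1 - of_real q) * ((qinf q (of_real q) * qinf q t * (B * F * A))
             / (qinf q (t ^ Suc i) * (\<kappa>' / p ^ (e + m + m) * qfin q p (e + m + m) * qinf q (of_real q / p)))) *
          (((x1 * x2 * Q) ^ e * x2 * qtheta q (x1 / x2)
             * (\<kappa>' / (x1 * x2 * b1 * b2) ^ (e + m + m) * qtheta q (x1 * x2 * b1 * b2)))
           / (D * (qtheta q (x1 * b1) * qtheta q (x1 * b2) * qtheta q (x2 * b1) * qtheta q (x2 * b2))))"
      unfolding mono[symmetric] \<Theta>_def tt by (rule factor_rearrange[OF tn])
    finally show ?thesis
      unfolding prods ti(2) defs[symmetric] qp m' th' m_def[symmetric] e_def[symmetric] thetas Q_def .
  qed

  have "1 / fact n * J = (\<Prod>i<n. I * G i)"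
    by (rule lhs)
  also have "\<dots> = C0 * (\<Prod>j=1..n.
           ((x 1 * x 2 * of_real q ^ ((j - 1) * \<tau>)) ^ ((n - j) * \<tau>) * x 2
             * qtheta q (x 1 / x 2)
             * qtheta q (x 1 * x 2 * b 1 * b 2 * of_real q ^ ((n + j - 2) * \<tau>)))
           / (qtheta q (x 1 * b 1 * of_real q ^ ((j - 1) * \<tau>))
              * qtheta q (x 1 * b 2 * of_real q ^ ((j - 1) * \<tau>))
              * qtheta q (x 2 * b 1 * of_real q ^ ((j - 1) * \<tau>))
              * qtheta q (x 2 * b 2 * of_real q ^ ((j - 1) * \<tau>))))"
  proof -
    have idx: "Suc i - 1 = i" "n - Suc i = n - 1 - i" "n + Suc i - 2 = n - 1 + i" for i
      using n by auto
    have const: "(1 - complex_of_real q) ^ n = (\<Prod>i<n. 1 - of_real q)"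
      by simp
    show ?thesis
      unfolding C0 One_nat_def prod.atLeast1_atMost_eq[of _ n] const prod.distrib[symmetric]
      unfolding One_nat_def[symmetric] idx
      by (rule prod.cong[OF refl], rule factor) simp
  qed
  finally have "1 / fact n * J = C0 * (\<Prod>j=1..n.
           ((x 1 * x 2 * of_real q ^ ((j - 1) * \<tau>)) ^ ((n - j) * \<tau>) * x 2
             * qtheta q (x 1 / x 2)
             * qtheta q (x 1 * x 2 * b 1 * b 2 * of_real q ^ ((n + j - 2) * \<tau>)))
           / (qtheta q (x 1 * b 1 * of_real q ^ ((j - 1) * \<tau>))
              * qtheta q (x 1 * b 2 * of_real q ^ ((j - 1) * \<tau>))
              * qtheta q (x 2 * b 1 * of_real q ^ ((j - 1) * \<tau>))
              * qtheta q (x 2 * b 2 * of_real q ^ ((j - 1) * \<tau>))))" .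
  then show ?thesis
    using jackson_iter_selberg(1)[OF q xnz adm c cconv E(1) C le, of "\<lambda>_. 0"]
    unfolding J_def \<Phi>'[symmetric] x1_def x2_def by blast
qed

end
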